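(* Let $(M,g)$ be a spacetime whose cosmological time function $\tau_g$ is regular and smooth, $\tau_g : M \to (0,\infty)$. For each $t > 0$, if the level set $M_t = \tau_g^{-1}(t)$ is nonempty, denote by $h_t$ the Riemannian metric induced by $g$ on $M_t$ and by $d_{h_t}$ the corresponding distance function. Let $\overline{M}$ be the metric completion of $(M,\hat{d}_{\tau_g})$, where $\hat{d}_{\tau_g}$ is the null distance associated with $\tau_g$, and let $\overline{\tau_g} : \overline{M} \to [0,\infty)$ be the unique $1$-Lipschitz extension of $\tau_g$ to $\overline{M}$. If $$\lim_{t \to 0^+} \operatorname{diam}_{d_{h_t}}(M_t) = 0,$$ then the initial level set $\overline{\tau_g}^{-1}(0) \subseteq \overline{M}$ consists of a single point $p_{BB} \in \overline{M}$.
   Context: A Lorentzian manifold is a smooth manifold $M$ of dimension $n+1$ with a metric tensor $g$ of signature $(1,n)$ (one negative, $n$ positive directions). A nonzero tangent vector $X$ is timelike, null or spacelike if $g(X,X)$ is negative, zero or positive; causal means timelike or null. A time orientation is a smooth timelike vector field $\vartheta$; a causal vector $X$ is future-directed if $g(X,\vartheta)<0$ and past-directed if $g(X,\vartheta)>0$. A spacetime is a connected, time-oriented Lorentzian manifold. A smooth curve is causal if its tangent vector is everywhere causal; it is future-directed (past-directed) if its tangent vector is everywhere future-directed (past-directed). Write $p \le q$ if $p=q$ or there is a future-directed causal curve from $p$ to $q$. The Lorentzian length of a causal curve $\gamma: I\to M$ is $L_g(\gamma) = \int_I \sqrt{-g(\gamma',\gamma')}\,ds$. The Lorentzian distance $d_g(p,q)$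 is the supremum of $L_g(\gamma)$ over future-directed causal curves $\gamma$ from $p$ to $q$, with $d_g(p,q)=0$ if $q=p$ or $p\not\le q$. The cosmological time function $\tau_g : M\to[0,\infty]$ is $\tau_g(q) = \sup_{p\le q} d_g(p,q)$. A future-directed causal curve $\gamma:(a,b)\to M$ is past inextendible if there is no $p\in M$ with $\lim_{s\to a^+}\gamma(s)=p$. The function $\tau_g$ is regular if (i) $\tau_g(q)<\infty$ for all $q\in M$, and (ii) $\tau_g\to 0$ along every past inextendible future-directed causal curve (i.e. $\tau_g(\gamma(s))\to 0$ as $s\to a^+$). A time function is a continuous function $\tau: M \to \mathbb{R}$ strictly increasing along all future-directed causal curves. A (continuous) curve $\beta : [a,b] \to M$ is piecewise causal if there is a partition $a = s_0 < \dots < s_N = b$ such that each restriction $\beta|_{[s_i,s_{i+1}]}$ is either a future-directed or a past-directed causal curve. For a time function $\tau$, the null length of $\beta$ is $\hat{L}_\tau(\beta) = \sum_{i=0}^{N-1} |\tau(\beta(s_{i+1})) - \tau(\beta(s_i))|$, and the null distance is $\hat{d}_\tau(p,q) = \inf\{\hat{L}_\tau(\beta) \mid \beta \text{ a piecewise causal curve from } p \text{ to } q\}$, with $\hat{d}_\tau(p,p)=0$. A smooth regular $\tau_g$ is a time function whose gradient is everywhere a past-directed timelike unit vector, so that its nonempty level sets are spacelike hypersurfaces, $\hat d_{\tau_g}$ is a metric inducing the manifold topology, and $\tau_g$ is $1$-Lipschitz with respect to $\hat d_{\tau_g}$; hence $h_t$, $\overline{M}$ and $\overline{\tau_g}$ are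 well defined. Distance functions may take the value $\infty$ (e.g. $d_{h_t}$ between different connected components of $M_t$). $\operatorname{diam}_d(S)=\sup_{x,y\in S} d(x,y)$. *)

theory Defs
  imports "HOL-Analysis.Analysis"
begin

text \<open>
  All derivatives are taken within \<open>S\<close>, so that the notion covers open sets and also curves
  on closed intervals, with one-sided derivatives of all orders at the end points. It is used only
  for sets \<open>S\<close> on which derivatives within \<open>S\<close> are unique: open sets and
  relatively open subsets of nondegenerate intervals.
\<close>

primrec Ck_on :: "nat \<Rightarrow> 'x::euclidean_space set \<Rightarrow> ('x \<Rightarrow> 'y::euclidean_space) \<Rightarrow> bool" where
  "Ck_on 0 S f \<longleftrightarrow> continuous_on S f"
| "Ck_on (Suc k) S f \<longleftrightarrow>
     f differentiable_on S \<and> (\<forall>v. Ck_on k S (\<lambda>x. frechet_derivative f (at x within S) v))"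

definition smooth_on :: "'x::euclidean_space set \<Rightarrow> ('x \<Rightarrow> 'y::euclidean_space) \<Rightarrow> bool" where
  "smooth_on S f \<longleftrightarrow> (\<forall>k. Ck_on k S f)"

text \<open>
  The manifold is the whole type \<open>'a\<close> with its Hausdorff, second countable topology; it is
  modelled on \<open>'e\<close>, so its dimension \<open>n + 1\<close> is \<open>DIM('e)\<close>. The atlas need not be maximal.
\<close>

type_synonym ('a, 'e) chart = "'a set \<times> ('a \<Rightarrow> 'e)"

definition chart_inv :: "('a, 'e) chart \<Rightarrow> 'e \<Rightarrow> 'a" where
  "chart_inv c = inv_into (fst c) (snd c)"

definition is_chart :: "('a::topological_space, 'e::euclidean_space) chart \<Rightarrow> bool" where
  "is_chart c \<longleftrightarrow> open (fst c) \<and> open (snd c ` fst c) \<and>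
     homeomorphism (fst c) (snd c ` fst c) (snd c) (chart_inv c)"

definition transition :: "('a, 'e) chart \<Rightarrow> ('a, 'e) chart \<Rightarrow> 'e \<Rightarrow> 'e" where
  "transition c d = snd d \<circ> chart_inv c"

definition charts_at :: "('a, 'e) chart set \<Rightarrow> 'a \<Rightarrow> ('a, 'e) chart set" where
  "charts_at A p = {c \<in> A. p \<in> fst c}"

locale smooth_manifold =
  fixes A :: "('a::{t2_space, second_countable_topology}, 'e::euclidean_space) chart set"
  assumes charts: "c \<in> A \<Longrightarrow> is_chart c"
    and cover: "(\<Union>c\<in>A. fst c) = UNIV"
    and compatible: "c \<in> A \<Longrightarrow> d \<in> A \<Longrightarrow> smooth_on (snd c ` (fst c \<inter> fst d)) (transition c d)"

definition smooth_fun :: "('a, 'e::euclidean_space) chart set \<Rightarrow> ('a \<Rightarrow> real) \<Rightarrow> bool" where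
  "smooth_fun A f \<longleftrightarrow> (\<forall>c\<in>A. smooth_on (snd c ` fst c) (f \<circ> chart_inv c))"

text \<open>
  A tangent vector at \<open>p\<close> is the family of its components in the charts around \<open>p\<close>, related by
  the derivatives of the transition maps; the value at all other charts is \<open>0\<close>, so that distinct
  families are distinct vectors.
\<close>

type_synonym ('a, 'e) tangent = "('a, 'e) chart \<Rightarrow> 'e"

definition tangent_space ::
  "('a, 'e::euclidean_space) chart set \<Rightarrow> 'a \<Rightarrow> ('a, 'e) tangent set" where
  "tangent_space A p = {v.
     (\<forall>c\<in>charts_at A p. \<forall>d\<in>charts_at A p.
        v d = frechet_derivative (transition c d) (at (snd c p)) (v c)) \<and>
     (\<forall>c. c \<notin> charts_at A p \<longrightarrow> v c = 0)}"

text \<open>The tangent vector at \<open>p\<close> whose component in the chart \<open>c\<close> is \<open>u\<close>.\<close>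

definition tangent_vec ::
  "('a, 'e::euclidean_space) chart set \<Rightarrow> ('a, 'e) chart \<Rightarrow> 'a \<Rightarrow> 'e \<Rightarrow> ('a, 'e) tangent" where
  "tangent_vec A c p u = (\<lambda>d. if d \<in> charts_at A p
     then frechet_derivative (transition c d) (at (snd c p)) u else 0)"

definition smooth_curve ::
  "('a::topological_space, 'e::euclidean_space) chart set \<Rightarrow> real set \<Rightarrow> (real \<Rightarrow> 'a) \<Rightarrow> bool" where
  "smooth_curve A I \<gamma> \<longleftrightarrow> continuous_on I \<gamma> \<and>
     (\<forall>c\<in>A. smooth_on (I \<inter> \<gamma> -` fst c) (snd c \<circ> \<gamma>))"

definition velocity ::
  "('a, 'e::euclidean_space) chart set \<Rightarrow> real set \<Rightarrow> (real \<Rightarrow> 'a) \<Rightarrow> real \<Rightarrow> ('a, 'e) tangent" where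
  "velocity A I \<gamma> s = (\<lambda>c. if c \<in> charts_at A (\<gamma> s)
     then vector_derivative (snd c \<circ> \<gamma>) (at s within I) else 0)"

text \<open>Signature \<open>(1, n)\<close>: an orthogonal basis with exactly one negative and no null vector.\<close>

definition lorentz_form :: "('e::euclidean_space \<Rightarrow> 'e \<Rightarrow> real) \<Rightarrow> bool" where
  "lorentz_form b \<longleftrightarrow> bilinear b \<and> (\<forall>u w. b u w = b w u) \<and>
     (\<exists>B e\<^sub>0. independent B \<and> span B = UNIV \<and> pairwise (\<lambda>u w. b u w = 0) B \<and>
        e\<^sub>0 \<in> B \<and> b e\<^sub>0 e\<^sub>0 < 0 \<and> (\<forall>e\<in>B - {e\<^sub>0}. 0 < b e e))"

type_synonym ('a, 'e) metric_tensor = "'a \<Rightarrow> ('a, 'e) tangent \<Rightarrow> ('a, 'e) tangent \<Rightarrow> real"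

definition metric_in_chart ::
  "('a, 'e::euclidean_space) chart set \<Rightarrow> ('a, 'e) metric_tensor \<Rightarrow> ('a, 'e) chart \<Rightarrow>
   'a \<Rightarrow> 'e \<Rightarrow> 'e \<Rightarrow> real" where
  "metric_in_chart A g c p u w = g p (tangent_vec A c p u) (tangent_vec A c p w)"

locale lorentzian_manifold = smooth_manifold A
  for A :: "('a::{t2_space, second_countable_topology}, 'e::euclidean_space) chart set" +
  fixes g :: "('a, 'e) metric_tensor"
  assumes signature: "c \<in> A \<Longrightarrow> p \<in> fst c \<Longrightarrow> lorentz_form (metric_in_chart A g c p)"
    and smooth_metric:
      "c \<in> A \<Longrightarrow> smooth_on (snd c ` fst c) (\<lambda>x. metric_in_chart A g c (chart_inv c x) u w)"

definition timelike :: "('a, 'e) metric_tensor \<Rightarrow> 'a \<Rightarrow> ('a, 'e::euclidean_space) tangent \<Rightarrow> bool" where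
  "timelike g p v \<longleftrightarrow> v \<noteq> (\<lambda>_. 0) \<and> g p v v < 0"

definition causal :: "('a, 'e) metric_tensor \<Rightarrow> 'a \<Rightarrow> ('a, 'e::euclidean_space) tangent \<Rightarrow> bool" where
  "causal g p v \<longleftrightarrow> v \<noteq> (\<lambda>_. 0) \<and> g p v v \<le> 0"

locale spacetime = lorentzian_manifold A g
  for A :: "('a::{t2_space, second_countable_topology}, 'e::euclidean_space) chart set"
    and g :: "('a, 'e) metric_tensor" +
  fixes \<theta> :: "'a \<Rightarrow> ('a, 'e) tangent"
  assumes connected: "connected (UNIV :: 'a set)"
    and orientation_tangent: "\<theta> p \<in> tangent_space A p"
    and orientation_smooth: "c \<in> A \<Longrightarrow> smooth_on (snd c ` fst c) (\<lambda>x. \<theta> (chart_inv c x) c)"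
    and orientation_timelike: "timelike g p (\<theta> p)"

context
  fixes A :: "('a::{t2_space, second_countable_topology}, 'e::euclidean_space) chart set"
    and g :: "('a, 'e) metric_tensor"
    and \<theta> :: "'a \<Rightarrow> ('a, 'e) tangent"
begin

definition future_causal_curve :: "real set \<Rightarrow> (real \<Rightarrow> 'a) \<Rightarrow> bool" where
  "future_causal_curve I \<gamma> \<longleftrightarrow> smooth_curve A I \<gamma> \<and>
     (\<forall>s\<in>I. causal g (\<gamma> s) (velocity A I \<gamma> s) \<and> g (\<gamma> s) (velocity A I \<gamma> s) (\<theta> (\<gamma> s)) < 0)"

definition past_causal_curve :: "real set \<Rightarrow> (real \<Rightarrow> 'a) \<Rightarrow> bool" where
  "past_causal_curve I \<gamma> \<longleftrightarrow> smooth_curve A I \<gamma> \<and>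
     (\<forall>s\<in>I. causal g (\<gamma> s) (velocity A I \<gamma> s) \<and> g (\<gamma> s) (velocity A I \<gamma> s) (\<theta> (\<gamma> s)) > 0)"

definition future_causal_from_to :: "real \<Rightarrow> real \<Rightarrow> (real \<Rightarrow> 'a) \<Rightarrow> 'a \<Rightarrow> 'a \<Rightarrow> bool" where
  "future_causal_from_to a b \<gamma> p q \<longleftrightarrow>
     a < b \<and> future_causal_curve {a..b} \<gamma> \<and> \<gamma> a = p \<and> \<gamma> b = q"

definition causal_le :: "'a \<Rightarrow> 'a \<Rightarrow> bool" where
  "causal_le p q \<longleftrightarrow> p = q \<or> (\<exists>a b \<gamma>. future_causal_from_to a b \<gamma> p q)"

definition lorentzian_length :: "real set \<Rightarrow> (real \<Rightarrow> 'a) \<Rightarrow> real" where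
  "lorentzian_length I \<gamma> =
     integral I (\<lambda>s. sqrt (- g (\<gamma> s) (velocity A I \<gamma> s) (velocity A I \<gamma> s)))"

definition lorentzian_dist :: "'a \<Rightarrow> 'a \<Rightarrow> ennreal" where
  "lorentzian_dist p q = (if p = q \<or> \<not> causal_le p q then 0
     else Sup {ennreal (lorentzian_length {a..b} \<gamma>) | a b \<gamma>. future_causal_from_to a b \<gamma> p q})"

definition cosmological_time :: "'a \<Rightarrow> ennreal" where
  "cosmological_time q = (SUP p\<in>{p. causal_le p q}. lorentzian_dist p q)"

definition past_inextendible :: "real \<Rightarrow> real \<Rightarrow> (real \<Rightarrow> 'a) \<Rightarrow> bool" where
  "past_inextendible a b \<gamma> \<longleftrightarrow>
     a < b \<and> future_causal_curve {a<..<b} \<gamma> \<and> \<not> (\<exists>p. (\<gamma> \<longlongrightarrow> p) (at_right a))"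

definition regular_cosmological_time :: bool where
  "regular_cosmological_time \<longleftrightarrow>
     (\<forall>q. cosmological_time q < \<infinity>) \<and>
     (\<forall>a b \<gamma>. past_inextendible a b \<gamma> \<longrightarrow>
        ((\<lambda>s. cosmological_time (\<gamma> s)) \<longlongrightarrow> 0) (at_right a))"

definition partition_points :: "nat \<Rightarrow> (nat \<Rightarrow> real) \<Rightarrow> bool" where
  "partition_points N s \<longleftrightarrow> 0 < N \<and> (\<forall>i<N. s i < s (Suc i))"

definition piecewise_causal :: "nat \<Rightarrow> (nat \<Rightarrow> real) \<Rightarrow> (real \<Rightarrow> 'a) \<Rightarrow> bool" where
  "piecewise_causal N s \<beta> \<longleftrightarrow> partition_points N s \<and> continuous_on {s 0..s N} \<beta> \<and>
     (\<forall>i<N. future_causal_curve {s i..s (Suc i)} \<beta> \<or> past_causal_curve {s i..s (Suc i)} \<beta>)"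

definition null_length :: "('a \<Rightarrow> real) \<Rightarrow> nat \<Rightarrow> (nat \<Rightarrow> real) \<Rightarrow> (real \<Rightarrow> 'a) \<Rightarrow> real" where
  "null_length \<tau> N s \<beta> = (\<Sum>i<N. \<bar>\<tau> (\<beta> (s (Suc i))) - \<tau> (\<beta> (s i))\<bar>)"

definition null_dist :: "('a \<Rightarrow> real) \<Rightarrow> 'a \<Rightarrow> 'a \<Rightarrow> ennreal" where
  "null_dist \<tau> p q = (if p = q then 0
     else Inf {ennreal (null_length \<tau> N s \<beta>) | N s \<beta>.
                 piecewise_causal N s \<beta> \<and> \<beta> (s 0) = p \<and> \<beta> (s N) = q})"

text \<open>
  The induced metric of an embedded hypersurface \<open>S\<close> is the restriction of \<open>g\<close> to vectors tangent
  to \<open>S\<close>, and the smooth curves of \<open>S\<close> are the smooth curves of the ambient manifold that run in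
  \<open>S\<close>. The distance is the infimum of the lengths of piecewise smooth curves in \<open>S\<close>; it
  is infinite if there are none.
\<close>

definition piecewise_smooth_in :: "'a set \<Rightarrow> nat \<Rightarrow> (nat \<Rightarrow> real) \<Rightarrow> (real \<Rightarrow> 'a) \<Rightarrow> bool" where
  "piecewise_smooth_in S N s \<sigma> \<longleftrightarrow> partition_points N s \<and> continuous_on {s 0..s N} \<sigma> \<and>
     \<sigma> ` {s 0..s N} \<subseteq> S \<and> (\<forall>i<N. smooth_curve A {s i..s (Suc i)} \<sigma>)"

definition induced_length :: "nat \<Rightarrow> (nat \<Rightarrow> real) \<Rightarrow> (real \<Rightarrow> 'a) \<Rightarrow> real" where
  "induced_length N s \<sigma> = (\<Sum>i<N. integral {s i..s (Suc i)} (\<lambda>r.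
     sqrt (g (\<sigma> r) (velocity A {s i..s (Suc i)} \<sigma> r) (velocity A {s i..s (Suc i)} \<sigma> r))))"

definition induced_dist :: "'a set \<Rightarrow> 'a \<Rightarrow> 'a \<Rightarrow> ennreal" where
  "induced_dist S p q = Inf {ennreal (induced_length N s \<sigma>) | N s \<sigma>.
     piecewise_smooth_in S N s \<sigma> \<and> \<sigma> (s 0) = p \<and> \<sigma> (s N) = q}"

end

definition diam :: "('a \<Rightarrow> 'a \<Rightarrow> ennreal) \<Rightarrow> 'a set \<Rightarrow> ennreal" where
  "diam d S = (SUP x\<in>S. SUP y\<in>S. d x y)"

definition is_completion ::
  "('a \<Rightarrow> 'a \<Rightarrow> ennreal) \<Rightarrow> 'b set \<Rightarrow> ('b \<Rightarrow> 'b \<Rightarrow> real) \<Rightarrow> ('a \<Rightarrow> 'b) \<Rightarrow> bool" where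
  "is_completion d X dX \<iota> \<longleftrightarrow>
     Metric_space X dX \<and> Metric_space.mcomplete X dX \<and>
     range \<iota> \<subseteq> X \<and> (\<forall>p q. ennreal (dX (\<iota> p) (\<iota> q)) = d p q) \<and>
     Metric_space.mtopology X dX closure_of range \<iota> = X"

definition lipschitz1_on :: "'b set \<Rightarrow> ('b \<Rightarrow> 'b \<Rightarrow> real) \<Rightarrow> ('b \<Rightarrow> real) \<Rightarrow> bool" where
  "lipschitz1_on X dX f \<longleftrightarrow> (\<forall>x\<in>X. \<forall>y\<in>X. \<bar>f x - f y\<bar> \<le> dX x y)"

end

theory Submission
  imports Defs "HOL-Computational_Algebra.Polynomial"
begin

text \<open>
  Null distance only records the change of the cosmological time \<open>\<tau>\<close> along a zigzag: it is at most
  \<open>\<tau> q - \<tau> p\<close> if \<open>p \<le> q\<close>. Let \<open>p\<close> and \<open>q\<close> have small \<open>\<tau>\<close>, say \<open>\<tau> p \<le> \<tau> q\<close>. Following an almost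
  maximal causal curve into the past of \<open>q\<close> down to the level of \<open>p\<close> costs null distance
  \<open>\<tau> q - \<tau> p\<close> (\<open>descend_to_level\<close>). On that level the two points are joined by a curve that is short in
  the induced Riemannian metric, and such a curve can be replaced by a fine zigzag of timelike
  segments whose null length is at most three times its Riemannian length
  (\<open>D_le_level_curve_length\<close>). So points with small \<open>\<tau>\<close> are uniformly close to each other
  (\<open>D_small_for_small_tau\<close>). A sequence along which \<open>\<tau>\<close> tends to \<open>0\<close> is then Cauchy, its limit lies on
  the initial level, and any two points of the initial level are at distance \<open>0\<close>.

  Comparing null length with Riemannian length requires that the gradient of \<open>\<tau>\<close> is timelike
  with a norm bounded from below and above. One half is \<open>dtau_timelike_ge\<close>: the differential of \<open>\<tau>\<close> is at
  least the Lorentzian norm on future timelike vectors, since an almost maximal curve can be prolonged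
  by a short timelike segment. The Lorentzian distance is a supremum over smooth curves, so the
  corner of the prolonged curve has to be rounded off without losing causality or much length
  (\<open>append_timelike_segment\<close>). The other half is \<open>almost_minimal_direction\<close>: at each point some future
  unit vector \<open>u\<close> satisfies \<open>d\<tau>(u) \<le> 11/10\<close>. It is proved without maximising geodesics: if \<open>d\<tau>\<close>
  exceeded \<open>11/10\<close> times the norm near a point, curves ending there could not be almost maximal. The
  two halves together make the tangent vectors of a level set spacelike and almost orthogonal to \<open>u\<close>
  (\<open>lorentz_near_minimal\<close>), which is what the zigzag needs (\<open>zigzag_bound\<close>).
\<close>

section \<open>Iterated differentiability on thick sets\<close>

text \<open>
  A condition under which derivatives within a set are unique. It covers open sets and
  nondegenerate intervals together with their relatively open subsets, so that coordinate
  functions and curves with end points obey the same calculus.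
\<close>

definition thick :: "'x::euclidean_space set \<Rightarrow> bool" where
  "thick S \<longleftrightarrow> (\<forall>x\<in>S. \<forall>i\<in>Basis. \<forall>e>0. \<exists>d. 0 < \<bar>d\<bar> \<and> \<bar>d\<bar> < e \<and> x + d *\<^sub>R i \<in> S)"

lemma frechet_derivative_thick:
  fixes f :: "'x::euclidean_space \<Rightarrow> 'y::real_normed_vector"
  assumes "thick S" "x \<in> S" "(f has_derivative D) (at x within S)"
  shows "frechet_derivative f (at x within S) = D"
proof -
  have "(f has_derivative frechet_derivative f (at x within S)) (at x within S)"
    using assms(3) differentiable_def frechet_derivative_works by blast
  then show ?thesis
    using assms by (intro frechet_derivative_unique_within[of f]) (auto simp: thick_def)
qed

lemma thick_Int_open:
  assumes "thick S" "open N" shows "thick (S \<inter> N)"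
  unfolding thick_def
proof (intro ballI allI impI)
  fix x i and e :: real assume x: "x \<in> S \<inter> N" and i: "i \<in> (Basis :: 'a set)" and "e > 0"
  obtain r where r: "r > 0" "ball x r \<subseteq> N" using assms(2) x open_contains_ball by blast
  obtain d where d: "0 < \<bar>d\<bar>" "\<bar>d\<bar> < min e r" "x + d *\<^sub>R i \<in> S"
    using assms(1) x i \<open>e > 0\<close> r(1) unfolding thick_def by (metis IntD1 min_less_iff_conj)
  moreover have "x + d *\<^sub>R i \<in> N" using r(2) d(2) i by (auto simp: subset_iff dist_norm)
  ultimately show "\<exists>d. 0 < \<bar>d\<bar> \<and> \<bar>d\<bar> < e \<and> x + d *\<^sub>R i \<in> S \<inter> N" by auto
qed

lemma thick_UNIV: "thick (UNIV :: 'x::euclidean_space set)"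
  unfolding thick_def
proof (intro ballI allI impI)
  fix e :: real assume "e > 0"
  then show "\<exists>d. 0 < \<bar>d\<bar> \<and> \<bar>d\<bar> < e \<and> x + d *\<^sub>R i \<in> UNIV" for x i :: 'x
    by (intro exI[of _ "e/2"]) auto
qed

lemma thick_interval:
  assumes "a < (b::real)" shows "thick {a..b}"
  unfolding thick_def
proof (intro ballI allI impI)
  fix x i e :: real assume x: "x \<in> {a..b}" and i: "i \<in> Basis" and e: "e > 0"
  show "\<exists>d. 0 < \<bar>d\<bar> \<and> \<bar>d\<bar> < e \<and> x + d *\<^sub>R i \<in> {a..b}"
  proof (cases "x < b")
    case True
    then show ?thesis using x i e by (intro exI[of _ "min (e/2) (b - x)"]) auto
  next
    case False
    then show ?thesis using x i e assms by (intro exI[of _ "- min (e/2) (b - a)"]) auto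
  qed
qed

lemma Ck_cong:
  assumes "\<And>x. x \<in> S \<Longrightarrow> f x = h x"
  shows "Ck_on k S f \<longleftrightarrow> Ck_on k S h"
  using assms
proof (induction k arbitrary: f h)
  case 0
  then show ?case by (simp cong: continuous_on_cong)
next
  case (Suc k)
  have hd: "(f has_derivative D) (at x within S) \<longleftrightarrow> (h has_derivative D) (at x within S)"
    if "x \<in> S" for x D
    using Suc.prems that by (metis has_derivative_transform)
  have fr: "frechet_derivative f (at x within S) = frechet_derivative h (at x within S)"
    if "x \<in> S" for x
    unfolding frechet_derivative_def using hd[OF that] by simp
  show ?case
    using hd Suc.IH[of "\<lambda>x. frechet_derivative f (at x within S) v"
        "\<lambda>x. frechet_derivative h (at x within S) v" for v] fr
    by (simp add: differentiable_on_def differentiable_def)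
qed

lemma Ck_Suc_intro:
  assumes "thick S"
    and "\<And>x. x \<in> S \<Longrightarrow> (f has_derivative D x) (at x within S)"
    and "\<And>v. Ck_on k S (\<lambda>x. D x v)"
  shows "Ck_on (Suc k) S f"
  using assms frechet_derivative_thick[OF assms(1) _ assms(2)]
    Ck_cong[of S "\<lambda>x. frechet_derivative f (at x within S) v" "\<lambda>x. D x v" k for v]
  by (auto simp: differentiable_on_def differentiable_def)

lemma Ck_Suc_derivative:
  assumes "Ck_on (Suc k) S f" "x \<in> S"
  shows "(f has_derivative frechet_derivative f (at x within S)) (at x within S)"
  using assms by (simp add: differentiable_on_def frechet_derivative_works)

lemma Ck_Suc_imp: "Ck_on (Suc k) S f \<Longrightarrow> Ck_on k S f"
proof (induction k arbitrary: f)
  case 0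
  then show ?case by (simp add: differentiable_imp_continuous_on)
qed auto

lemma Ck_imp_continuous: "Ck_on k S f \<Longrightarrow> continuous_on S f"
  by (cases k) (auto simp: differentiable_imp_continuous_on)

lemma Ck_subset:
  assumes "Ck_on k S f" "T \<subseteq> S" "thick T"
  shows "Ck_on k T f"
  using assms(1)
proof (induction k arbitrary: f)
  case 0
  then show ?case using assms(2) by (auto intro: continuous_on_subset)
next
  case (Suc k)
  show ?case
  proof (rule Ck_Suc_intro[OF assms(3)])
    show "(f has_derivative frechet_derivative f (at x within S)) (at x within T)" if "x \<in> T" for x
      using has_derivative_subset[OF Ck_Suc_derivative[OF Suc.prems] assms(2)] that assms(2) by auto
    show "Ck_on k T (\<lambda>x. frechet_derivative f (at x within S) v)" for v
      using Suc by auto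
  qed
qed

lemma at_within_Int_open_set:
  "x \<in> N \<Longrightarrow> open N \<Longrightarrow> at x within (S \<inter> N) = at x within S"
  by (rule at_within_nhd[of _ N]) auto

text \<open>
  Derivatives within a set see only a neighbourhood of the point, so curves glued from pieces that
  agree on overlaps can be checked piece by piece.
\<close>

lemma Ck_local:
  assumes "\<And>x. x \<in> S \<Longrightarrow> \<exists>N. open N \<and> x \<in> N \<and> Ck_on k (S \<inter> N) f"
  shows "Ck_on k S f"
  using assms
proof (induction k arbitrary: f)
  case 0
  show ?case
    unfolding Ck_on.simps continuous_on_eq_continuous_within
  proof
    fix x assume "x \<in> S"
    then obtain N where N: "open N" "x \<in> N" "continuous_on (S \<inter> N) f" using 0[of x] by auto
    then show "continuous (at x within S) f"
      using \<open>x \<in> S\<close> at_within_Int_open_set[of x N S]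
      by (metis IntI continuous_on_eq_continuous_within)
  qed
next
  case (Suc k)
  have "f differentiable (at x within S)" if "x \<in> S" for x
    using Suc.prems[OF that] that at_within_Int_open_set[of x _ S]
    by (auto simp: differentiable_on_def) (metis IntI)
  moreover have "Ck_on k S (\<lambda>x. frechet_derivative f (at x within S) v)" for v
  proof (rule Suc.IH)
    fix x assume "x \<in> S"
    then obtain N where N: "open N" "x \<in> N" "Ck_on (Suc k) (S \<inter> N) f" using Suc.prems[of x] by auto
    have "Ck_on k (S \<inter> N) (\<lambda>x. frechet_derivative f (at x within S) v)
      \<longleftrightarrow> Ck_on k (S \<inter> N) (\<lambda>x. frechet_derivative f (at x within (S \<inter> N)) v)"
      by (rule Ck_cong) (use N at_within_Int_open_set[of _ N S] in auto)
    then show "\<exists>N. open N \<and> x \<in> N \<and> Ck_on k (S \<inter> N) (\<lambda>x. frechet_derivative f (at x within S) v)"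
      using N by auto
  qed
  ultimately show ?case by (simp add: differentiable_on_def)
qed

lemma Ck_const: "thick S \<Longrightarrow> Ck_on k S (\<lambda>x. c)"
proof (induction k arbitrary: c)
  case (Suc k)
  then show ?case by (intro Ck_Suc_intro[where D = "\<lambda>x v. 0"]) (auto intro: derivative_intros)
qed auto

lemma Ck_linear:
  assumes "thick S" "bounded_linear h"
  shows "Ck_on k S h"
proof (cases k)
  case 0
  then show ?thesis using assms by (simp add: linear_continuous_on)
next
  case (Suc n)
  show ?thesis
    unfolding Suc
    by (rule Ck_Suc_intro[OF assms(1), where D = "\<lambda>x. h"])
      (auto intro: bounded_linear_imp_has_derivative assms Ck_const)
qed

lemma Ck_add:
  assumes "thick S" "Ck_on k S f" "Ck_on k S h"
  shows "Ck_on k S (\<lambda>x. f x + h x)"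
  using assms(2,3)
proof (induction k arbitrary: f h)
  case 0
  then show ?case by (simp add: continuous_on_add)
next
  case (Suc k)
  show ?case
    by (rule Ck_Suc_intro[OF assms(1) has_derivative_add[OF Ck_Suc_derivative[OF Suc.prems(1)]
          Ck_Suc_derivative[OF Suc.prems(2)]]]) (use Suc in auto)
qed

lemma Ck_scaleR:
  fixes f :: "'x::euclidean_space \<Rightarrow> real" and h :: "'x \<Rightarrow> 'y::euclidean_space"
  assumes "thick S" "Ck_on k S f" "Ck_on k S h"
  shows "Ck_on k S (\<lambda>x. f x *\<^sub>R h x)"
  using assms(2,3)
proof (induction k arbitrary: f h)
  case 0
  then show ?case by (simp add: continuous_on_scaleR)
next
  case (Suc k)
  show ?case
  proof (rule Ck_Suc_intro[OF assms(1)])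
    show "((\<lambda>x. f x *\<^sub>R h x) has_derivative (\<lambda>v. f x *\<^sub>R frechet_derivative h (at x within S) v
        + frechet_derivative f (at x within S) v *\<^sub>R h x)) (at x within S)" if "x \<in> S" for x
      by (intro has_derivative_scaleR Ck_Suc_derivative[OF Suc.prems(1) that]
          Ck_Suc_derivative[OF Suc.prems(2) that])
    show "Ck_on k S (\<lambda>x. f x *\<^sub>R frechet_derivative h (at x within S) v
        + frechet_derivative f (at x within S) v *\<^sub>R h x)" for v
      using Suc Ck_Suc_imp[OF Suc.prems(1)] Ck_Suc_imp[OF Suc.prems(2)]
      by (intro Ck_add assms(1) Suc.IH) auto
  qed
qed

lemma Ck_sum:
  assumes "thick S" "finite J" "\<And>j. j \<in> J \<Longrightarrow> Ck_on k S (f j)"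
  shows "Ck_on k S (\<lambda>x. \<Sum>j\<in>J. f j x)"
  using assms(2,3) by (induction J rule: finite_induct) (auto intro: Ck_add Ck_const assms(1))

lemma Ck_bounded_linear_compose:
  assumes "thick S" "bounded_linear L" "Ck_on k S f"
  shows "Ck_on k S (\<lambda>x. L (f x))"
  using assms(3)
proof (induction k arbitrary: f)
  case 0
  then show ?case using assms(2) by (simp add: bounded_linear.continuous_on)
next
  case (Suc k)
  show ?case
    by (rule Ck_Suc_intro[OF assms(1) bounded_linear.has_derivative[OF assms(2) Ck_Suc_derivative[OF Suc.prems]]])
      (use Suc in auto)
qed

text \<open>
  The chain rule writes the derivative of \<open>f \<circ> h\<close> in the direction \<open>v\<close> as a sum, over the
  basis, of products of components of the derivative of \<open>h\<close> with partial derivatives of \<open>f\<close> along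
  \<open>h\<close>; each factor is covered by the induction hypothesis or by the assumption on \<open>h\<close>.
\<close>

lemma Ck_compose:
  fixes f :: "'y::euclidean_space \<Rightarrow> 'z::euclidean_space"
    and h :: "'x::euclidean_space \<Rightarrow> 'y"
  assumes "thick S" "Ck_on k S h" "Ck_on k T f" "h ` S \<subseteq> T"
  shows "Ck_on k S (\<lambda>x. f (h x))"
  using assms(2,3)
proof (induction k arbitrary: f)
  case 0
  then show ?case using assms(4)
    by (simp, intro continuous_on_compose2[of T f S h]) auto
next
  case (Suc k)
  show ?case
  proof (rule Ck_Suc_intro[OF assms(1)])
    let ?f' = "\<lambda>x. frechet_derivative f (at (h x) within T)"
    let ?h' = "\<lambda>x. frechet_derivative h (at x within S)"
    show "((\<lambda>x. f (h x)) has_derivative (\<lambda>v. ?f' x (?h' x v))) (at x within S)" if "x \<in> S" for x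
      using has_derivative_in_compose2[of T f "\<lambda>y. frechet_derivative f (at y within T)" h S x "?h' x"]
        Ck_Suc_derivative[OF Suc.prems(2)] Ck_Suc_derivative[OF Suc.prems(1) that] assms(4) that
      by blast
    show "Ck_on k S (\<lambda>x. ?f' x (?h' x v))" for v
    proof -
      have "Ck_on k S (\<lambda>x. \<Sum>i\<in>Basis. (?h' x v \<bullet> i) *\<^sub>R ?f' x i)"
      proof (intro Ck_sum Ck_scaleR assms(1) finite_Basis)
        show "Ck_on k S (\<lambda>x. ?h' x v \<bullet> i)" for i
          using Suc.prems by (intro Ck_bounded_linear_compose[OF assms(1) bounded_linear_inner_left]) auto
        show "Ck_on k S (\<lambda>x. ?f' x i)" for i
          using Suc.prems Ck_Suc_imp[OF Suc.prems(1)] by (intro Suc.IH) auto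
      qed
      moreover have "?f' x (?h' x v) = (\<Sum>i\<in>Basis. (?h' x v \<bullet> i) *\<^sub>R ?f' x i)" if "x \<in> S" for x
      proof -
        have "linear (?f' x)"
          using Ck_Suc_derivative[OF Suc.prems(2), of "h x"] that assms(4) has_derivative_linear by blast
        then have "?f' x (\<Sum>i\<in>Basis. (?h' x v \<bullet> i) *\<^sub>R i) = (\<Sum>i\<in>Basis. (?h' x v \<bullet> i) *\<^sub>R ?f' x i)"
          by (simp add: linear_sum linear_scale)
        then show ?thesis by (simp add: euclidean_representation)
      qed
      ultimately show ?thesis
        using Ck_cong[of S "\<lambda>x. ?f' x (?h' x v)" "\<lambda>x. \<Sum>i\<in>Basis. (?h' x v \<bullet> i) *\<^sub>R ?f' x i"] by auto
    qed
  qed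
qed

lemma Ck_Suc_vector_intro:
  fixes f :: "real \<Rightarrow> 'y::euclidean_space"
  assumes "thick S"
    and "\<And>x. x \<in> S \<Longrightarrow> (f has_vector_derivative D x) (at x within S)"
    and "Ck_on k S D"
  shows "Ck_on (Suc k) S f"
  using assms(2)
  by (intro Ck_Suc_intro[OF assms(1), where D = "\<lambda>x v. v *\<^sub>R D x"] Ck_scaleR Ck_const assms(1,3))
    (auto simp: has_vector_derivative_def)

lemma smooth_on_vector_derivative:
  fixes f :: "real \<Rightarrow> 'y::euclidean_space"
  assumes "thick S" "smooth_on S f"
  shows "\<And>x. x \<in> S \<Longrightarrow> (f has_vector_derivative vector_derivative f (at x within S)) (at x within S)"
    and "smooth_on S (\<lambda>x. vector_derivative f (at x within S))"
proof -
  have C: "Ck_on (Suc k) S f" for k using assms(2) smooth_on_def by blast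
  show vd: "(f has_vector_derivative vector_derivative f (at x within S)) (at x within S)"
    if "x \<in> S" for x
    using Ck_Suc_derivative[OF C that] differentiableI vector_derivative_works by blast
  show "smooth_on S (\<lambda>x. vector_derivative f (at x within S))"
    unfolding smooth_on_def
  proof
    fix k
    have "frechet_derivative f (at x within S) 1 = vector_derivative f (at x within S)"
      if "x \<in> S" for x
      using frechet_derivative_thick[OF assms(1) that, of f] vd[OF that]
      by (auto simp: has_vector_derivative_def)
    then show "Ck_on k S (\<lambda>x. vector_derivative f (at x within S))"
      using C[of k] Ck_cong[of S "\<lambda>x. frechet_derivative f (at x within S) 1"
          "\<lambda>x. vector_derivative f (at x within S)" k] by auto
  qed
qed

section \<open>A smooth step function\<close>

text \<open>
  The classical flat function \<open>exp (- 1 / x)\<close> with a polynomial factor in \<open>1 / x\<close>. The factor makes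
  the family closed under differentiation, so that all orders are handled by one induction.
\<close>

definition flat_exp :: "real poly \<Rightarrow> real \<Rightarrow> real" where
  "flat_exp P x = (if 0 < x then poly P (1 / x) * exp (- (1 / x)) else 0)"

lemma poly_times_exp_minus_tendsto_0: "((\<lambda>y::real. poly P y * exp (- y)) \<longlongrightarrow> 0) at_top"
proof -
  have "((\<lambda>y. \<Sum>i\<le>degree P. coeff P i * (y ^ i / exp y)) \<longlongrightarrow> (\<Sum>i\<le>degree P. coeff P i * 0)) at_top"
    by (intro tendsto_intros tendsto_power_div_exp_0)
  moreover have "(\<Sum>i\<le>degree P. coeff P i * (y ^ i / exp y)) = poly P y * exp (- y)" for y
    by (simp add: poly_altdef sum_distrib_right exp_minus divide_inverse mult.assoc)
  ultimately show ?thesis by simp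
qed

lemma flat_exp_tendsto_0: "(flat_exp P \<longlongrightarrow> 0) (at 0)"
  unfolding filterlim_at_split
proof
  have "eventually (\<lambda>x. 0 = flat_exp P x) (at_left 0)"
    by (auto simp: eventually_at_filter flat_exp_def)
  then show "(flat_exp P \<longlongrightarrow> 0) (at_left 0)" by (rule tendsto_eventually[OF eventually_mono]) simp
next
  have "((\<lambda>x. poly P (inverse x) * exp (- inverse x)) \<longlongrightarrow> 0) (at_right 0)"
    using filterlim_compose[OF poly_times_exp_minus_tendsto_0 filterlim_inverse_at_top_right] .
  moreover have "eventually (\<lambda>x. poly P (inverse x) * exp (- inverse x) = flat_exp P x) (at_right 0)"
    by (auto simp: eventually_at_filter flat_exp_def inverse_eq_divide)
  ultimately show "(flat_exp P \<longlongrightarrow> 0) (at_right 0)" by (rule Lim_transform_eventually)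
qed

lemma flat_exp_has_derivative:
  "(flat_exp P has_real_derivative flat_exp ([:0, 0, 1:] * (P - pderiv P)) x) (at x)"
proof -
  consider "x < 0" | "x = 0" | "x > 0" by linarith
  then show ?thesis
  proof cases
    case 1
    have "((\<lambda>x. 0) has_real_derivative flat_exp ([:0, 0, 1:] * (P - pderiv P)) x) (at x)"
      using 1 by (simp add: flat_exp_def)
    then show ?thesis
      by (rule has_field_derivative_transform_within_open[of _ _ _ "{..<0}"])
        (use 1 in \<open>auto simp: flat_exp_def\<close>)
  next
    case 2
    have "((\<lambda>h. flat_exp P h / h) \<longlongrightarrow> 0) (at 0)"
    proof (rule Lim_transform_eventually[OF flat_exp_tendsto_0[of "[:0, 1:] * P"]])
      show "eventually (\<lambda>h. flat_exp ([:0, 1:] * P) h = flat_exp P h / h) (at 0)"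
        by (auto simp: eventually_at_filter flat_exp_def)
    qed
    then show ?thesis using 2 by (simp add: DERIV_def flat_exp_def)
  next
    case 3
    have "((\<lambda>x. poly P (1 / x) * exp (- (1 / x))) has_real_derivative
       flat_exp ([:0, 0, 1:] * (P - pderiv P)) x) (at x)"
      using 3 by (auto intro!: derivative_eq_intros DERIV_chain2[OF poly_DERIV]
          simp: flat_exp_def field_simps power2_eq_square)
    then show ?thesis
      by (rule has_field_derivative_transform_within_open[of _ _ _ "{0<..}"])
        (use 3 in \<open>auto simp: flat_exp_def\<close>)
  qed
qed

lemma flat_exp_Ck: "Ck_on k UNIV (flat_exp P)"
proof (induction k arbitrary: P)
  case 0
  show ?case
    using DERIV_isCont[OF flat_exp_has_derivative] by (simp add: continuous_at_imp_continuous_on)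
next
  case (Suc k)
  show ?case
    by (rule Ck_Suc_vector_intro[OF thick_UNIV _ Suc[of "[:0, 0, 1:] * (P - pderiv P)"]])
      (use flat_exp_has_derivative has_real_derivative_iff_has_vector_derivative in blast)
qed

text \<open>
  With \<open>e\<close> the flat exponential, \<open>e (e 1 - e x) / e (e 1)\<close> is \<open>1\<close> for \<open>x \<le> 0\<close>, decreases, and is
  \<open>0\<close> for \<open>x \<ge> 1\<close>; only composition is needed to see that it is smooth.
\<close>

lemma smooth_step:
  fixes a b :: real
  assumes "a < b"
  obtains \<psi> :: "real \<Rightarrow> real" where "smooth_on UNIV \<psi>" "mono \<psi>"
    "\<And>x. x \<le> a \<Longrightarrow> \<psi> x = 0" "\<And>x. x \<ge> b \<Longrightarrow> \<psi> x = 1"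
proof
  let ?e = "flat_exp 1" and ?l = "\<lambda>x. (x - a) / (b - a)"
  define \<psi> where "\<psi> = (\<lambda>x. 1 + (- 1 / ?e (?e 1)) *\<^sub>R ?e (?e 1 - ?e (?l x)))"
  have pos: "?e x > 0" if "x > 0" for x using that by (simp add: flat_exp_def)
  have nonpos: "?e x = 0" if "x \<le> 0" for x using that by (simp add: flat_exp_def)
  have mono: "?e x \<le> ?e y" if "x \<le> y" for x y
    using that by (auto simp: flat_exp_def frac_le)
  have lmono: "?l x \<le> ?l y" if "x \<le> y" for x y using that assms by (simp add: divide_right_mono)
  have e1: "?e 1 > 0" "?e (?e 1) > 0" by (simp_all add: pos)
  show "smooth_on UNIV \<psi>"
    unfolding smooth_on_def
  proof
    fix k
    have l: "Ck_on k UNIV (\<lambda>x. (x - a) / (b - a))"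
    proof -
      have "Ck_on k UNIV (\<lambda>x::real. (1 / (b - a)) *\<^sub>R x + (- a / (b - a)))"
        by (intro Ck_add Ck_const Ck_linear thick_UNIV bounded_linear_scaleR_right)
      then show ?thesis by (simp add: diff_divide_distrib)
    qed
    have "Ck_on k UNIV (\<lambda>x. ?e (?l x))"
      by (rule Ck_compose[OF thick_UNIV l flat_exp_Ck]) auto
    then have "Ck_on k UNIV (\<lambda>x. ?e 1 + (- 1) *\<^sub>R ?e (?l x))"
      by (intro Ck_add Ck_scaleR Ck_const thick_UNIV)
    then have "Ck_on k UNIV (\<lambda>x. ?e (?e 1 + (- 1) *\<^sub>R ?e (?l x)))"
      by (rule Ck_compose[OF thick_UNIV _ flat_exp_Ck]) auto
    then show "Ck_on k UNIV \<psi>"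
      unfolding \<psi>_def by (intro Ck_add Ck_scaleR Ck_const thick_UNIV) simp
  qed
  show "mono \<psi>"
  proof (rule monoI)
    fix x y :: real assume "x \<le> y"
    then have "?e (?e 1 - ?e (?l y)) \<le> ?e (?e 1 - ?e (?l x))"
      using mono[OF lmono] mono by simp
    then show "\<psi> x \<le> \<psi> y" using e1 by (simp add: \<psi>_def divide_right_mono)
  qed
  show "\<psi> x = 0" if "x \<le> a" for x
  proof -
    have "?l x \<le> 0" using that assms by (simp add: divide_le_0_iff)
    then have "?e (?l x) = 0" by (rule nonpos)
    then show ?thesis using e1 by (simp add: \<psi>_def)
  qed
  show "\<psi> x = 1" if "x \<ge> b" for x
  proof -
    have "1 \<le> ?l x" using that assms by simp
    then have "?e 1 - ?e (?l x) \<le> 0" using mono by simp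
    then have "?e (?e 1 - ?e (?l x)) = 0" by (rule nonpos)
    then show ?thesis by (simp add: \<psi>_def)
  qed
qed

section \<open>Lorentzian forms\<close>

lemma lorentz_formD:
  assumes "lorentz_form b"
  shows "bilinear b" "b u w = b w u"
  using assms by (auto simp: lorentz_form_def)

lemma lorentz_form_combination:
  assumes "lorentz_form b"
  shows "b (x *\<^sub>R u + y *\<^sub>R w) (x *\<^sub>R u + y *\<^sub>R w) = x\<^sup>2 * b u u + 2 * (x * y) * b u w + y\<^sup>2 * b w w"
  using assms lorentz_formD[OF assms]
  by (simp add: bilinear_ladd bilinear_radd bilinear_lmul bilinear_rmul power2_eq_square algebra_simps)

text \<open>
  If \<open>w\<close> were causal as well, the form would be nonpositive on the plane spanned by \<open>t\<close> and \<open>w\<close>.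
  That plane meets the hyperplane spanned by the positive basis vectors in a nonzero vector \<open>z\<close>, on
  which the form is positive.
\<close>

lemma lorentz_orthogonal_pos:
  assumes b: "lorentz_form b" and t: "b t t < 0" and w: "w \<noteq> 0" "b w t = 0"
  shows "0 < b w w"
proof (rule ccontr)
  assume "\<not> 0 < b w w"
  then have ww: "b w w \<le> 0" by simp
  have bil: "bilinear b" and sym: "\<And>u w. b u w = b w u" using b by (auto simp: lorentz_form_def)
  obtain B e0 where B: "independent B" "span B = UNIV" "pairwise (\<lambda>u w. b u w = 0) B"
    "e0 \<in> B" "\<And>e. e \<in> B - {e0} \<Longrightarrow> 0 < b e e"
    using b unfolding lorentz_form_def by blast
  note lin = bilinear_ladd[OF bil] bilinear_radd[OF bil] bilinear_lmul[OF bil] bilinear_rmul[OF bil]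
    bilinear_lzero[OF bil] bilinear_rzero[OF bil]
  have fin: "finite B" using B(1) independent_bound by blast
  define r where "r = representation B"
  have rep: "v = (\<Sum>e\<in>B. r v e *\<^sub>R e)" for v
    using sum_representation_eq[OF B(1) _ fin, of v] B(2) by (simp add: r_def)
  have pos: "0 < b z z" if "z \<noteq> 0" "r z e0 = 0" for z
  proof -
    have "b z z = b (\<Sum>e\<in>B. r z e *\<^sub>R e) (\<Sum>e\<in>B. r z e *\<^sub>R e)"
      by (rule arg_cong2[where f = b, OF rep rep])
    also have "\<dots> = (\<Sum>e\<in>B. \<Sum>f\<in>B. r z e * (r z f * b e f))"
      by (simp add: bilinear_sum[OF bil] lin sum.cartesian_product split_def mult.left_commute)
    also have "\<dots> = (\<Sum>e\<in>B. r z e * (r z e * b e e))"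
    proof (intro sum.cong refl)
      fix e assume e: "e \<in> B"
      have "(\<Sum>f\<in>B. r z e * (r z f * b e f)) = (\<Sum>f\<in>B. if f = e then r z e * (r z e * b e e) else 0)"
        using B(3) e by (intro sum.cong) (auto simp: pairwise_def)
      then show "(\<Sum>f\<in>B. r z e * (r z f * b e f)) = r z e * (r z e * b e e)"
        using e fin by simp
    qed
    finally have eq: "b z z = (\<Sum>e\<in>B. (r z e)\<^sup>2 * b e e)" by (simp add: power2_eq_square mult.assoc)
    have "\<exists>e\<in>B. r z e \<noteq> 0"
      using that(1) rep[of z] by (metis (no_types, lifting) scaleR_zero_left sum.neutral)
    then obtain e where e: "e \<in> B" "r z e \<noteq> 0" by blast
    then have "e \<noteq> e0" using that(2) by auto
    have nn: "0 \<le> (r z f)\<^sup>2 * b f f" if "f \<in> B" for f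
      using B(5)[of f] that \<open>r z e0 = 0\<close> by (cases "f = e0") auto
    show ?thesis unfolding eq
      by (rule sum_pos2[OF fin e(1)]) (use nn B(5)[of e] e \<open>e \<noteq> e0\<close> in auto)
  qed
  have rlin: "r (x *\<^sub>R t + y *\<^sub>R w) e0 = x * r t e0 + y * r w e0" for x y
    by (simp add: r_def representation_add[OF B(1)] representation_scale[OF B(1)] B(2))
  define z where "z = r w e0 *\<^sub>R t + (- r t e0) *\<^sub>R w"
  have "r z e0 = 0" unfolding z_def rlin by simp
  have "b z z = (r w e0)\<^sup>2 * b t t + (r t e0)\<^sup>2 * b w w"
    unfolding z_def lorentz_form_combination[OF b] using w(2) sym[of t w] by simp
  also have "\<dots> \<le> 0" using t ww by (intro add_nonpos_nonpos mult_nonneg_nonpos) auto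
  finally have "z = 0" using pos \<open>r z e0 = 0\<close> by force
  have "t \<noteq> 0" using t lin by auto
  then have "r t e0 \<noteq> 0" using pos t by force
  then have wt: "w = (r w e0 / r t e0) *\<^sub>R t"
    using \<open>z = 0\<close> unfolding z_def by (simp add: field_simps eq_vector_fraction_iff)
  then have "(r w e0 / r t e0) * b t t = 0" using w(2) by (metis lin(3) real_scaleR_def)
  then have "r w e0 / r t e0 = 0" using t by simp
  then show False using wt w(1) by (metis scaleR_zero_left)
qed

text \<open>
  The reverse Cauchy-Schwarz inequality in qualitative form. Otherwise some positive combination of
  \<open>t\<close> and \<open>w\<close>, which is timelike, would be orthogonal to the causal vector \<open>v\<close>.
\<close>

lemma lorentz_future_product_neg:
  assumes b: "lorentz_form b" and t: "b t t < 0"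
    and v: "b v v \<le> 0" "b v t < 0" and w: "b w w < 0" "b w t < 0"
  shows "b v w < 0"
proof (rule ccontr)
  have bil: "bilinear b" and sym: "\<And>u w. b u w = b w u" using b by (auto simp: lorentz_form_def)
  note lin = bilinear_ladd[OF bil] bilinear_radd[OF bil] bilinear_lmul[OF bil] bilinear_rmul[OF bil]
    bilinear_lzero[OF bil] bilinear_rzero[OF bil]
  assume "\<not> b v w < 0"
  then have vw: "0 \<le> b v w" by simp
  define z where "z = b v w *\<^sub>R t + (- b v t) *\<^sub>R w"
  have "b z z = (b v w)\<^sup>2 * b t t + 2 * (b v w * (- b v t) * b w t) + (b v t)\<^sup>2 * b w w"
    unfolding z_def lorentz_form_combination[OF b] using sym[of t w] by simp
  moreover have "(b v w)\<^sup>2 * b t t \<le> 0" using t by (simp add: mult_nonneg_nonpos)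
  moreover have "b v w * (- b v t) * b w t \<le> 0"
    using vw v(2) w(2) by (intro mult_nonneg_nonpos mult_nonneg_nonneg) auto
  moreover have "(b v t)\<^sup>2 * b w w < 0" using v(2) w(1) by (simp add: mult_pos_neg)
  ultimately have z: "b z z < 0" by linarith
  have "b v z = 0" unfolding z_def lin by simp
  moreover have "v \<noteq> 0" using v(2) lin by auto
  ultimately have "0 < b v v" using lorentz_orthogonal_pos[OF b z] by blast
  then show False using v by simp
qed

lemma lorentz_same_cone:
  assumes b: "lorentz_form b" and t: "b t t < 0" and u: "b u u < 0" "b u t < 0"
    and w: "b w w < 0" "b u w < 0"
  shows "b w t < 0"
proof -
  have sym: "\<And>u w. b u w = b w u" using b by (auto simp: lorentz_form_def)
  show ?thesis
    using lorentz_future_product_neg[OF b u(1), of t w] t u w sym[of t u] sym[of w u] sym[of w t] by simp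
qed

text \<open>
  A covector \<open>\<alpha>\<close> that dominates the Lorentzian norm on the future cone and nearly attains it at the
  unit vector \<open>u\<close> has a kernel that is nearly orthogonal to \<open>u\<close>. As long as \<open>u + s v\<close> is timelike,
  its squared norm \<open>1 - 2 s b(u, v) - s\<^sup>2 b(v, v)\<close> is at most \<open>\<alpha>(u)\<^sup>2\<close>, because \<open>\<alpha>\<close> does not change along
  \<open>v\<close>. A bounded quadratic forces \<open>b(v, v) \<ge> 0\<close>, and its maximum \<open>1 + b(u, v)\<^sup>2 / b(v, v)\<close> gives the
  second estimate.
\<close>

lemma lorentz_near_minimal:
  assumes b: "lorentz_form b" and t: "b t t < 0"
    and \<alpha>: "linear \<alpha>"
    and dom: "\<And>w. b w w < 0 \<Longrightarrow> b w t < 0 \<Longrightarrow> sqrt (- b w w) \<le> \<alpha> w"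
    and u: "b u u = -1" "b u t < 0" "\<alpha> u \<le> 11/10"
    and v: "\<alpha> v = 0"
  shows "0 \<le> b v v" "\<bar>b u v\<bar> \<le> sqrt (b v v) / 2"
proof -
  have bil: "bilinear b" and sym: "\<And>u w. b u w = b w u" using b by (auto simp: lorentz_form_def)
  note lin = bilinear_ladd[OF bil] bilinear_radd[OF bil] bilinear_lmul[OF bil] bilinear_rmul[OF bil]
    bilinear_lzero[OF bil] bilinear_rzero[OF bil]
  let ?h = "b v v" and ?k = "b u v"
  have Q: "1 - 2 * s * ?k - s\<^sup>2 * ?h \<le> 121/100" if "s * ?k \<le> 0" "0 < 1 - 2 * s * ?k - s\<^sup>2 * ?h" for s
  proof -
    let ?w = "u + s *\<^sub>R v"
    have ww: "- b ?w ?w = 1 - 2 * s * ?k - s\<^sup>2 * ?h"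
      using u(1) sym[of v u] by (simp add: lin power2_eq_square algebra_simps)
    have uw: "b u ?w = -1 + s * ?k" using u(1) by (simp add: lin)
    have "b ?w t < 0"
      using lorentz_same_cone[OF b t _ u(2), of ?w] u(1) ww uw that by simp
    then have "sqrt (- b ?w ?w) \<le> \<alpha> ?w" using dom[of ?w] ww that by simp
    also have "\<alpha> ?w = \<alpha> u" using \<alpha> v by (simp add: linear_add linear_scale)
    finally have le: "sqrt (- b ?w ?w) \<le> 11/10" using u(3) by simp
    have "- b ?w ?w = (sqrt (- b ?w ?w))\<^sup>2" using ww that by simp
    also have "\<dots> \<le> (11/10)\<^sup>2" using le ww that by (intro power_mono) auto
    finally show ?thesis using ww by (simp add: power2_eq_square)
  qed
  \<comment> \<open>The sign for which the linear term of the quadratic is nonnegative.\<close>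
  define \<sigma> where "\<sigma> = (if ?k \<le> 0 then 1 else -1 :: real)"
  have \<sigma>: "(\<sigma> * r) * ?k = - (r * \<bar>?k\<bar>)" "(\<sigma> * r)\<^sup>2 = r\<^sup>2" for r by (auto simp: \<sigma>_def)
  show h: "0 \<le> ?h"
  proof (rule ccontr)
    assume n: "\<not> 0 \<le> ?h"
    define r where "r = 1 / sqrt (- ?h)"
    have r: "r > 0" "r\<^sup>2 * ?h = - 1" using n by (auto simp: r_def power_divide field_simps)
    have e: "1 - 2 * (\<sigma> * r) * ?k - (\<sigma> * r)\<^sup>2 * ?h = 2 + 2 * (r * \<bar>?k\<bar>)"
      using \<sigma>[of r] r(2) by simp
    have k: "(\<sigma> * r) * ?k \<le> 0" using \<sigma>(1)[of r] r(1) by simp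
    have "0 \<le> r * \<bar>?k\<bar>" using r(1) by simp
    then show False using Q[OF k] e by linarith
  qed
  show "\<bar>?k\<bar> \<le> sqrt ?h / 2"
  proof (cases "?k = 0")
    case True
    then show ?thesis using h by simp
  next
    case False
    have hp: "0 < ?h"
    proof (rule ccontr)
      assume "\<not> 0 < ?h"
      then have z: "?h = 0" using h by simp
      define r where "r = 1 / \<bar>?k\<bar>"
      have r: "r > 0" "r * \<bar>?k\<bar> = 1" using False by (auto simp: r_def)
      have e: "1 - 2 * (\<sigma> * r) * ?k - (\<sigma> * r)\<^sup>2 * ?h = 1 + 2 * (r * \<bar>?k\<bar>)"
        using \<sigma>[of r] z by simp
      have k: "(\<sigma> * r) * ?k \<le> 0" using \<sigma>(1)[of r] r(1) by simp
      show False using Q[OF k] e r(2) by linarith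
    qed
    \<comment> \<open>The maximum of the quadratic.\<close>
    define s where "s = - ?k / ?h"
    have e: "1 - 2 * s * ?k - s\<^sup>2 * ?h = 1 + ?k\<^sup>2 / ?h"
      using hp by (simp add: s_def field_simps power2_eq_square)
    have "s * ?k \<le> 0" using hp by (simp add: s_def divide_le_0_iff)
    moreover have "0 < 1 + ?k\<^sup>2 / ?h" using hp by (simp add: add_pos_nonneg)
    ultimately have "1 + ?k\<^sup>2 / ?h \<le> 121/100" using Q[of s] e by simp
    then have "?k\<^sup>2 \<le> ?h * (21/100)" using hp by (simp add: field_simps)
    also have "\<dots> \<le> ?h / 4" using hp by simp
    finally have "sqrt (?k\<^sup>2) \<le> sqrt (?h / 4)" by (rule real_sqrt_le_mono)
    then show ?thesis by (simp add: real_sqrt_divide)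
  qed
qed

section \<open>Curves in charts\<close>

lemma relatively_open_preimage:
  fixes \<gamma> :: "real \<Rightarrow> 'a::topological_space"
  assumes "continuous_on I \<gamma>" "open V"
  obtains N where "open N" "I \<inter> \<gamma> -` V = I \<inter> N"
  using assms continuous_on_open_invariant[of I \<gamma>] by (metis Int_commute)

lemma vector_derivative_thick:
  fixes f :: "real \<Rightarrow> 'y::euclidean_space"
  assumes "thick I" "s \<in> I" "(f has_vector_derivative D) (at s within I)"
  shows "vector_derivative f (at s within I) = D"
proof (rule vector_derivative_within[OF _ assms(3)])
  have "s islimpt I"
    unfolding islimpt_approachable
  proof (intro allI impI)
    fix e :: real assume "e > 0"
    then obtain d where "0 < \<bar>d\<bar>" "\<bar>d\<bar> < e" "s + d *\<^sub>R 1 \<in> I"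
      using assms unfolding thick_def by (metis Basis_real_def singletonI)
    then show "\<exists>x'\<in>I. x' \<noteq> s \<and> dist x' s < e"
      by (intro bexI[of _ "s + d"]) (auto simp: dist_real_def)
  qed
  then show "at s within I \<noteq> bot" by (simp add: trivial_limit_within)
qed

context smooth_manifold
begin

lemma
  assumes "c \<in> A"
  shows open_chart_domain: "open (fst c)" and open_chart_image: "open (snd c ` fst c)"
    and chart_homeomorphism: "homeomorphism (fst c) (snd c ` fst c) (snd c) (chart_inv c)"
  using charts[OF assms] by (auto simp: is_chart_def)

lemma chart_inv_chart: "c \<in> A \<Longrightarrow> p \<in> fst c \<Longrightarrow> chart_inv c (snd c p) = p"
  using chart_homeomorphism homeomorphism_apply1 by blast

lemma
  assumes "c \<in> A" "x \<in> snd c ` fst c"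
  shows chart_chart_inv: "snd c (chart_inv c x) = x" and chart_inv_in: "chart_inv c x \<in> fst c"
  using assms(2) chart_inv_chart[OF assms(1)] by auto

lemma continuous_on_chart: "c \<in> A \<Longrightarrow> continuous_on (fst c) (snd c)"
  using chart_homeomorphism by (auto simp: homeomorphism_def)

lemma continuous_on_chart_inv: "c \<in> A \<Longrightarrow> continuous_on (snd c ` fst c) (chart_inv c)"
  using chart_homeomorphism by (auto simp: homeomorphism_def)

lemma chart_overlap:
  assumes "c \<in> A"
  shows "snd c ` (fst c \<inter> V) = snd c ` fst c \<inter> chart_inv c -` V"
  using chart_inv_chart[OF assms] by force

lemma open_chart_overlap:
  assumes "c \<in> A" "open V"
  shows "open (snd c ` (fst c \<inter> V))"
  unfolding chart_overlap[OF assms(1)]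
  using continuous_on_chart_inv[OF assms(1)] open_chart_image[OF assms(1)] assms(2)
  by (simp add: continuous_on_open_vimage Int_commute)

lemma chart_at_exists: obtains c where "c \<in> A" "p \<in> fst c"
  using cover by blast

lemma transition_has_derivative:
  assumes "c \<in> A" "d \<in> A" "p \<in> fst c" "p \<in> fst d"
  shows "(transition c d has_derivative frechet_derivative (transition c d) (at (snd c p))) (at (snd c p))"
proof -
  have "Ck_on 1 (snd c ` (fst c \<inter> fst d)) (transition c d)"
    using compatible[OF assms(1,2)] smooth_on_def by blast
  moreover have "open (snd c ` (fst c \<inter> fst d))"
    using open_chart_overlap assms open_chart_domain by blast
  ultimately have "transition c d differentiable (at (snd c p))"
    using assms by (auto simp: differentiable_on_eq_differentiable_at)
  then show ?thesis by (simp add: frechet_derivative_works)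
qed

lemma tangent_vec_eqI:
  assumes "v \<in> tangent_space A p" "c \<in> A" "p \<in> fst c"
  shows "v = tangent_vec A c p (v c)"
proof
  fix d show "v d = tangent_vec A c p (v c) d"
  proof (cases "d \<in> charts_at A p")
    case True
    moreover have "c \<in> charts_at A p" using assms(2,3) by (simp add: charts_at_def)
    ultimately have "v d = frechet_derivative (transition c d) (at (snd c p)) (v c)"
      using assms(1) unfolding tangent_space_def by blast
    then show ?thesis using True unfolding tangent_vec_def by argo
  next
    case False
    then have "v d = 0" using assms(1) unfolding tangent_space_def by blast
    then show ?thesis using False unfolding tangent_vec_def by argo
  qed
qed

lemma smooth_curve_chart:
  assumes "smooth_curve A I \<gamma>" "thick I" "c \<in> A"
  obtains N where "open N" "I \<inter> \<gamma> -` fst c = I \<inter> N" "thick (I \<inter> N)" "smooth_on (I \<inter> N) (snd c \<circ> \<gamma>)"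
proof -
  have "continuous_on I \<gamma>" using assms(1) by (simp add: smooth_curve_def)
  then obtain N where N: "open N" "I \<inter> \<gamma> -` fst c = I \<inter> N"
    using relatively_open_preimage open_chart_domain assms(3) by metis
  then show thesis using that[of N] assms thick_Int_open[of I N] by (auto simp: smooth_curve_def)
qed

lemma
  assumes "smooth_curve A I \<gamma>" "thick I" "c \<in> A" "s \<in> I" "\<gamma> s \<in> fst c"
  shows chart_curve_has_vector_derivative:
      "(snd c \<circ> \<gamma> has_vector_derivative velocity A I \<gamma> s c) (at s within I)"
    and velocity_component_tendsto:
      "((\<lambda>r. velocity A I \<gamma> r c) \<longlongrightarrow> velocity A I \<gamma> s c) (at s within I)"
    and chart_curve_tendsto: "((\<lambda>r. snd c (\<gamma> r)) \<longlongrightarrow> snd c (\<gamma> s)) (at s within I)"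
    and eventually_in_chart: "eventually (\<lambda>r. \<gamma> r \<in> fst c) (at s within I)"
proof -
  obtain N where N: "open N" "I \<inter> \<gamma> -` fst c = I \<inter> N" "thick (I \<inter> N)" "smooth_on (I \<inter> N) (snd c \<circ> \<gamma>)"
    using smooth_curve_chart[OF assms(1-3)] by blast
  have s: "s \<in> I \<inter> N" using N(2) assms(4,5) by auto
  have at: "at r within (I \<inter> N) = at r within I" if "r \<in> I \<inter> N" for r
    using that N(1) by (simp add: at_within_Int_open_set)
  have vel: "velocity A I \<gamma> r c = vector_derivative (snd c \<circ> \<gamma>) (at r within (I \<inter> N))"
    if r: "r \<in> I \<inter> N" for r
  proof -
    have "r \<in> I \<inter> \<gamma> -` fst c" using r N(2) by blast
    then show ?thesis using r at assms(3) by (simp add: velocity_def charts_at_def)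
  qed
  show "(snd c \<circ> \<gamma> has_vector_derivative velocity A I \<gamma> s c) (at s within I)"
    using smooth_on_vector_derivative(1)[OF N(3,4) s] vel[OF s] at[OF s] by simp
  have "continuous_on (I \<inter> N) (\<lambda>r. vector_derivative (snd c \<circ> \<gamma>) (at r within (I \<inter> N)))"
    using smooth_on_vector_derivative(2)[OF N(3,4)] Ck_imp_continuous unfolding smooth_on_def by blast
  then have "continuous_on (I \<inter> N) (\<lambda>r. velocity A I \<gamma> r c)"
    by (rule continuous_on_eq) (use vel in metis)
  then show "((\<lambda>r. velocity A I \<gamma> r c) \<longlongrightarrow> velocity A I \<gamma> s c) (at s within I)"
    using s at[OF s] unfolding continuous_on_def by metis
  have "continuous_on (I \<inter> N) (\<lambda>r. snd c (\<gamma> r))"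
    using N(4) Ck_imp_continuous[of 0 "I \<inter> N" "snd c \<circ> \<gamma>"] unfolding smooth_on_def comp_def by blast
  then show "((\<lambda>r. snd c (\<gamma> r)) \<longlongrightarrow> snd c (\<gamma> s)) (at s within I)"
    using s at[OF s] unfolding continuous_on_def by metis
  have "eventually (\<lambda>r. r \<in> N) (at s within I)"
    using N(1) s by (auto simp: eventually_at_topological)
  moreover have "eventually (\<lambda>r. r \<in> I) (at s within I)" by (auto simp: eventually_at_filter)
  ultimately show "eventually (\<lambda>r. \<gamma> r \<in> fst c) (at s within I)"
    by eventually_elim (use N(2) in auto)
qed

text \<open>
  Velocities transform between charts like tangent vectors, by the chain rule. Hence one chart
  suffices to evaluate the metric on them.
\<close>

lemma velocity_eq_tangent_vec:
  assumes "smooth_curve A I \<gamma>" "thick I" "c \<in> A" "s \<in> I" "\<gamma> s \<in> fst c"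
  shows "velocity A I \<gamma> s = tangent_vec A c (\<gamma> s) (velocity A I \<gamma> s c)"
proof
  fix d
  show "velocity A I \<gamma> s d = tangent_vec A c (\<gamma> s) (velocity A I \<gamma> s c) d"
  proof (cases "d \<in> charts_at A (\<gamma> s)")
    case False
    then show ?thesis by (simp add: velocity_def tangent_vec_def)
  next
    case True
    then have d: "d \<in> A" "\<gamma> s \<in> fst d" by (auto simp: charts_at_def)
    have "(transition c d \<circ> (snd c \<circ> \<gamma>) has_vector_derivative
        frechet_derivative (transition c d) (at (snd c (\<gamma> s))) (velocity A I \<gamma> s c)) (at s within I)"
      by (rule vector_derivative_diff_chain_within[OF chart_curve_has_vector_derivative[OF assms]
            has_derivative_at_withinI]) (use transition_has_derivative assms d in auto)
    then have "(snd d \<circ> \<gamma> has_vector_derivative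
        frechet_derivative (transition c d) (at (snd c (\<gamma> s))) (velocity A I \<gamma> s c)) (at s within I)"
      unfolding has_vector_derivative_def
    proof (rule has_derivative_transform_eventually)
      show "eventually (\<lambda>r. (transition c d \<circ> (snd c \<circ> \<gamma>)) r = (snd d \<circ> \<gamma>) r) (at s within I)"
        using eventually_in_chart[OF assms]
        by eventually_elim (simp add: transition_def chart_inv_chart assms(3))
      show "(transition c d \<circ> (snd c \<circ> \<gamma>)) s = (snd d \<circ> \<gamma>) s"
        using assms by (simp add: transition_def chart_inv_chart)
    qed (use assms in auto)
    then have "vector_derivative (snd d \<circ> \<gamma>) (at s within I) =
        frechet_derivative (transition c d) (at (snd c (\<gamma> s))) (velocity A I \<gamma> s c)"
      by (rule vector_derivative_thick[OF assms(2,4)])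
    moreover have "velocity A I \<gamma> s d = vector_derivative (snd d \<circ> \<gamma>) (at s within I)"
      using True by (simp add: velocity_def)
    ultimately show ?thesis
      using True by (simp add: tangent_vec_def)
  qed
qed

lemma smooth_curve_chart_inv:
  assumes "thick I" "c \<in> A" "smooth_on I \<xi>" "\<xi> ` I \<subseteq> snd c ` fst c"
  shows "smooth_curve A I (chart_inv c \<circ> \<xi>)"
proof -
  have cont: "continuous_on I \<xi>"
    using assms(3) Ck_imp_continuous unfolding smooth_on_def by blast
  then have cont': "continuous_on I (chart_inv c \<circ> \<xi>)"
    using continuous_on_chart_inv[OF assms(2)] assms(4)
    by (intro continuous_on_compose) (auto intro: continuous_on_subset)
  have "Ck_on k (I \<inter> (chart_inv c \<circ> \<xi>) -` fst d) (snd d \<circ> (chart_inv c \<circ> \<xi>))" if d: "d \<in> A" for d k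
  proof -
    obtain N where N: "open N" "I \<inter> (chart_inv c \<circ> \<xi>) -` fst d = I \<inter> N"
      using relatively_open_preimage[OF cont' open_chart_domain[OF d]] by blast
    have th: "thick (I \<inter> N)" using thick_Int_open assms(1) N(1) by blast
    have "\<xi> ` (I \<inter> N) \<subseteq> snd c ` (fst c \<inter> fst d)"
      unfolding chart_overlap[OF assms(2)] N(2)[symmetric] using assms(4) by auto
    moreover have "Ck_on k (I \<inter> N) \<xi>"
      by (rule Ck_subset[OF _ _ th, of k I]) (use assms(3) in \<open>auto simp: smooth_on_def\<close>)
    moreover have "Ck_on k (snd c ` (fst c \<inter> fst d)) (transition c d)"
      using compatible[OF assms(2) d] by (simp add: smooth_on_def)
    ultimately have "Ck_on k (I \<inter> N) (\<lambda>r. transition c d (\<xi> r))"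
      using Ck_compose[OF th] by blast
    then show ?thesis unfolding N(2) by (simp add: transition_def comp_def)
  qed
  then show ?thesis using cont' by (auto simp: smooth_curve_def smooth_on_def)
qed

lemma smooth_curve_subset:
  assumes "smooth_curve A I \<gamma>" "J \<subseteq> I" "thick J"
  shows "smooth_curve A J \<gamma>"
  unfolding smooth_curve_def smooth_on_def
proof (intro conjI ballI allI)
  show c: "continuous_on J \<gamma>" using assms continuous_on_subset by (auto simp: smooth_curve_def)
  fix d k assume d: "d \<in> A"
  obtain N where N: "open N" "J \<inter> \<gamma> -` fst d = J \<inter> N"
    using relatively_open_preimage[OF c open_chart_domain[OF d]] by blast
  have "Ck_on k (I \<inter> \<gamma> -` fst d) (snd d \<circ> \<gamma>)"
    using assms(1) d by (simp add: smooth_curve_def smooth_on_def)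
  moreover have "J \<inter> \<gamma> -` fst d \<subseteq> I \<inter> \<gamma> -` fst d" using assms(2) by blast
  moreover have "thick (J \<inter> \<gamma> -` fst d)"
    unfolding N(2) by (rule thick_Int_open[OF assms(3) N(1)])
  ultimately show "Ck_on k (J \<inter> \<gamma> -` fst d) (snd d \<circ> \<gamma>)"
    by (rule Ck_subset)
qed

lemma smooth_curve_local:
  assumes "\<And>s. s \<in> I \<Longrightarrow> \<exists>N \<delta>. open N \<and> s \<in> N \<and> smooth_curve A (I \<inter> N) \<delta> \<and> (\<forall>r\<in>I \<inter> N. \<gamma> r = \<delta> r)"
  shows "smooth_curve A I \<gamma>"
  unfolding smooth_curve_def smooth_on_def
proof (intro conjI ballI allI)
  show "continuous_on I \<gamma>"
    unfolding continuous_on_eq_continuous_within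
  proof
    fix s assume s: "s \<in> I"
    then obtain N \<delta> where N: "open N" "s \<in> N" "smooth_curve A (I \<inter> N) \<delta>" "\<And>r. r \<in> I \<inter> N \<Longrightarrow> \<gamma> r = \<delta> r"
      using assms[of s] by blast
    have "continuous_on (I \<inter> N) \<gamma>"
      by (rule continuous_on_eq[of _ \<delta>]) (use N(3,4) in \<open>auto simp: smooth_curve_def\<close>)
    then show "continuous (at s within I) \<gamma>"
      using s N at_within_Int_open_set[of s N I] by (metis IntI continuous_on_eq_continuous_within)
  qed
  fix c k assume c: "c \<in> A"
  show "Ck_on k (I \<inter> \<gamma> -` fst c) (snd c \<circ> \<gamma>)"
  proof (rule Ck_local)
    fix s assume s: "s \<in> I \<inter> \<gamma> -` fst c"
    obtain N \<delta> where N: "open N" "s \<in> N" "smooth_curve A (I \<inter> N) \<delta>" "\<And>r. r \<in> I \<inter> N \<Longrightarrow> \<gamma> r = \<delta> r"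
      using assms[of s] s by blast
    have "I \<inter> \<gamma> -` fst c \<inter> N = I \<inter> N \<inter> \<delta> -` fst c" using N(4) by auto
    moreover have "Ck_on k (I \<inter> N \<inter> \<delta> -` fst c) (snd c \<circ> \<delta>)"
      using N(3) c by (simp add: smooth_curve_def smooth_on_def)
    ultimately have "Ck_on k (I \<inter> \<gamma> -` fst c \<inter> N) (snd c \<circ> \<gamma>)"
      using Ck_cong[of "I \<inter> N \<inter> \<delta> -` fst c" "snd c \<circ> \<gamma>" "snd c \<circ> \<delta>" k] N(4) by auto
    then show "\<exists>N. open N \<and> s \<in> N \<and> Ck_on k (I \<inter> \<gamma> -` fst c \<inter> N) (snd c \<circ> \<gamma>)"
      using N by blast
  qed
qed

end

section \<open>Metric and causality in coordinates\<close>

text \<open>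
  Bounding each of the finitely many partial derivatives on a compact ball bounds the operator norm
  of the derivative there.
\<close>

lemma C1_lipschitz_on_cball:
  fixes f :: "'e::euclidean_space \<Rightarrow> real"
  assumes U: "open U" and f: "Ck_on 1 U f" and ball: "cball x \<rho> \<subseteq> U"
  obtains L where "0 \<le> L" "\<And>y z. y \<in> cball x \<rho> \<Longrightarrow> z \<in> cball x \<rho> \<Longrightarrow> \<bar>f y - f z\<bar> \<le> L * norm (y - z)"
proof -
  let ?f' = "\<lambda>y. frechet_derivative f (at y within U)"
  have d: "(f has_derivative ?f' y) (at y within U)" if "y \<in> U" for y
    using Ck_Suc_derivative[of 0 U f y] f that by simp
  have "\<exists>B. \<forall>y\<in>cball x \<rho>. \<bar>?f' y k\<bar> \<le> B" for k
  proof -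
    have "continuous_on (cball x \<rho>) (\<lambda>y. ?f' y k)"
      by (rule continuous_on_subset[OF _ ball]) (use f in simp)
    then have "bounded ((\<lambda>y. ?f' y k) ` cball x \<rho>)"
      by (intro compact_imp_bounded compact_continuous_image compact_cball)
    then show ?thesis unfolding bounded_iff by auto
  qed
  then obtain B where B: "\<And>k y. y \<in> cball x \<rho> \<Longrightarrow> \<bar>?f' y k\<bar> \<le> B k" by metis
  define L where "L = (\<Sum>k\<in>Basis. \<bar>B k\<bar>)"
  have "onorm (?f' y) \<le> L" if y: "y \<in> cball x \<rho>" for y
  proof (rule onorm_le)
    fix v
    have lin: "linear (?f' y)" using d[of y] y ball has_derivative_linear by blast
    have "?f' y v = ?f' y (\<Sum>k\<in>Basis. (v \<bullet> k) *\<^sub>R k)" by (simp add: euclidean_representation)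
    also have "\<dots> = (\<Sum>k\<in>Basis. (v \<bullet> k) * ?f' y k)" using lin by (simp add: linear_sum linear_scale)
    finally have "norm (?f' y v) \<le> (\<Sum>k\<in>Basis. norm ((v \<bullet> k) * ?f' y k))" by (simp only: norm_sum)
    also have "\<dots> \<le> (\<Sum>k\<in>Basis. norm v * \<bar>B k\<bar>)"
    proof (rule sum_mono)
      fix k :: 'e assume "k \<in> Basis"
      then have "\<bar>v \<bullet> k\<bar> \<le> norm v" by (rule Basis_le_norm)
      moreover have "\<bar>?f' y k\<bar> \<le> \<bar>B k\<bar>" using B[OF y, of k] by linarith
      ultimately show "norm ((v \<bullet> k) * ?f' y k) \<le> norm v * \<bar>B k\<bar>"
        by (simp add: abs_mult mult_mono)
    qed
    finally show "norm (?f' y v) \<le> L * norm v" by (simp add: L_def sum_distrib_left mult.commute)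
  qed
  moreover have "(f has_derivative ?f' y) (at y within cball x \<rho>)" if "y \<in> cball x \<rho>" for y
    using has_derivative_subset[OF d ball] that ball by blast
  ultimately have "norm (f y - f z) \<le> L * norm (y - z)" if "y \<in> cball x \<rho>" "z \<in> cball x \<rho>" for y z
    using differentiable_bound[of "cball x \<rho>" f ?f' L y z] that convex_cball by blast
  then show thesis using that[of L] by (auto simp: L_def sum_nonneg)
qed

context lorentzian_manifold
begin

text \<open>
  The metric of a chart as a field of bilinear forms on the image of the chart, so that base points
  and vectors are both elements of the model space and can be varied jointly.
\<close>

definition metric_coords :: "('a, 'e) chart \<Rightarrow> 'e \<Rightarrow> 'e \<Rightarrow> 'e \<Rightarrow> real" where
  "metric_coords c x = metric_in_chart A g c (chart_inv c x)"

context
  fixes c :: "('a, 'e) chart"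
  assumes c: "c \<in> A"
begin

lemma metric_coords_lorentz: "x \<in> snd c ` fst c \<Longrightarrow> lorentz_form (metric_coords c x)"
  unfolding metric_coords_def using signature c chart_inv_in by blast

lemma metric_coords_expand:
  assumes "x \<in> snd c ` fst c"
  shows "metric_coords c x u w = (\<Sum>(i,j)\<in>Basis \<times> Basis. (u \<bullet> i) * (w \<bullet> j) * metric_coords c x i j)"
proof -
  have b: "bilinear (metric_coords c x)"
    using metric_coords_lorentz[OF assms] by (rule lorentz_formD)
  have "metric_coords c x u w
      = metric_coords c x (\<Sum>i\<in>Basis. (u \<bullet> i) *\<^sub>R i) (\<Sum>i\<in>Basis. (w \<bullet> i) *\<^sub>R i)"
    by (simp add: euclidean_representation)
  also have "\<dots> = (\<Sum>(i,j)\<in>Basis \<times> Basis. (u \<bullet> i) * (w \<bullet> j) * metric_coords c x i j)"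
    by (simp add: bilinear_sum[OF b] bilinear_lmul[OF b] bilinear_rmul[OF b] split_def mult_ac)
  finally show ?thesis .
qed

lemma metric_coords_tendsto:
  assumes x: "x \<in> snd c ` fst c" and "(X \<longlongrightarrow> x) F" "(Y \<longlongrightarrow> u) F" "(Z \<longlongrightarrow> w) F"
  shows "((\<lambda>t. metric_coords c (X t) (Y t) (Z t)) \<longlongrightarrow> metric_coords c x u w) F"
proof -
  have op: "open (snd c ` fst c)" using c open_chart_image by blast
  have G: "((\<lambda>t. metric_coords c (X t) i j) \<longlongrightarrow> metric_coords c x i j) F" for i j
  proof -
    have "continuous_on (snd c ` fst c) (\<lambda>x. metric_coords c x i j)"
      unfolding metric_coords_def
      using smooth_metric[OF c] Ck_imp_continuous unfolding smooth_on_def by blast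
    then show ?thesis using continuous_on_tendsto_compose[OF _ assms(2) x]
      topological_tendstoD[OF assms(2) op x] by simp
  qed
  have "((\<lambda>t. \<Sum>(i,j)\<in>Basis \<times> Basis. (Y t \<bullet> i) * (Z t \<bullet> j) * metric_coords c (X t) i j)
      \<longlongrightarrow> (\<Sum>(i,j)\<in>Basis \<times> Basis. (u \<bullet> i) * (w \<bullet> j) * metric_coords c x i j)) F"
    unfolding split_def by (intro tendsto_intros assms G)
  then have "((\<lambda>t. \<Sum>(i,j)\<in>Basis \<times> Basis. (Y t \<bullet> i) * (Z t \<bullet> j) * metric_coords c (X t) i j)
      \<longlongrightarrow> metric_coords c x u w) F"
    by (simp only: metric_coords_expand[OF x, of u w])
  then show ?thesis
  proof (rule Lim_transform_eventually)
    show "eventually (\<lambda>t. (\<Sum>(i,j)\<in>Basis \<times> Basis. (Y t \<bullet> i) * (Z t \<bullet> j) * metric_coords c (X t) i j)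
       = metric_coords c (X t) (Y t) (Z t)) F"
      using topological_tendstoD[OF assms(2) op x]
      by eventually_elim (rule metric_coords_expand[symmetric])
  qed
qed

text \<open>
  The corner of a causal curve is smoothed below by moving it by a small amount. A Lipschitz
  estimate, rather than mere continuity, is needed because the curve may be null and then only
  survives perturbations of the metric that are proportional to the timelike part added to its
  velocity.
\<close>

lemma metric_coords_lipschitz:
  assumes "cball x \<rho> \<subseteq> snd c ` fst c"
  obtains L where "0 \<le> L" "\<And>y z u w. y \<in> cball x \<rho> \<Longrightarrow> z \<in> cball x \<rho> \<Longrightarrow>
    \<bar>metric_coords c y u w - metric_coords c z u w\<bar> \<le> L * norm (y - z) * (norm u * norm w)"
proof -
  have "\<exists>L. 0 \<le> L \<and> (\<forall>y\<in>cball x \<rho>. \<forall>z\<in>cball x \<rho>.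
      \<bar>metric_coords c y i j - metric_coords c z i j\<bar> \<le> L * norm (y - z))" for i j
  proof -
    have "Ck_on 1 (snd c ` fst c) (\<lambda>x. metric_coords c x i j)"
      unfolding metric_coords_def using smooth_metric[OF c] unfolding smooth_on_def by blast
    then show ?thesis
      using C1_lipschitz_on_cball[OF open_chart_image[OF c] _ assms] by metis
  qed
  then obtain L where L: "\<And>i j. 0 \<le> L i j" "\<And>i j y z. y \<in> cball x \<rho> \<Longrightarrow> z \<in> cball x \<rho> \<Longrightarrow>
      \<bar>metric_coords c y i j - metric_coords c z i j\<bar> \<le> L i j * norm (y - z)" by metis
  define K where "K = (\<Sum>(i,j)\<in>Basis \<times> Basis. L i j)"
  have "\<bar>metric_coords c y u w - metric_coords c z u w\<bar> \<le> K * norm (y - z) * (norm u * norm w)"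
    if y: "y \<in> cball x \<rho>" and z: "z \<in> cball x \<rho>" for y z u w
  proof -
    have "y \<in> snd c ` fst c" "z \<in> snd c ` fst c" using y z assms by auto
    then have "\<bar>metric_coords c y u w - metric_coords c z u w\<bar>
        = \<bar>\<Sum>(i,j)\<in>Basis \<times> Basis. (u \<bullet> i) * (w \<bullet> j) * (metric_coords c y i j - metric_coords c z i j)\<bar>"
      using metric_coords_expand[of y u w] metric_coords_expand[of z u w]
      by (simp add: split_def sum_subtractf[symmetric] right_diff_distrib)
    also have "\<dots> \<le> (\<Sum>(i,j)\<in>Basis \<times> Basis. norm u * norm w * (L i j * norm (y - z)))"
      unfolding split_def
    proof (rule order_trans[OF sum_abs], rule sum_mono)
      fix p :: "'e \<times> 'e" assume p: "p \<in> Basis \<times> Basis"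
      have "\<bar>u \<bullet> fst p\<bar> \<le> norm u" "\<bar>w \<bullet> snd p\<bar> \<le> norm w" using p by (auto simp: Basis_le_norm)
      then show "\<bar>(u \<bullet> fst p) * (w \<bullet> snd p) * (metric_coords c y (fst p) (snd p) - metric_coords c z (fst p) (snd p))\<bar>
          \<le> norm u * norm w * (L (fst p) (snd p) * norm (y - z))"
        unfolding abs_mult using L(2)[OF y z] by (intro mult_mono) auto
    qed
    also have "\<dots> = K * norm (y - z) * (norm u * norm w)"
      by (simp add: K_def split_def sum_distrib_left sum_distrib_right mult_ac)
    finally show ?thesis .
  qed
  moreover have "0 \<le> K" unfolding K_def split_def by (intro sum_nonneg L(1))
  ultimately show thesis using that by blast
qed

lemma metric_velocity:
  assumes "smooth_curve A I \<gamma>" "thick I" "s \<in> I" "\<gamma> s \<in> fst c"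
  shows "g (\<gamma> s) (velocity A I \<gamma> s) (velocity A I \<gamma> s)
    = metric_coords c (snd c (\<gamma> s)) (velocity A I \<gamma> s c) (velocity A I \<gamma> s c)"
proof -
  have "velocity A I \<gamma> s = tangent_vec A c (\<gamma> s) (velocity A I \<gamma> s c)"
    using velocity_eq_tangent_vec[OF assms(1,2) c assms(3,4)] .
  then show ?thesis
    unfolding metric_coords_def metric_in_chart_def chart_inv_chart[OF c assms(4)] by simp
qed

end

lemma continuous_on_speed_square:
  assumes "smooth_curve A I \<gamma>" "thick I"
  shows "continuous_on I (\<lambda>s. g (\<gamma> s) (velocity A I \<gamma> s) (velocity A I \<gamma> s))"
  unfolding continuous_on_def
proof
  fix s assume s: "s \<in> I"
  obtain c where c: "c \<in> A" "\<gamma> s \<in> fst c" using chart_at_exists by blast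
  note * = assms c(1) s c(2)
  have x: "snd c (\<gamma> s) \<in> snd c ` fst c" using c by blast
  have "((\<lambda>r. metric_coords c (snd c (\<gamma> r)) (velocity A I \<gamma> r c) (velocity A I \<gamma> r c)) \<longlongrightarrow>
     g (\<gamma> s) (velocity A I \<gamma> s) (velocity A I \<gamma> s)) (at s within I)"
    unfolding metric_velocity[OF c(1) assms s c(2)]
    by (intro metric_coords_tendsto[OF c(1) x] chart_curve_tendsto[OF *] velocity_component_tendsto[OF *])
  then show "((\<lambda>s. g (\<gamma> s) (velocity A I \<gamma> s) (velocity A I \<gamma> s)) \<longlongrightarrow>
     g (\<gamma> s) (velocity A I \<gamma> s) (velocity A I \<gamma> s)) (at s within I)"
  proof (rule Lim_transform_eventually)
    have "eventually (\<lambda>r. r \<in> I) (at s within I)" by (auto simp: eventually_at_filter)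
    then show "eventually (\<lambda>r. metric_coords c (snd c (\<gamma> r)) (velocity A I \<gamma> r c) (velocity A I \<gamma> r c) =
       g (\<gamma> r) (velocity A I \<gamma> r) (velocity A I \<gamma> r)) (at s within I)"
      using eventually_in_chart[OF *]
      by eventually_elim (metis metric_velocity[OF c(1) assms])
  qed
qed

end

lemma velocity_cong_filter:
  fixes A :: "('a::topological_space, 'e::euclidean_space) chart set"
  assumes "at s within I = at s within J" "eventually (\<lambda>r. \<gamma> r = \<delta> r) (nhds s)"
  shows "velocity A I \<gamma> s = velocity A J \<delta> s"
proof
  fix c :: "('a, 'e) chart"
  have s: "\<gamma> s = \<delta> s" using assms(2) eventually_nhds_x_imp_x by blast
  have "(snd c \<circ> \<gamma> has_vector_derivative D) (at s within J) \<longleftrightarrow>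
     (snd c \<circ> \<delta> has_vector_derivative D) (at s within J)" for D
    by (rule has_vector_derivative_cong_ev) (use assms(2) s in \<open>auto elim: eventually_mono\<close>)
  then have "vector_derivative (snd c \<circ> \<gamma>) (at s within J) = vector_derivative (snd c \<circ> \<delta>) (at s within J)"
    unfolding vector_derivative_def by simp
  then show "velocity A I \<gamma> s c = velocity A J \<delta> s c"
    unfolding velocity_def s assms(1) by simp
qed

lemma eventually_nhds_Pair_obtain:
  assumes "eventually (\<lambda>p. Q (fst p) (snd p)) (nhds (x :: 'e::real_normed_vector, u :: 'f::real_normed_vector))"
  obtains e where "0 < e" "\<And>y w. norm (y - x) < e \<Longrightarrow> norm (w - u) < e \<Longrightarrow> Q y w"
proof -
  obtain d where d: "d > 0" "\<And>p. dist p (x, u) < d \<Longrightarrow> Q (fst p) (snd p)"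
    using assms unfolding eventually_nhds_metric by blast
  show thesis
  proof (rule that[of "d/2"])
    fix y w assume "norm (y - x) < d/2" "norm (w - u) < d/2"
    then have "dist (y, w) (x, u) < d"
      using sqrt_sum_squares_le_sum[of "dist y x" "dist w u"] unfolding dist_Pair_Pair unfolding dist_norm by simp
    then show "Q y w" using d(2)[of "(y, w)"] by simp
  qed (use d in simp)
qed

context spacetime
begin

definition orient_coords :: "('a, 'e) chart \<Rightarrow> 'e \<Rightarrow> 'e" where
  "orient_coords c x = \<theta> (chart_inv c x) c"

definition future_causal_vec :: "('a, 'e) chart \<Rightarrow> 'e \<Rightarrow> 'e \<Rightarrow> bool" where
  "future_causal_vec c x u \<longleftrightarrow> metric_coords c x u u \<le> 0 \<and> metric_coords c x u (orient_coords c x) < 0"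

definition future_timelike_vec :: "('a, 'e) chart \<Rightarrow> 'e \<Rightarrow> 'e \<Rightarrow> bool" where
  "future_timelike_vec c x u \<longleftrightarrow> metric_coords c x u u < 0 \<and> metric_coords c x u (orient_coords c x) < 0"

lemma future_timelike_imp_causal: "future_timelike_vec c x u \<Longrightarrow> future_causal_vec c x u"
  by (simp add: future_timelike_vec_def future_causal_vec_def)

context
  fixes c :: "('a, 'e) chart"
  assumes c: "c \<in> A"
begin

lemma orient_coords_tendsto:
  assumes x: "x \<in> snd c ` fst c" and "(X \<longlongrightarrow> x) F"
  shows "((\<lambda>t. orient_coords c (X t)) \<longlongrightarrow> orient_coords c x) F"
proof -
  have op: "open (snd c ` fst c)" using c open_chart_image by blast
  have "continuous_on (snd c ` fst c) (\<lambda>x. orient_coords c x)"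
    unfolding orient_coords_def
    using orientation_smooth[OF c] Ck_imp_continuous unfolding smooth_on_def by blast
  then show ?thesis using continuous_on_tendsto_compose[OF _ assms(2) x]
    topological_tendstoD[OF assms(2) op x] by simp
qed

lemma orientation_eq:
  assumes "x \<in> snd c ` fst c"
  shows "\<theta> (chart_inv c x) = tangent_vec A c (chart_inv c x) (orient_coords c x)"
  unfolding orient_coords_def
  using tangent_vec_eqI[OF orientation_tangent c chart_inv_in[OF c assms]] .

lemma orient_coords_timelike:
  assumes "x \<in> snd c ` fst c"
  shows "metric_coords c x (orient_coords c x) (orient_coords c x) < 0"
proof -
  have "g (chart_inv c x) (\<theta> (chart_inv c x)) (\<theta> (chart_inv c x)) < 0"
    using orientation_timelike by (auto simp: timelike_def)
  then show ?thesis
    unfolding metric_coords_def metric_in_chart_def using orientation_eq[OF assms] by simp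
qed

lemma metric_orient_velocity:
  assumes "smooth_curve A I \<gamma>" "thick I" "s \<in> I" "\<gamma> s \<in> fst c"
  shows "g (\<gamma> s) (velocity A I \<gamma> s) (\<theta> (\<gamma> s))
    = metric_coords c (snd c (\<gamma> s)) (velocity A I \<gamma> s c) (orient_coords c (snd c (\<gamma> s)))"
proof -
  have "velocity A I \<gamma> s = tangent_vec A c (\<gamma> s) (velocity A I \<gamma> s c)"
    using velocity_eq_tangent_vec[OF assms(1,2) c assms(3,4)] .
  moreover have "\<theta> (\<gamma> s) = tangent_vec A c (\<gamma> s) (orient_coords c (snd c (\<gamma> s)))"
    using orientation_eq[of "snd c (\<gamma> s)"] chart_inv_chart[OF c assms(4)] assms(4) by simp
  ultimately show ?thesis
    unfolding metric_coords_def metric_in_chart_def chart_inv_chart[OF c assms(4)] by simp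
qed

lemma future_timelike_open:
  assumes x: "x \<in> snd c ` fst c" and u: "future_timelike_vec c x u"
  obtains e where "0 < e" "\<And>y w. norm (y - x) < e \<Longrightarrow> norm (w - u) < e \<Longrightarrow>
    y \<in> snd c ` fst c \<and> future_timelike_vec c y w"
proof -
  have f: "(fst \<longlongrightarrow> x) (nhds (x, u))" and s: "(snd \<longlongrightarrow> u) (nhds (x, u))"
    using tendsto_fst[OF filterlim_ident, of "(x,u)"] tendsto_snd[OF filterlim_ident, of "(x,u)"] by auto
  have "eventually (\<lambda>p. metric_coords c (fst p) (snd p) (snd p) < 0) (nhds (x, u))"
    using order_tendstoD(2)[OF metric_coords_tendsto[OF c x f s s]] u by (simp add: future_timelike_vec_def)
  moreover have "eventually (\<lambda>p. metric_coords c (fst p) (snd p) (orient_coords c (fst p)) < 0) (nhds (x, u))"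
    using order_tendstoD(2)[OF metric_coords_tendsto[OF c x f s orient_coords_tendsto[OF x f]]] u
    by (simp add: future_timelike_vec_def)
  moreover have "eventually (\<lambda>p. fst p \<in> snd c ` fst c) (nhds (x, u))"
    using topological_tendstoD[OF f open_chart_image[OF c] x] .
  ultimately have "eventually (\<lambda>p. fst p \<in> snd c ` fst c \<and> future_timelike_vec c (fst p) (snd p)) (nhds (x, u))"
    by eventually_elim (simp add: future_timelike_vec_def)
  from eventually_nhds_Pair_obtain[OF this] show thesis using that by metis
qed

lemma future_timelike_imp_product_neg:
  assumes "x \<in> snd c ` fst c" "future_causal_vec c x v" "future_timelike_vec c x w"
  shows "metric_coords c x v w < 0"
  using lorentz_future_product_neg[OF metric_coords_lorentz[OF c assms(1)] orient_coords_timelike[OF assms(1)]] assms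
  by (simp add: future_causal_vec_def future_timelike_vec_def)

lemma future_causal_curveD:
  assumes "future_causal_curve A g \<theta> I \<gamma>" "thick I" "s \<in> I" "\<gamma> s \<in> fst c"
  shows "future_causal_vec c (snd c (\<gamma> s)) (velocity A I \<gamma> s c)"
proof -
  have s: "smooth_curve A I \<gamma>" using assms(1) by (simp add: future_causal_curve_def)
  show ?thesis
    using assms(1,3) metric_velocity[OF c s assms(2-4)] metric_orient_velocity[OF s assms(2-4)]
    by (auto simp: future_causal_curve_def causal_def future_causal_vec_def)
qed

lemma velocity_chart_inv:
  assumes "thick I" "s \<in> I" "(\<xi> has_vector_derivative D) (at s within I)" "\<xi> ` I \<subseteq> snd c ` fst c"
  shows "velocity A I (chart_inv c \<circ> \<xi>) s c = D"
proof -
  have "(snd c \<circ> (chart_inv c \<circ> \<xi>) has_vector_derivative D) (at s within I)"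
    by (rule has_vector_derivative_transform[OF assms(2) _ assms(3)])
      (use assms chart_chart_inv[OF c] in auto)
  moreover have "chart_inv c (\<xi> s) \<in> fst c" using assms chart_inv_in[OF c] by auto
  ultimately show ?thesis
    using vector_derivative_thick[OF assms(1,2)] c by (simp add: velocity_def charts_at_def)
qed

end

text \<open>
  The velocity is automatically nonzero: it has a nonzero product with the time orientation.
\<close>

lemma future_causal_curveI:
  assumes "smooth_curve A I \<gamma>" "thick I"
    "\<And>s. s \<in> I \<Longrightarrow> \<exists>c\<in>A. \<gamma> s \<in> fst c \<and> future_causal_vec c (snd c (\<gamma> s)) (velocity A I \<gamma> s c)"
  shows "future_causal_curve A g \<theta> I \<gamma>"
  unfolding future_causal_curve_def
proof (intro conjI ballI)
  fix s assume s: "s \<in> I"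
  then obtain c where c: "c \<in> A" "\<gamma> s \<in> fst c" and f: "future_causal_vec c (snd c (\<gamma> s)) (velocity A I \<gamma> s c)"
    using assms(3) by blast
  have b: "bilinear (metric_coords c (snd c (\<gamma> s)))"
    using metric_coords_lorentz[OF c(1)] lorentz_formD(1) c(2) by blast
  have "velocity A I \<gamma> s c \<noteq> 0"
    using f bilinear_lzero[OF b] by (auto simp: future_causal_vec_def)
  then show "causal g (\<gamma> s) (velocity A I \<gamma> s)"
    using f metric_velocity[OF c(1) assms(1,2) s c(2)] by (auto simp: causal_def future_causal_vec_def)
  show "g (\<gamma> s) (velocity A I \<gamma> s) (\<theta> (\<gamma> s)) < 0"
    using f metric_orient_velocity[OF c(1) assms(1,2) s c(2)] by (simp add: future_causal_vec_def)
qed (rule assms)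

lemma coordinate_curve_future_causal:
  assumes c: "c \<in> A" and I: "thick I" and "smooth_on I \<xi>" "\<xi> ` I \<subseteq> snd c ` fst c"
    "\<And>s. s \<in> I \<Longrightarrow> (\<xi> has_vector_derivative D s) (at s within I)"
    "\<And>s. s \<in> I \<Longrightarrow> future_causal_vec c (\<xi> s) (D s)"
  shows "future_causal_curve A g \<theta> I (chart_inv c \<circ> \<xi>)"
proof (rule future_causal_curveI[OF smooth_curve_chart_inv[OF I c assms(3,4)] I])
  fix s assume s: "s \<in> I"
  have "velocity A I (chart_inv c \<circ> \<xi>) s c = D s"
    by (rule velocity_chart_inv[OF c I s assms(5)[OF s] assms(4)])
  moreover have "\<xi> s \<in> snd c ` fst c" using s assms(4) by blast
  ultimately show "\<exists>d\<in>A. (chart_inv c \<circ> \<xi>) s \<in> fst d \<and>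
      future_causal_vec d (snd d ((chart_inv c \<circ> \<xi>) s)) (velocity A I (chart_inv c \<circ> \<xi>) s d)"
    using c assms(6)[OF s] chart_chart_inv[OF c] chart_inv_in[OF c] by (intro bexI[of _ c]) auto
qed

lemma future_causal_segment:
  assumes c: "c \<in> A" and "0 < \<delta>"
    and "\<And>r. 0 \<le> r \<Longrightarrow> r \<le> \<delta> \<Longrightarrow> x + r *\<^sub>R w \<in> snd c ` fst c \<and> future_causal_vec c (x + r *\<^sub>R w) w"
  shows "future_causal_from_to A g \<theta> 0 \<delta> (chart_inv c \<circ> (\<lambda>r. x + r *\<^sub>R w))
    (chart_inv c x) (chart_inv c (x + \<delta> *\<^sub>R w))"
proof -
  have t: "thick {0..\<delta>}" using assms thick_interval by blast
  have "future_causal_curve A g \<theta> {0..\<delta>} (chart_inv c \<circ> (\<lambda>r. x + r *\<^sub>R w))"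
  proof (rule coordinate_curve_future_causal[OF c t, where D = "\<lambda>_. w"])
    show "smooth_on {0..\<delta>} (\<lambda>r. x + r *\<^sub>R w)"
      unfolding smooth_on_def
      by (intro allI Ck_add Ck_const Ck_linear t bounded_linear_scaleR_left)
    show "((\<lambda>r. x + r *\<^sub>R w) has_vector_derivative w) (at s within {0..\<delta>})" for s
      by (auto simp: has_vector_derivative_def intro!: derivative_eq_intros)
  qed (use assms in auto)
  then show ?thesis using assms by (simp add: future_causal_from_to_def)
qed

lemma future_causal_curve_subset:
  assumes "future_causal_curve A g \<theta> I \<gamma>" "thick I" "J \<subseteq> I" "thick J"
  shows "future_causal_curve A g \<theta> J \<gamma>"
    and "\<And>s. s \<in> J \<Longrightarrow> velocity A J \<gamma> s = velocity A I \<gamma> s"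
proof -
  have sI: "smooth_curve A I \<gamma>" using assms by (simp add: future_causal_curve_def)
  have sJ: "smooth_curve A J \<gamma>" using smooth_curve_subset[OF sI assms(3,4)] .
  show v: "velocity A J \<gamma> s = velocity A I \<gamma> s" if s: "s \<in> J" for s
  proof
    fix d show "velocity A J \<gamma> s d = velocity A I \<gamma> s d"
    proof (cases "d \<in> charts_at A (\<gamma> s)")
      case True
      then have d: "d \<in> A" "\<gamma> s \<in> fst d" by (auto simp: charts_at_def)
      have "(snd d \<circ> \<gamma> has_vector_derivative velocity A I \<gamma> s d) (at s within J)"
        using has_vector_derivative_within_subset[OF chart_curve_has_vector_derivative[OF sI assms(2) d(1) _ d(2)] assms(3)]
          s assms(3) by blast
      then show ?thesis
        using vector_derivative_thick[OF assms(4) s] True by (simp add: velocity_def)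
    next
      case False then show ?thesis by (simp add: velocity_def)
    qed
  qed
  show "future_causal_curve A g \<theta> J \<gamma>"
    using sJ v assms(1,3) unfolding future_causal_curve_def by auto
qed

end

section \<open>Appending a timelike segment to a causal curve\<close>

lemma vector_derivative_norm_bound:
  fixes f :: "real \<Rightarrow> 'y::euclidean_space"
  assumes "a \<le> b" "\<And>s. s \<in> {a..b} \<Longrightarrow> (f has_vector_derivative f' s) (at s within {a..b})"
    "\<And>s. s \<in> {a..b} \<Longrightarrow> norm (f' s) \<le> B"
  shows "norm (f b - f a) \<le> B * (b - a)"
proof -
  have "norm (f b - f a) \<le> B * norm (b - a)"
  proof (rule differentiable_bound[of "{a..b}" f "\<lambda>s r. r *\<^sub>R f' s"])
    show "onorm (\<lambda>r. r *\<^sub>R f' s) \<le> B" if "s \<in> {a..b}" for s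
      by (rule onorm_le) (use assms(3)[OF that] in \<open>simp add: mult.commute[of B] mult_left_mono\<close>)
  qed (use assms in \<open>auto simp: has_vector_derivative_def\<close>)
  then show ?thesis using assms(1) by simp
qed

text \<open>
  The velocity passes from that of \<open>\<xi>\<close> to the constant \<open>w\<close> by means of a smooth step \<open>\<psi>\<close>, and the
  curve is obtained by integration. Since \<open>\<psi>\<close> is increasing, the deviation from \<open>\<xi>\<close> at time \<open>s\<close> is
  bounded by the length of the interval times \<open>\<psi> s\<close>: it is small compared with the amount of
  \<open>w\<close> already present in the velocity. The interval ends at \<open>b\<close>, where \<open>\<xi>\<close> is still defined, and
  \<open>\<psi> = 1\<close> near \<open>b\<close>, so that no extension of \<open>\<xi>\<close> beyond \<open>b\<close> is needed.
\<close>

lemma blend_into_line: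
  fixes \<xi> :: "real \<Rightarrow> 'e::euclidean_space"
  assumes ab: "a < b" "0 < \<epsilon>" and sm: "smooth_on {a..b} \<xi>"
    and der: "\<And>s. s \<in> {a..b} \<Longrightarrow> (\<xi> has_vector_derivative v s) (at s within {a..b})"
    and K: "\<And>s. s \<in> {a..b} \<Longrightarrow> norm (v s) \<le> K" "norm w \<le> K"
  obtains \<zeta> and \<psi> :: "real \<Rightarrow> real" and s1 where "a < s1" "s1 < b" "smooth_on {a..b + \<epsilon>} \<zeta>"
    "\<forall>s. 0 \<le> \<psi> s \<and> \<psi> s \<le> 1" "\<forall>s\<le>s1. \<psi> s = 0"
    "\<forall>s\<in>{a..b}. (\<zeta> has_vector_derivative (1 - \<psi> s) *\<^sub>R v s + \<psi> s *\<^sub>R w) (at s within {a..b + \<epsilon>})"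
    "\<forall>s\<in>{b..b + \<epsilon>}. (\<zeta> has_vector_derivative w) (at s within {a..b + \<epsilon>})"
    "\<forall>s\<in>{a..b}. norm (\<zeta> s - \<xi> s) \<le> 2 * K * (b - a) * \<psi> s"
    "\<forall>s\<in>{b..b + \<epsilon>}. \<zeta> s = \<zeta> b + (s - b) *\<^sub>R w"
proof -
  define s1 s2 where "s1 = (a + b) / 2" and "s2 = (s1 + b) / 2"
  have s12: "a < s1" "s1 < s2" "s2 < b" using ab by (auto simp: s1_def s2_def field_simps)
  obtain \<psi> :: "real \<Rightarrow> real" where \<psi>: "smooth_on UNIV \<psi>" "mono \<psi>"
    "\<And>x. x \<le> s1 \<Longrightarrow> \<psi> x = 0" "\<And>x. x \<ge> s2 \<Longrightarrow> \<psi> x = 1"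
    using smooth_step[OF s12(2)] by blast
  have \<psi>01: "0 \<le> \<psi> s \<and> \<psi> s \<le> 1" for s
  proof
    show "0 \<le> \<psi> s" using monoD[OF \<psi>(2), of "min s s1" s] \<psi>(3)[of "min s s1"] by simp
    show "\<psi> s \<le> 1" using monoD[OF \<psi>(2), of s "max s s2"] \<psi>(4)[of "max s s2"] by simp
  qed
  define J where "J = {a..b + \<epsilon>}"
  have thJ: "thick J" and thI: "thick {a..b}" unfolding J_def using ab by (auto intro!: thick_interval)
  define V where "V s = (if s \<le> b then (1 - \<psi> s) *\<^sub>R v s else 0) + \<psi> s *\<^sub>R w" for s
  have V_le: "V s = (1 - \<psi> s) *\<^sub>R v s + \<psi> s *\<^sub>R w" if "s \<le> b" for s using that by (simp add: V_def)
  have V_ge: "V s = w" if "s2 \<le> s" for s using \<psi>(4)[OF that] by (simp add: V_def)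
  have vsm: "Ck_on k {a..b} v" for k
  proof -
    have "Ck_on k {a..b} (\<lambda>s. vector_derivative \<xi> (at s within {a..b}))"
      using smooth_on_vector_derivative(2)[OF thI sm] by (simp add: smooth_on_def)
    then show ?thesis
      using Ck_cong[of "{a..b}" "\<lambda>s. vector_derivative \<xi> (at s within {a..b})" v k]
        vector_derivative_thick[OF thI _ der] by blast
  qed
  have VC: "Ck_on k J V" for k
  proof (rule Ck_local)
    fix s assume s: "s \<in> J"
    show "\<exists>N. open N \<and> s \<in> N \<and> Ck_on k (J \<inter> N) V"
    proof (cases "s < b")
      case True
      have th: "thick (J \<inter> {..<b})" by (rule thick_Int_open[OF thJ]) auto
      have "Ck_on k (J \<inter> {..<b}) v"
        by (rule Ck_subset[OF vsm _ th]) (auto simp: J_def)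
      moreover have p: "Ck_on k (J \<inter> {..<b}) \<psi>"
        by (rule Ck_subset[OF _ _ th, of k UNIV]) (use \<psi>(1) in \<open>auto simp: smooth_on_def\<close>)
      moreover have "Ck_on k (J \<inter> {..<b}) (\<lambda>s. 1 + (-1) *\<^sub>R \<psi> s)"
        by (intro Ck_add Ck_const th Ck_scaleR p)
      ultimately have "Ck_on k (J \<inter> {..<b}) (\<lambda>s. (1 + (-1) *\<^sub>R \<psi> s) *\<^sub>R v s + \<psi> s *\<^sub>R w)"
        by (intro Ck_add th Ck_scaleR Ck_const)
      then have "Ck_on k (J \<inter> {..<b}) V"
        using Ck_cong[of "J \<inter> {..<b}" V "\<lambda>s. (1 + (-1) *\<^sub>R \<psi> s) *\<^sub>R v s + \<psi> s *\<^sub>R w" k]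
        by (auto simp: V_def)
      then show ?thesis using True by (intro exI[of _ "{..<b}"]) auto
    next
      case False
      have th: "thick (J \<inter> {s2<..})" by (rule thick_Int_open[OF thJ]) auto
      have "Ck_on k (J \<inter> {s2<..}) V"
        using Ck_cong[of "J \<inter> {s2<..}" V "\<lambda>_. w" k] Ck_const[OF th] V_ge by auto
      then show ?thesis using False s12 by (intro exI[of _ "{s2<..}"]) auto
    qed
  qed
  then have Vcont: "continuous_on J V" using Ck_imp_continuous by blast
  define \<zeta> where "\<zeta> s = \<xi> a + integral {a..s} V" for s
  have \<zeta>der: "(\<zeta> has_vector_derivative V s) (at s within J)" if "s \<in> J" for s
  proof -
    have "((\<lambda>s. integral {a..s} V) has_vector_derivative V s) (at s within J)"
      using integral_has_vector_derivative[of a "b + \<epsilon>" V s] Vcont that by (simp add: J_def)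
    then show ?thesis unfolding \<zeta>_def using has_vector_derivative_add[OF has_vector_derivative_const] by fastforce
  qed
  have \<zeta>sm: "smooth_on J \<zeta>"
    unfolding smooth_on_def using Ck_Suc_imp[OF Ck_Suc_vector_intro[OF thJ \<zeta>der VC]] by blast
  have dev: "norm (\<zeta> s - \<xi> s) \<le> 2 * K * (b - a) * \<psi> s" if s: "s \<in> {a..b}" for s
  proof -
    have K0: "0 \<le> K" using K(2) norm_ge_zero order_trans by blast
    have "norm ((\<zeta> s - \<xi> s) - (\<zeta> a - \<xi> a)) \<le> (2 * K * \<psi> s) * (s - a)"
    proof (rule vector_derivative_norm_bound[where f = "\<lambda>s. \<zeta> s - \<xi> s" and f' = "\<lambda>r. V r - v r"])
      fix r assume r: "r \<in> {a..s}"
      have "(\<zeta> has_vector_derivative V r) (at r within {a..s})"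
        by (rule has_vector_derivative_within_subset[OF \<zeta>der]) (use r s ab in \<open>auto simp: J_def\<close>)
      moreover have "(\<xi> has_vector_derivative v r) (at r within {a..s})"
        by (rule has_vector_derivative_within_subset[OF der]) (use r s ab in auto)
      ultimately show "((\<lambda>s. \<zeta> s - \<xi> s) has_vector_derivative V r - v r) (at r within {a..s})"
        by (rule has_vector_derivative_diff)
      have "V r - v r = \<psi> r *\<^sub>R (w - v r)" using V_le[of r] r s by (simp add: algebra_simps)
      then have "norm (V r - v r) = \<psi> r * norm (w - v r)" using \<psi>01[of r] by simp
      also have "\<dots> \<le> \<psi> s * (2 * K)"
        using \<psi>01[of s] monoD[OF \<psi>(2), of r s] r s K(1)[of r] K(2) norm_triangle_ineq4[of w "v r"]
        by (intro mult_mono) auto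
      finally show "norm (V r - v r) \<le> 2 * K * \<psi> s" by (simp add: mult.commute)
    qed (use s in auto)
    also have "\<dots> \<le> (2 * K * \<psi> s) * (b - a)" using s K0 \<psi>01[of s] by (intro mult_left_mono) auto
    finally show ?thesis by (simp add: \<zeta>_def mult_ac)
  qed
  have line: "\<zeta> s = \<zeta> b + (s - b) *\<^sub>R w" if s: "s \<in> {b..b + \<epsilon>}" for s
  proof -
    have "V integrable_on {a..s}"
      by (rule integrable_continuous_interval, rule continuous_on_subset[OF Vcont]) (use s in \<open>auto simp: J_def\<close>)
    then have "integral {a..s} V = integral {a..b} V + integral {b..s} V"
      using Henstock_Kurzweil_Integration.integral_combine[of a b s V] s ab by auto
    also have "integral {b..s} V = integral {b..s} (\<lambda>_. w)"
      by (rule integral_cong) (use V_ge s12 in auto)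
    finally show ?thesis using s by (simp add: \<zeta>_def)
  qed
  show thesis
  proof (rule that[of s1 \<zeta> \<psi>])
    show "\<forall>s\<in>{a..b}. (\<zeta> has_vector_derivative (1 - \<psi> s) *\<^sub>R v s + \<psi> s *\<^sub>R w) (at s within {a..b + \<epsilon>})"
    proof
      fix s assume "s \<in> {a..b}"
      then show "(\<zeta> has_vector_derivative (1 - \<psi> s) *\<^sub>R v s + \<psi> s *\<^sub>R w) (at s within {a..b + \<epsilon>})"
        using \<zeta>der[of s] V_le[of s] ab by (simp add: J_def)
    qed
    show "\<forall>s\<in>{b..b + \<epsilon>}. (\<zeta> has_vector_derivative w) (at s within {a..b + \<epsilon>})"
    proof
      fix s assume "s \<in> {b..b + \<epsilon>}"
      then show "(\<zeta> has_vector_derivative w) (at s within {a..b + \<epsilon>})"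
        using \<zeta>der[of s] V_ge[of s] ab s12 by (simp add: J_def)
    qed
    show "a < s1" "s1 < b" using s12 by auto
    show "smooth_on {a..b + \<epsilon>} \<zeta>" using \<zeta>sm unfolding J_def .
    show "\<forall>s. 0 \<le> \<psi> s \<and> \<psi> s \<le> 1" "\<forall>s\<le>s1. \<psi> s = 0" using \<psi>01 \<psi>(3) by blast+
    show "\<forall>s\<in>{a..b}. norm (\<zeta> s - \<xi> s) \<le> 2 * K * (b - a) * \<psi> s" using dev by blast
    show "\<forall>s\<in>{b..b + \<epsilon>}. \<zeta> s = \<zeta> b + (s - b) *\<^sub>R w" using line by blast
  qed
qed

lemma eventually_mult_less_at_right_0: "0 < \<mu> \<Longrightarrow> eventually (\<lambda>\<delta>. C * \<delta> < \<mu>) (at_right (0::real))"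
proof -
  assume "0 < \<mu>"
  have "((\<lambda>\<delta>. C * \<delta>) \<longlongrightarrow> C * 0) (at_right 0)" by (intro tendsto_intros)
  then show ?thesis using \<open>0 < \<mu>\<close> by (simp add: order_tendstoD(2))
qed

context spacetime
begin

lemma velocity_local:
  assumes "open N" "s \<in> N" "I \<inter> N = J \<inter> N" "\<And>r. r \<in> N \<Longrightarrow> \<beta> r = \<delta> r"
  shows "velocity A I \<beta> s = velocity A J \<delta> s"
proof (rule velocity_cong_filter)
  show "at s within I = at s within J"
    using assms(1-3) at_within_Int_open_set[of s N I] at_within_Int_open_set[of s N J] by simp
  show "eventually (\<lambda>r. \<beta> r = \<delta> r) (nhds s)"
    using assms by (auto simp: eventually_nhds)
qed

lemma future_causal_curve_local:
  assumes "\<And>s. s \<in> I \<Longrightarrow> \<exists>N J \<delta>. open N \<and> s \<in> N \<and> I \<inter> N = J \<inter> N \<and> thick J \<and>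
     future_causal_curve A g \<theta> J \<delta> \<and> (\<forall>r\<in>N. \<beta> r = \<delta> r)"
  shows "future_causal_curve A g \<theta> I \<beta>"
  unfolding future_causal_curve_def
proof
  show "smooth_curve A I \<beta>"
  proof (rule smooth_curve_local)
    fix s assume "s \<in> I"
    then obtain N J \<delta> where N: "open N" "s \<in> N" "I \<inter> N = J \<inter> N" "thick J"
      "future_causal_curve A g \<theta> J \<delta>" "\<And>r. r \<in> N \<Longrightarrow> \<beta> r = \<delta> r" using assms[of s] by blast
    have "smooth_curve A (I \<inter> N) \<delta>"
      unfolding N(3)
      by (rule smooth_curve_subset[of J]) (use N thick_Int_open in \<open>auto simp: future_causal_curve_def\<close>)
    then show "\<exists>N \<delta>. open N \<and> s \<in> N \<and> smooth_curve A (I \<inter> N) \<delta> \<and> (\<forall>r\<in>I \<inter> N. \<beta> r = \<delta> r)"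
      using N by blast
  qed
  show "\<forall>s\<in>I. causal g (\<beta> s) (velocity A I \<beta> s) \<and> g (\<beta> s) (velocity A I \<beta> s) (\<theta> (\<beta> s)) < 0"
  proof
    fix s assume s: "s \<in> I"
    then obtain N J \<delta> where N: "open N" "s \<in> N" "I \<inter> N = J \<inter> N" "thick J"
      "future_causal_curve A g \<theta> J \<delta>" "\<And>r. r \<in> N \<Longrightarrow> \<beta> r = \<delta> r" using assms[of s] by blast
    have "s \<in> J" using s N by blast
    then show "causal g (\<beta> s) (velocity A I \<beta> s) \<and> g (\<beta> s) (velocity A I \<beta> s) (\<theta> (\<beta> s)) < 0"
      using N velocity_local[OF N(1-3,6)] by (simp add: future_causal_curve_def)
  qed
qed

lemma orient_product_open:
  assumes c: "c \<in> A" and x: "x \<in> snd c ` fst c" and u: "metric_coords c x u (orient_coords c x) < 0"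
  obtains e where "0 < e" "\<And>y w. norm (y - x) < e \<Longrightarrow> norm (w - u) < e \<Longrightarrow>
    metric_coords c y w (orient_coords c y) < 0"
proof -
  have f: "(fst \<longlongrightarrow> x) (nhds (x, u))" and s: "(snd \<longlongrightarrow> u) (nhds (x, u))"
    using tendsto_fst[OF filterlim_ident, of "(x,u)"] tendsto_snd[OF filterlim_ident, of "(x,u)"] by auto
  have "eventually (\<lambda>p. metric_coords c (fst p) (snd p) (orient_coords c (fst p)) < 0) (nhds (x, u))"
    using order_tendstoD(2)[OF metric_coords_tendsto[OF c x f s orient_coords_tendsto[OF c x f]]] u
    by simp
  from eventually_nhds_Pair_obtain[OF this] show thesis using that by metis
qed

text \<open>
  A causal curve followed by a straight timelike segment has a corner. On a short interval before
  the corner the velocity is blended into \<open>w\<close>. At the old position a blend \<open>(1 - \<psi>) v + \<psi> w\<close> of a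
  future causal and a future timelike vector satisfies \<open>g(V, V) \<le> - \<kappa> \<psi>\<close>, whereas moving to the new
  position costs at most a constant times the deviation, which is at most \<open>\<delta> \<psi>\<close> up to a constant.
  For \<open>\<delta>\<close> small the blended curve is causal. It loses only the length of the original curve on the
  short interval, and its end point differs little from that of the segment.
\<close>

lemma append_timelike_segment:
  assumes c: "c \<in> A" and \<gamma>: "future_causal_from_to A g \<theta> a b \<gamma> p q" and q: "q \<in> fst c"
    and ball: "\<And>y. y \<in> ball (snd c q) \<rho> \<Longrightarrow> y \<in> snd c ` fst c \<and> future_timelike_vec c y w \<and>
       m\<^sup>2 \<le> - metric_coords c y w w"
    and m: "0 \<le> m" and \<epsilon>: "0 < \<epsilon>" "\<epsilon> * norm w < \<rho>" and \<eta>: "0 < \<eta>"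
  obtains b' \<beta> z where "future_causal_from_to A g \<theta> a b' \<beta> p (chart_inv c z)"
    "z \<in> snd c ` fst c" "norm (z - (snd c q + \<epsilon> *\<^sub>R w)) < \<eta>"
    "lorentzian_length A g {a..b} \<gamma> + \<epsilon> * m - \<eta> \<le> lorentzian_length A g {a..b'} \<beta>"
proof -
  define x where "x = snd c q"
  have ab: "a < b" and fc: "future_causal_curve A g \<theta> {a..b} \<gamma>" and \<gamma>ab: "\<gamma> a = p" "\<gamma> b = q"
    using \<gamma> by (auto simp: future_causal_from_to_def)
  have sc: "smooth_curve A {a..b} \<gamma>" using fc by (simp add: future_causal_curve_def)
  have thI: "thick {a..b}" using ab by (rule thick_interval)
  have x: "x \<in> snd c ` fst c" using q by (simp add: x_def)
  have \<rho>: "0 < \<rho>" using \<epsilon> by (metis less_le_trans mult_nonneg_nonneg norm_ge_zero not_less order_less_imp_le)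
  define v where "v s = velocity A {a..b} \<gamma> s c" for s
  define \<xi> where "\<xi> = snd c \<circ> \<gamma>"
  have bI: "b \<in> {a..b}" and qb: "\<gamma> b \<in> fst c" using ab \<gamma>ab q by auto
  have \<xi>b: "\<xi> b = x" by (simp add: \<xi>_def x_def \<gamma>ab)
  have lim\<xi>: "(\<xi> \<longlongrightarrow> x) (at b within {a..b})"
    using chart_curve_tendsto[OF sc thI c bI qb] by (simp add: \<xi>_def comp_def x_def \<gamma>ab)
  have limv: "(v \<longlongrightarrow> v b) (at b within {a..b})"
    using velocity_component_tendsto[OF sc thI c bI qb] by (simp add: v_def[abs_def])
  have vb: "future_causal_vec c x (v b)"
    using future_causal_curveD[OF c fc thI bI qb] by (simp add: v_def x_def \<gamma>ab)
  have xb: "x \<in> ball (snd c q) \<rho>" using \<rho> by (simp add: x_def)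
  have wx: "future_timelike_vec c x w" using ball[OF xb] by simp
  have vwx: "metric_coords c x (v b) w < 0" by (rule future_timelike_imp_product_neg[OF c x vb wx])
  have wwx: "metric_coords c x w w < 0" using wx by (simp add: future_timelike_vec_def)
  define \<kappa> where "\<kappa> = min (- metric_coords c x (v b) w) (- metric_coords c x w w) / 2"
  have \<kappa>: "0 < \<kappa>" "metric_coords c x (v b) w < - \<kappa>" "metric_coords c x w w < - \<kappa>"
    using vwx wwx by (auto simp: \<kappa>_def min_def)
  obtain e where e: "0 < e" "\<And>y u. norm (y - x) < e \<Longrightarrow> norm (u - v b) < e \<Longrightarrow>
      metric_coords c y u (orient_coords c y) < 0"
    using orient_product_open[OF c x] vb unfolding future_causal_vec_def by blast
  define r where "r = min (\<rho> / 2) e"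
  have r: "0 < r" "r < \<rho>" "r \<le> e" using \<rho> e(1) by (auto simp: r_def)
  have rdom: "cball x r \<subseteq> snd c ` fst c"
    using ball r by (auto simp: x_def subset_iff)
  obtain L where L: "0 \<le> L" "\<And>y z u w. y \<in> cball x r \<Longrightarrow> z \<in> cball x r \<Longrightarrow>
      \<bar>metric_coords c y u w - metric_coords c z u w\<bar> \<le> L * norm (y - z) * (norm u * norm w)"
    using metric_coords_lipschitz[OF c rdom] by blast
  define K where "K = max (norm (v b) + 1) (norm w)"
  define F where "F s = sqrt (- g (\<gamma> s) (velocity A {a..b} \<gamma> s) (velocity A {a..b} \<gamma> s))" for s
  have Fcont: "continuous_on {a..b} F"
    unfolding F_def using continuous_on_speed_square[OF sc thI] by (intro continuous_intros)
  then have "bounded (F ` {a..b})"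
    by (intro compact_imp_bounded compact_continuous_image compact_Icc)
  then obtain B where "\<forall>y\<in>F ` {a..b}. norm y \<le> B" unfolding bounded_iff by blast
  then have B: "F s \<le> B" if "s \<in> {a..b}" for s using that by (auto dest: abs_le_D1)
  have "eventually (\<lambda>s. \<gamma> s \<in> fst c \<and> norm (\<xi> s - x) < r / 2 \<and> norm (v s - v b) < min e 1 \<and>
      metric_coords c (\<xi> s) (v s) w < - \<kappa> \<and> metric_coords c (\<xi> s) w w < - \<kappa>) (at b within {a..b})"
    using eventually_in_chart[OF sc thI c bI qb]
      tendstoD[OF lim\<xi>, of "r/2"] tendstoD[OF limv, of "min e 1"]
      order_tendstoD(2)[OF metric_coords_tendsto[OF c x lim\<xi> limv tendsto_const] \<kappa>(2)]
      order_tendstoD(2)[OF metric_coords_tendsto[OF c x lim\<xi> tendsto_const tendsto_const] \<kappa>(3)]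
      r e(1)
    by (auto simp: dist_norm eventually_conj_iff)
  then obtain d where d: "d > 0" "\<And>s. s \<in> {a..b} \<Longrightarrow> s \<noteq> b \<Longrightarrow> dist s b < d \<Longrightarrow>
      \<gamma> s \<in> fst c \<and> norm (\<xi> s - x) < r / 2 \<and> norm (v s - v b) < min e 1 \<and>
      metric_coords c (\<xi> s) (v s) w < - \<kappa> \<and> metric_coords c (\<xi> s) w w < - \<kappa>"
    unfolding eventually_at by blast
  have near: "\<gamma> s \<in> fst c \<and> norm (\<xi> s - x) < r / 2 \<and> norm (v s - v b) < min e 1 \<and>
      metric_coords c (\<xi> s) (v s) w < - \<kappa> \<and> metric_coords c (\<xi> s) w w < - \<kappa>"
    if "s \<in> {a..b}" "b - s < d" for s
    using d(2)[OF that(1)] that qb \<xi>b r e(1) \<kappa> by (cases "s = b") (auto simp: dist_real_def)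
  \<comment> \<open>All smallness conditions on the length of the blending interval.\<close>
  have "eventually (\<lambda>\<delta>. 1 * \<delta> < d \<and> 1 * \<delta> < b - a \<and> 2 * K * \<delta> < r / 2 \<and> 2 * K * \<delta> < \<rho> - \<epsilon> * norm w
      \<and> 2 * K * \<delta> < \<eta> \<and> B * \<delta> < \<eta> \<and> (L * (2 * K) * (K * K)) * \<delta> < \<kappa> \<and> 0 < \<delta>) (at_right 0)"
    using ab d(1) r(1) \<epsilon>(2) \<eta> \<kappa>(1)
    by (intro eventually_conj eventually_mult_less_at_right_0) (auto simp: eventually_at_filter)
  then obtain \<delta> where \<delta>: "\<delta> < d" "\<delta> < b - a" "2 * K * \<delta> < r / 2" "2 * K * \<delta> < \<rho> - \<epsilon> * norm w"
     "2 * K * \<delta> < \<eta>" "B * \<delta> < \<eta>" "L * (2 * K) * (K * K) * \<delta> < \<kappa>" "0 < \<delta>"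
    using eventually_happens[of _ "at_right (0::real)"] trivial_limit_at_right_real by fastforce
  define s0 where "s0 = b - \<delta>"
  have s0: "a < s0" "s0 < b" "b - s0 = \<delta>" using \<delta> by (auto simp: s0_def)
  have nr: "\<gamma> s \<in> fst c" "norm (\<xi> s - x) < r / 2" "norm (v s - v b) < e"
      "metric_coords c (\<xi> s) (v s) w < - \<kappa>" "metric_coords c (\<xi> s) w w < - \<kappa>" "norm (v s) \<le> K"
    if "s \<in> {s0..b}" for s
  proof -
    have *: "s \<in> {a..b}" "b - s < d" using that s0 \<delta>(1) by auto
    show "\<gamma> s \<in> fst c" "norm (\<xi> s - x) < r / 2" "norm (v s - v b) < e"
      "metric_coords c (\<xi> s) (v s) w < - \<kappa>" "metric_coords c (\<xi> s) w w < - \<kappa>"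
      using near[OF *] by auto
    show "norm (v s) \<le> K" using near[OF *] norm_triangle_ineq[of "v s - v b" "v b"] by (auto simp: K_def)
  qed
  have th0: "thick {s0..b}" using s0(2) by (rule thick_interval)
  have \<xi>sm: "smooth_on {s0..b} \<xi>"
  proof -
    have "smooth_curve A {s0..b} \<gamma>" by (rule smooth_curve_subset[OF sc _ th0]) (use s0 in auto)
    moreover have "{s0..b} \<inter> \<gamma> -` fst c = {s0..b}" using nr(1) by auto
    ultimately show ?thesis using c unfolding smooth_curve_def \<xi>_def by metis
  qed
  have \<xi>der: "(\<xi> has_vector_derivative v s) (at s within {s0..b})" if s: "s \<in> {s0..b}" for s
  proof -
    have "s \<in> {a..b}" using s s0 by auto
    then have "(\<xi> has_vector_derivative v s) (at s within {a..b})"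
      using chart_curve_has_vector_derivative[OF sc thI c _ nr(1)[OF s]] by (simp add: \<xi>_def v_def)
    then show ?thesis by (rule has_vector_derivative_within_subset) (use s0 in auto)
  qed
  have wK: "norm w \<le> K" by (simp add: K_def)
  have K0: "0 \<le> K" using wK norm_ge_zero order_trans by blast
  obtain \<zeta> and \<psi> :: "real \<Rightarrow> real" and s1 where s1: "s0 < s1" "s1 < b"
    and \<zeta>sm: "smooth_on {s0..b + \<epsilon>} \<zeta>"
    and \<psi>': "\<forall>s. 0 \<le> \<psi> s \<and> \<psi> s \<le> 1" "\<forall>s\<le>s1. \<psi> s = 0"
    and der1': "\<forall>s\<in>{s0..b}.
      (\<zeta> has_vector_derivative (1 - \<psi> s) *\<^sub>R v s + \<psi> s *\<^sub>R w) (at s within {s0..b + \<epsilon>})"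
    and der2': "\<forall>s\<in>{b..b + \<epsilon>}. (\<zeta> has_vector_derivative w) (at s within {s0..b + \<epsilon>})"
    and dev0: "\<forall>s\<in>{s0..b}. norm (\<zeta> s - \<xi> s) \<le> 2 * K * (b - s0) * \<psi> s"
    and line': "\<forall>s\<in>{b..b + \<epsilon>}. \<zeta> s = \<zeta> b + (s - b) *\<^sub>R w"
    by (rule blend_into_line[OF s0(2) \<epsilon>(1) \<xi>sm \<xi>der nr(6) wK]) (assumption | rule that)+
  note \<psi> = \<psi>'[rule_format] and der1 = der1'[rule_format] and der2 = der2'[rule_format]
    and dev = dev0[rule_format] and line = line'[rule_format]
  have dev': "norm (\<zeta> s - \<xi> s) \<le> 2 * K * \<delta> * \<psi> s" if "s \<in> {s0..b}" for s
    using dev[OF that] s0(3) by simp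
  have dev'': "norm (\<zeta> s - \<xi> s) \<le> 2 * K * \<delta>" if "s \<in> {s0..b}" for s
  proof -
    have "2 * K * \<delta> * \<psi> s \<le> 2 * K * \<delta> * 1" using K0 \<delta>(8) \<psi>(1)[of s] by (intro mult_left_mono) auto
    then show ?thesis using dev'[OF that] by simp
  qed
  have \<zeta>ball: "\<zeta> s \<in> ball x r" if s: "s \<in> {s0..b}" for s
  proof -
    have "norm (\<zeta> s - x) \<le> norm (\<zeta> s - \<xi> s) + norm (\<xi> s - x)"
      using norm_triangle_ineq[of "\<zeta> s - \<xi> s" "\<xi> s - x"] by simp
    then have "norm (\<zeta> s - x) < r" using dev''[OF s] nr(2)[OF s] \<delta>(3) by simp
    then show ?thesis by (simp add: dist_norm norm_minus_commute)
  qed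
  have \<zeta>ball2: "\<zeta> s \<in> ball (snd c q) \<rho>" if s: "s \<in> {b..b + \<epsilon>}" for s
  proof -
    have "\<zeta> s - x = (\<zeta> b - x) + (s - b) *\<^sub>R w" using line[OF s] by simp
    then have "norm (\<zeta> s - x) \<le> norm (\<zeta> b - x) + norm ((s - b) *\<^sub>R w)"
      by (simp only: norm_triangle_ineq)
    also have "norm ((s - b) *\<^sub>R w) \<le> \<epsilon> * norm w" using s by (simp add: mult_right_mono)
    also have "norm (\<zeta> b - x) \<le> 2 * K * \<delta>" using dev''[of b] s0 \<xi>b by simp
    finally have "norm (\<zeta> s - x) < \<rho>" using \<delta>(4) by linarith
    then show ?thesis by (simp add: dist_norm norm_minus_commute x_def)
  qed
  define D where "D s = (if s \<le> b then (1 - \<psi> s) *\<^sub>R v s + \<psi> s *\<^sub>R w else w)" for s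
  define J where "J = {s0..b + \<epsilon>}"
  have thJ: "thick J" unfolding J_def using s0 \<epsilon> by (intro thick_interval) auto
  have \<zeta>der: "(\<zeta> has_vector_derivative D s) (at s within J)" if "s \<in> J" for s
    using der1[of s] der2[of s] that by (cases "s \<le> b") (auto simp: D_def J_def)
  have \<zeta>dom: "\<zeta> ` J \<subseteq> snd c ` fst c"
  proof
    fix y assume "y \<in> \<zeta> ` J"
    then obtain s where s: "s \<in> J" "y = \<zeta> s" by blast
    show "y \<in> snd c ` fst c"
    proof (cases "s \<le> b")
      case True
      then show ?thesis using \<zeta>ball[of s] s rdom by (auto simp: J_def)
    next
      case False
      then show ?thesis using ball[OF \<zeta>ball2[of s]] s by (auto simp: J_def)
    qed
  qed
  have \<zeta>causal: "future_causal_vec c (\<zeta> s) (D s)" if s: "s \<in> J" for s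
  proof (cases "s \<le> b")
    case False
    then have "\<zeta> s \<in> ball (snd c q) \<rho>" using \<zeta>ball2[of s] s by (auto simp: J_def)
    then show ?thesis using ball[of "\<zeta> s"] future_timelike_imp_causal False by (simp add: D_def)
  next
    case True
    then have sI: "s \<in> {s0..b}" using s by (auto simp: J_def)
    let ?p = "\<psi> s" and ?V = "(1 - \<psi> s) *\<^sub>R v s + \<psi> s *\<^sub>R w"
    have p: "0 \<le> ?p" "?p \<le> 1" using \<psi>(1) by auto
    have \<zeta>s: "\<zeta> s \<in> cball x r" "norm (\<zeta> s - x) < e"
      using \<zeta>ball[OF sI] r(3) by (auto simp: dist_norm norm_minus_commute)
    have \<xi>s: "\<xi> s \<in> cball x r" using nr(2)[OF sI] r(1) by (simp add: dist_norm norm_minus_commute)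
    have \<xi>dom: "\<xi> s \<in> snd c ` fst c" using \<xi>s rdom by blast
    have \<zeta>sdom: "\<zeta> s \<in> snd c ` fst c" using \<zeta>s(1) rdom by blast
    have "s \<in> {a..b}" using sI s0 by auto
    then have vv: "metric_coords c (\<xi> s) (v s) (v s) \<le> 0"
      using future_causal_curveD[OF c fc thI _ nr(1)[OF sI]] by (simp add: future_causal_vec_def v_def \<xi>_def)
    have "metric_coords c (\<xi> s) ?V ?V
        = (1 - ?p)\<^sup>2 * metric_coords c (\<xi> s) (v s) (v s) + 2 * ((1 - ?p) * ?p) * metric_coords c (\<xi> s) (v s) w
          + ?p\<^sup>2 * metric_coords c (\<xi> s) w w"
      by (rule lorentz_form_combination[OF metric_coords_lorentz[OF c \<xi>dom]])
    also have "\<dots> \<le> (1 - ?p)\<^sup>2 * 0 + 2 * ((1 - ?p) * ?p) * (- \<kappa>) + ?p\<^sup>2 * (- \<kappa>)"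
      using vv nr(4,5)[OF sI] p by (intro add_mono mult_left_mono) auto
    also have "\<dots> = - \<kappa> * ?p - \<kappa> * (?p * (1 - ?p))" by (simp add: algebra_simps power2_eq_square)
    also have "\<dots> \<le> - \<kappa> * ?p" using p \<kappa>(1) by simp
    finally have VV: "metric_coords c (\<xi> s) ?V ?V \<le> - \<kappa> * ?p" .
    have "norm ?V \<le> (1 - ?p) * norm (v s) + ?p * norm w"
      using norm_triangle_ineq[of "(1 - ?p) *\<^sub>R v s" "?p *\<^sub>R w"] p by simp
    also have "\<dots> \<le> (1 - ?p) * K + ?p * K" using p nr(6)[OF sI] wK by (intro add_mono mult_left_mono) auto
    finally have VK: "norm ?V \<le> K" by (simp add: algebra_simps)
    have "metric_coords c (\<zeta> s) ?V ?V - metric_coords c (\<xi> s) ?V ?V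
        \<le> L * norm (\<zeta> s - \<xi> s) * (norm ?V * norm ?V)"
      using L(2)[OF \<zeta>s(1) \<xi>s, of ?V ?V] by linarith
    also have "\<dots> \<le> L * (2 * K * \<delta> * ?p) * (K * K)"
      using dev'[OF sI] VK L(1) K0 \<delta>(8) p by (intro mult_mono mult_nonneg_nonneg) auto
    also have "\<dots> = (L * (2 * K) * (K * K) * \<delta>) * ?p" by (simp add: mult_ac)
    also have "\<dots> \<le> \<kappa> * ?p" using \<delta>(7) p by (intro mult_right_mono) auto
    finally have 1: "metric_coords c (\<zeta> s) ?V ?V \<le> 0" using VV by simp
    have o1: "metric_coords c (\<zeta> s) (v s) (orient_coords c (\<zeta> s)) < 0"
      using e(2)[OF \<zeta>s(2) nr(3)[OF sI]] .
    have "\<zeta> s \<in> ball (snd c q) \<rho>" using \<zeta>s(1) r(2) by (simp add: x_def)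
    then have o2: "metric_coords c (\<zeta> s) w (orient_coords c (\<zeta> s)) < 0"
      using ball[of "\<zeta> s"] by (simp add: future_timelike_vec_def)
    have b: "bilinear (metric_coords c (\<zeta> s))"
      using metric_coords_lorentz[OF c \<zeta>sdom] lorentz_formD(1) by blast
    have "metric_coords c (\<zeta> s) ?V (orient_coords c (\<zeta> s)) =
       (1 - ?p) * metric_coords c (\<zeta> s) (v s) (orient_coords c (\<zeta> s))
       + ?p * metric_coords c (\<zeta> s) w (orient_coords c (\<zeta> s))"
      by (simp add: bilinear_ladd[OF b] bilinear_lmul[OF b])
    also have "\<dots> < 0"
    proof (cases "?p = 0")
      case False
      show ?thesis
        by (rule add_nonpos_neg[OF mult_nonneg_nonpos mult_pos_neg]) (use o1 o2 p False in auto)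
    qed (use o1 in simp)
    finally show ?thesis using 1 True by (simp add: future_causal_vec_def D_def)
  qed
  have fc2: "future_causal_curve A g \<theta> J (chart_inv c \<circ> \<zeta>)"
    using coordinate_curve_future_causal[OF c thJ _ \<zeta>dom \<zeta>der \<zeta>causal] \<zeta>sm by (simp add: J_def)
  \<comment> \<open>On \<open>(s0, s1)\<close> both branches agree, which makes \<open>\<beta>\<close> smooth at \<open>s0\<close>.\<close>
  define \<beta> where "\<beta> s = (if s \<le> s0 then \<gamma> s else (chart_inv c \<circ> \<zeta>) s)" for s
  have \<beta>1: "\<beta> s = \<gamma> s" if "s < s1" for s
  proof (cases "s \<le> s0")
    case False
    then have sI: "s \<in> {s0..b}" using that s1 by auto
    have "\<zeta> s = \<xi> s" using dev[OF sI] \<psi>(2)[of s] that by simp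
    then show ?thesis using False nr(1)[OF sI] chart_inv_chart[OF c] by (simp add: \<beta>_def \<xi>_def)
  qed (simp add: \<beta>_def)
  have \<beta>2: "\<beta> s = (chart_inv c \<circ> \<zeta>) s" if "s0 < s" for s using that by (simp add: \<beta>_def)
  let ?I' = "{a..b + \<epsilon>}"
  have loc1: "?I' \<inter> {..<s1} = {a..b} \<inter> {..<s1}" using s1 \<epsilon> by auto
  have loc2: "?I' \<inter> {s0<..} = J \<inter> {s0<..}" using s0 by (auto simp: J_def)
  have fc\<beta>: "future_causal_curve A g \<theta> ?I' \<beta>"
  proof (rule future_causal_curve_local)
    fix s assume "s \<in> ?I'"
    show "\<exists>N J \<delta>. open N \<and> s \<in> N \<and> ?I' \<inter> N = J \<inter> N \<and> thick J \<and>
       future_causal_curve A g \<theta> J \<delta> \<and> (\<forall>r\<in>N. \<beta> r = \<delta> r)"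
    proof (cases "s < s1")
      case True
      then show ?thesis using loc1 thI fc \<beta>1 by (intro exI[of _ "{..<s1}"] exI[of _ "{a..b}"] exI[of _ \<gamma>]) auto
    next
      case False
      then have "s0 < s" using s1 by simp
      then show ?thesis using loc2 thJ fc2 \<beta>2
        by (intro exI[of _ "{s0<..}"] exI[of _ J] exI[of _ "chart_inv c \<circ> \<zeta>"]) auto
    qed
  qed
  have th': "thick ?I'" using ab \<epsilon> by (intro thick_interval) auto
  define F' where "F' s = sqrt (- g (\<beta> s) (velocity A ?I' \<beta> s) (velocity A ?I' \<beta> s))" for s
  have sc\<beta>: "smooth_curve A ?I' \<beta>" using fc\<beta> by (simp add: future_causal_curve_def)
  have F'cont: "continuous_on ?I' F'"
    unfolding F'_def using continuous_on_speed_square[OF sc\<beta> th'] by (intro continuous_intros)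
  have F'int: "F' integrable_on {y..z}" if "a \<le> y" "z \<le> b + \<epsilon>" for y z
    by (rule integrable_continuous_interval, rule continuous_on_subset[OF F'cont]) (use that in auto)
  have F'nn: "0 \<le> F' s" if "s \<in> ?I'" for s
    using fc\<beta> that by (auto simp: F'_def future_causal_curve_def causal_def)
  have F'1: "F' s = F s" if "s \<in> {a..s0}" for s
  proof -
    have "s < s1" using that s1 by simp
    then show ?thesis
      using velocity_local[of "{..<s1}" s ?I' "{a..b}" \<beta> \<gamma>] loc1 \<beta>1 by (simp add: F'_def F_def)
  qed
  have F'2: "m \<le> F' s" if s: "s \<in> {b..b + \<epsilon>}" for s
  proof -
    have s': "s0 < s" "s \<in> J" using s s0 by (auto simp: J_def)
    have \<zeta>s: "\<zeta> s \<in> snd c ` fst c" using \<zeta>dom s' by blast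
    have \<beta>s: "\<beta> s \<in> fst c" "snd c (\<beta> s) = \<zeta> s"
      using \<beta>2[OF s'(1)] chart_inv_in[OF c \<zeta>s] chart_chart_inv[OF c \<zeta>s] by auto
    have "velocity A ?I' \<beta> s = velocity A J (chart_inv c \<circ> \<zeta>) s"
      by (rule velocity_local[of "{s0<..}"]) (use s' loc2 \<beta>2 in auto)
    moreover have "velocity A J (chart_inv c \<circ> \<zeta>) s c = w"
      by (rule velocity_chart_inv[OF c thJ s'(2) _ \<zeta>dom]) (use der2[OF s] in \<open>simp add: J_def\<close>)
    ultimately have "g (\<beta> s) (velocity A ?I' \<beta> s) (velocity A ?I' \<beta> s) = metric_coords c (\<zeta> s) w w"
      using metric_velocity[OF c sc\<beta> th' _ \<beta>s(1)] s ab \<beta>s(2) by simp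
    moreover have "m\<^sup>2 \<le> - metric_coords c (\<zeta> s) w w" using ball[OF \<zeta>ball2[OF s]] by simp
    ultimately show ?thesis unfolding F'_def using m real_le_rsqrt by simp
  qed
  have "lorentzian_length A g ?I' \<beta> = integral {a..b + \<epsilon>} F'"
    by (simp add: lorentzian_length_def F'_def[abs_def])
  also have "\<dots> = integral {a..s0} F' + (integral {s0..b} F' + integral {b..b + \<epsilon>} F')"
    using Henstock_Kurzweil_Integration.integral_combine[of a s0 "b + \<epsilon>" F']
      Henstock_Kurzweil_Integration.integral_combine[of s0 b "b + \<epsilon>" F'] F'int s0 \<epsilon>(1) by simp
  finally have len': "lorentzian_length A g ?I' \<beta>
    = integral {a..s0} F' + (integral {s0..b} F' + integral {b..b + \<epsilon>} F')" .
  have i1: "integral {a..s0} F' = integral {a..s0} F" by (rule integral_cong) (use F'1 in auto)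
  have i2: "0 \<le> integral {s0..b} F'"
    by (rule integral_nonneg) (use F'int F'nn s0 \<epsilon> in auto)
  have "integral {b..b + \<epsilon>} (\<lambda>_. m) \<le> integral {b..b + \<epsilon>} F'"
    by (rule integral_le) (use F'int F'2 ab in auto)
  then have i3: "\<epsilon> * m \<le> integral {b..b + \<epsilon>} F'" using \<epsilon>(1) by simp
  have Fint: "F integrable_on {y..z}" if "a \<le> y" "z \<le> b" for y z
    by (rule integrable_continuous_interval, rule continuous_on_subset[OF Fcont]) (use that in auto)
  have "lorentzian_length A g {a..b} \<gamma> = integral {a..s0} F + integral {s0..b} F"
    using Henstock_Kurzweil_Integration.integral_combine[of a s0 b F] Fint s0
    by (simp add: lorentzian_length_def F_def[abs_def])
  moreover have "integral {s0..b} F \<le> integral {s0..b} (\<lambda>_. B)"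
    by (rule integral_le) (use Fint B s0 in auto)
  then have "integral {s0..b} F \<le> B * \<delta>" using s0 by (simp add: mult.commute)
  ultimately have len: "lorentzian_length A g {a..b} \<gamma> + \<epsilon> * m - \<eta> \<le> lorentzian_length A g ?I' \<beta>"
    using len' i1 i2 i3 \<delta>(6) by linarith
  have end\<zeta>: "\<zeta> (b + \<epsilon>) = \<zeta> b + \<epsilon> *\<^sub>R w" using line[of "b + \<epsilon>"] \<epsilon>(1) by simp
  have "norm (\<zeta> (b + \<epsilon>) - (snd c q + \<epsilon> *\<^sub>R w)) = norm (\<zeta> b - \<xi> b)"
    by (simp add: end\<zeta> \<xi>b x_def)
  also have "\<dots> < \<eta>" using dev''[of b] s0 \<delta>(5) by simp
  finally have ne: "norm (\<zeta> (b + \<epsilon>) - (snd c q + \<epsilon> *\<^sub>R w)) < \<eta>" .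
  have "future_causal_from_to A g \<theta> a (b + \<epsilon>) \<beta> p (chart_inv c (\<zeta> (b + \<epsilon>)))"
    using fc\<beta> ab \<epsilon> \<beta>1[of a] \<beta>2[of "b + \<epsilon>"] s0 s1 \<gamma>ab by (simp add: future_causal_from_to_def)
  moreover have "\<zeta> (b + \<epsilon>) \<in> snd c ` fst c" using \<zeta>dom s0 \<epsilon> by (auto simp: J_def)
  ultimately show thesis using that ne len by blast
qed

end

section \<open>The differential of cosmological time\<close>

text \<open>
  The setting of the remaining argument: a spacetime whose cosmological time is finite, positive and
  smooth.
\<close>

locale cosmological_spacetime = spacetime A g \<theta>
  for A :: "('a::{t2_space, second_countable_topology}, 'e::euclidean_space) chart set"
    and g :: "('a, 'e) metric_tensor"
    and \<theta> :: "'a \<Rightarrow> ('a, 'e) tangent" +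
  fixes \<tau> :: "'a \<Rightarrow> real"
  assumes tau: "cosmological_time A g \<theta> p = ennreal (\<tau> p)"
    and tau_pos: "0 < \<tau> p"
    and tau_smooth: "smooth_fun A \<tau>"
begin

lemma length_le_tau:
  assumes "future_causal_from_to A g \<theta> a b \<gamma> p q" "p \<noteq> q"
  shows "lorentzian_length A g {a..b} \<gamma> \<le> \<tau> q"
proof -
  have le: "causal_le A g \<theta> p q" using assms by (auto simp: causal_le_def)
  have "ennreal (lorentzian_length A g {a..b} \<gamma>) \<le> lorentzian_dist A g \<theta> p q"
    using assms le unfolding lorentzian_dist_def by (auto intro!: Sup_upper)
  also have "\<dots> \<le> cosmological_time A g \<theta> q"
    unfolding cosmological_time_def using le by (intro SUP_upper) simp
  finally show ?thesis using tau[of q] tau_pos[of q] by (simp add: ennreal_le_iff)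
qed

lemma almost_maximal_curve:
  assumes "0 < \<eta>"
  obtains a b \<gamma> p where "future_causal_from_to A g \<theta> a b \<gamma> p q" "p \<noteq> q"
    "\<tau> q - \<eta> < lorentzian_length A g {a..b} \<gamma>"
proof -
  have "ennreal (\<tau> q - \<eta>) < cosmological_time A g \<theta> q"
    unfolding tau using tau_pos[of q] assms by (intro ennreal_lessI) auto
  then obtain p where p: "ennreal (\<tau> q - \<eta>) < lorentzian_dist A g \<theta> p q"
    unfolding cosmological_time_def less_SUP_iff by blast
  then have ne: "\<not> (p = q \<or> \<not> causal_le A g \<theta> p q)"
    by (auto simp: lorentzian_dist_def split: if_splits)
  then obtain a b \<gamma> where \<gamma>: "future_causal_from_to A g \<theta> a b \<gamma> p q"
    "ennreal (\<tau> q - \<eta>) < ennreal (lorentzian_length A g {a..b} \<gamma>)"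
    using p unfolding lorentzian_dist_def if_not_P[OF ne] less_Sup_iff by blast
  have "\<tau> q - \<eta> < lorentzian_length A g {a..b} \<gamma>"
    using \<gamma>(2) ennreal_leI[of "lorentzian_length A g {a..b} \<gamma>" "\<tau> q - \<eta>"] by (meson not_less)
  then show thesis using that \<gamma>(1) ne by blast
qed

definition dtau :: "('a, 'e) chart \<Rightarrow> 'e \<Rightarrow> 'e \<Rightarrow> real" where
  "dtau c x = frechet_derivative (\<tau> \<circ> chart_inv c) (at x)"

context
  fixes c :: "('a, 'e) chart"
  assumes c: "c \<in> A"
begin

lemma tau_coords_C1: "Ck_on 1 (snd c ` fst c) (\<tau> \<circ> chart_inv c)"
  using tau_smooth c unfolding smooth_fun_def smooth_on_def by blast

lemma tau_coords_has_derivative: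
  assumes "x \<in> snd c ` fst c"
  shows "(\<tau> \<circ> chart_inv c has_derivative dtau c x) (at x)"
proof -
  have "(\<tau> \<circ> chart_inv c) differentiable_on (snd c ` fst c)" using tau_coords_C1 by simp
  then have "(\<tau> \<circ> chart_inv c) differentiable (at x)"
    using differentiable_on_eq_differentiable_at[OF open_chart_image[OF c]] assms by blast
  then show ?thesis unfolding dtau_def frechet_derivative_works .
qed

lemma linear_dtau: "x \<in> snd c ` fst c \<Longrightarrow> linear (dtau c x)"
  using tau_coords_has_derivative has_derivative_linear by blast

lemma dtau_tendsto:
  assumes x: "x \<in> snd c ` fst c" and "(X \<longlongrightarrow> x) F" "(W \<longlongrightarrow> w) F"
  shows "((\<lambda>t. dtau c (X t) (W t)) \<longlongrightarrow> dtau c x w) F"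
proof -
  have op: "open (snd c ` fst c)" using c open_chart_image by blast
  have ev: "eventually (\<lambda>t. X t \<in> snd c ` fst c) F" using topological_tendstoD[OF assms(2) op x] .
  have ex: "dtau c y u = (\<Sum>i\<in>Basis. (u \<bullet> i) * dtau c y i)" if "y \<in> snd c ` fst c" for y u
  proof -
    have "dtau c y u = dtau c y (\<Sum>i\<in>Basis. (u \<bullet> i) *\<^sub>R i)" by (simp add: euclidean_representation)
    then show ?thesis using linear_dtau[OF that] by (simp add: linear_sum linear_scale)
  qed
  have D: "((\<lambda>t. dtau c (X t) i) \<longlongrightarrow> dtau c x i) F" for i
  proof -
    have "continuous_on (snd c ` fst c) (\<lambda>x. dtau c x i)"
      by (rule continuous_on_eq[of _ "\<lambda>x. frechet_derivative (\<tau> \<circ> chart_inv c) (at x within snd c ` fst c) i"])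
        (use tau_coords_C1 in \<open>auto simp: dtau_def at_within_open[OF _ op]\<close>)
    then show ?thesis using continuous_on_tendsto_compose[OF _ assms(2) x] ev by simp
  qed
  have "((\<lambda>t. \<Sum>i\<in>Basis. (W t \<bullet> i) * dtau c (X t) i) \<longlongrightarrow> (\<Sum>i\<in>Basis. (w \<bullet> i) * dtau c x i)) F"
    by (intro tendsto_intros assms D)
  then have "((\<lambda>t. \<Sum>i\<in>Basis. (W t \<bullet> i) * dtau c (X t) i) \<longlongrightarrow> dtau c x w) F"
    by (simp only: ex[OF x, of w])
  then show ?thesis
    by (rule Lim_transform_eventually) (use ev in eventually_elim, rule ex[symmetric])
qed

lemma tau_along_line:
  assumes "x \<in> snd c ` fst c"
  shows "((\<lambda>r. \<tau> (chart_inv c (x + r *\<^sub>R w))) has_real_derivative dtau c x w) (at 0)"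
proof -
  have "((\<lambda>r. x + r *\<^sub>R w) has_derivative (\<lambda>r. r *\<^sub>R w)) (at 0)"
    by (auto intro!: derivative_eq_intros)
  then have "((\<tau> \<circ> chart_inv c) \<circ> (\<lambda>r. x + r *\<^sub>R w) has_derivative (dtau c x \<circ> (\<lambda>r. r *\<^sub>R w))) (at 0)"
    using tau_coords_has_derivative[OF assms] by (intro diff_chain_at) auto
  moreover have "(dtau c x \<circ> (\<lambda>r. r *\<^sub>R w)) = (*) (dtau c x w)"
    using linear_dtau[OF assms] by (auto simp: linear_scale fun_eq_iff)
  ultimately show ?thesis by (simp add: has_field_derivative_def comp_def)
qed

text \<open>
  An almost maximal curve ending at the start of the segment, prolonged by the segment, is a
  competitor for the cosmological time at the end of the segment. The prolonged curve only ends near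
  that point, which suffices by continuity of \<open>\<tau>\<close>. Since curves from a point to itself do not
  contribute to the Lorentzian distance, the segment is shortened a little if necessary so that the
  prolonged curve does not close up.
\<close>

lemma tau_timelike_segment:
  assumes x: "x \<in> snd c ` fst c"
    and ball: "\<And>y. y \<in> ball x \<rho> \<Longrightarrow> y \<in> snd c ` fst c \<and> future_timelike_vec c y w \<and>
       m\<^sup>2 \<le> - metric_coords c y w w"
    and m: "0 \<le> m" and \<epsilon>: "0 < \<epsilon>" "\<epsilon> * norm w < \<rho>"
  shows "\<tau> (chart_inv c x) + \<epsilon> * m \<le> \<tau> (chart_inv c (x + \<epsilon> *\<^sub>R w))"
proof (rule field_le_epsilon)
  fix \<eta>0 :: real assume "0 < \<eta>0"
  define \<eta> where "\<eta> = \<eta>0 / 5"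
  have \<eta>: "0 < \<eta>" using \<open>0 < \<eta>0\<close> by (simp add: \<eta>_def)
  define q where "q = chart_inv c x"
  have q: "q \<in> fst c" "snd c q = x" using chart_inv_in[OF c x] chart_chart_inv[OF c x] by (auto simp: q_def)
  obtain a b \<gamma> p where \<gamma>: "future_causal_from_to A g \<theta> a b \<gamma> p q"
    "\<tau> q - \<eta> < lorentzian_length A g {a..b} \<gamma>"
    using almost_maximal_curve[OF \<eta>] by metis
  have \<rho>: "0 < \<rho>" using \<epsilon> by (metis less_le_trans mult_nonneg_nonneg norm_ge_zero not_less order_less_imp_le)
  have w0: "w \<noteq> 0"
  proof
    assume "w = 0"
    have "future_timelike_vec c x w" using ball[of x] \<rho> by simp
    then show False
      using bilinear_lzero[OF lorentz_formD(1)[OF metric_coords_lorentz[OF c x]]] \<open>w = 0\<close>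
      by (simp add: future_timelike_vec_def)
  qed
  define f where "f y = \<tau> (chart_inv c y)" for y
  have fc: "isCont f y" if "y \<in> snd c ` fst c" for y
    using has_derivative_continuous[OF tau_coords_has_derivative[OF that]] by (simp add: f_def[abs_def] comp_def)
  have line: "x + r *\<^sub>R w \<in> snd c ` fst c" if "0 \<le> r" "r \<le> \<epsilon>" for r
  proof -
    have "norm (r *\<^sub>R w) \<le> \<epsilon> * norm w" using that by (simp add: mult_right_mono)
    then have "x + r *\<^sub>R w \<in> ball x \<rho>" using \<epsilon>(2) by (simp add: dist_norm)
    then show ?thesis using ball by blast
  qed
  let ?y = "x + \<epsilon> *\<^sub>R w"
  have "isCont (\<lambda>r. x + r *\<^sub>R w) \<epsilon>" by (intro continuous_intros)
  moreover have "isCont f ?y" using line[of \<epsilon>] \<epsilon>(1) by (intro fc) auto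
  ultimately have "isCont (\<lambda>r. f (x + r *\<^sub>R w)) \<epsilon>" by (rule isCont_o2)
  then obtain d where d: "d > 0" "\<And>r. dist r \<epsilon> < d \<Longrightarrow> dist (f (x + r *\<^sub>R w)) (f ?y) < \<eta>"
    unfolding continuous_at_eps_delta using \<eta> by blast
  define k where "k = min (min d \<epsilon>) (\<eta> / (m + 1)) / 2"
  have k: "0 < k" "k < d" "k < \<epsilon>" "k * (m + 1) < \<eta>"
  proof -
    show "0 < k" using d(1) \<epsilon>(1) \<eta> m by (simp add: k_def)
    then show "k < d" "k < \<epsilon>" using d(1) \<epsilon>(1) by (auto simp: k_def)
    have "k \<le> \<eta> / (m + 1) / 2" unfolding k_def by (rule divide_right_mono) auto
    also have "\<dots> < \<eta> / (m + 1)"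
    proof -
      have half: "h / 2 < h" if "0 < h" for h :: real using that by simp
      show ?thesis by (rule half) (use \<eta> m in simp)
    qed
    finally have "k < \<eta> / (m + 1)" .
    then show "k * (m + 1) < \<eta>" using m by (simp add: pos_less_divide_eq)
  qed
  have "x + (\<epsilon> - k) *\<^sub>R w \<noteq> x + (\<epsilon> - k / 2) *\<^sub>R w" using k(1) w0 by simp
  \<comment> \<open>At least one of the two slightly shorter segments avoids the starting point of the curve.\<close>
  then obtain r where r: "r = \<epsilon> - k \<or> r = \<epsilon> - k / 2" "x + r *\<^sub>R w \<noteq> snd c p" by metis
  have r': "0 < r" "r < \<epsilon>" "dist r \<epsilon> < d" "(\<epsilon> - r) * m \<le> \<eta>"
  proof -
    show "0 < r" "r < \<epsilon>" "dist r \<epsilon> < d" using r(1) k by (auto simp: dist_real_def)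
    have "(\<epsilon> - r) * m \<le> k * (m + 1)" using r(1) k(1) m by (intro mult_mono) auto
    then show "(\<epsilon> - r) * m \<le> \<eta>" using k(4) by simp
  qed
  let ?z = "x + r *\<^sub>R w"
  have zd: "?z \<in> snd c ` fst c" using line r' by simp
  obtain d2 where d2: "d2 > 0" "\<And>z. dist z ?z < d2 \<Longrightarrow> dist (f z) (f ?z) < \<eta>"
    using fc[OF zd] \<eta> unfolding continuous_at_eps_delta by blast
  define \<eta>' where "\<eta>' = Min {\<eta>, d2, norm (?z - snd c p)}"
  have \<eta>': "0 < \<eta>'" "\<eta>' \<le> \<eta>" "\<eta>' \<le> d2" "\<eta>' \<le> norm (?z - snd c p)"
    using \<eta> d2(1) r(2) by (auto simp: \<eta>'_def)
  have rw: "r * norm w < \<rho>"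
    using r'(2) \<epsilon>(2) mult_right_mono[of r \<epsilon> "norm w"] by simp
  obtain b' \<beta> z where z: "future_causal_from_to A g \<theta> a b' \<beta> p (chart_inv c z)"
    "z \<in> snd c ` fst c" "norm (z - (snd c q + r *\<^sub>R w)) < \<eta>'"
    "lorentzian_length A g {a..b} \<gamma> + r * m - \<eta>' \<le> lorentzian_length A g {a..b'} \<beta>"
    by (rule append_timelike_segment[OF c \<gamma>(1) q(1) _ m r'(1) rw \<eta>'(1)]) (use ball q(2) in \<open>auto simp: that\<close>)
  have "chart_inv c z \<noteq> p"
  proof
    assume "chart_inv c z = p"
    then have "z = snd c p" using chart_chart_inv[OF c z(2)] by simp
    then show False using z(3) \<eta>'(4) q(2) by (simp add: norm_minus_commute)
  qed
  then have "lorentzian_length A g {a..b'} \<beta> \<le> f z"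
    using length_le_tau[OF z(1)] by (simp add: f_def)
  then have "\<tau> q - \<eta> + r * m - \<eta>' \<le> f z" using z(4) \<gamma>(2) by simp
  also have "f z \<le> f ?z + \<eta>" using d2(2)[of z] z(3) \<eta>'(3) q(2) by (simp add: dist_norm abs_less_iff)
  also have "f ?z \<le> f ?y + \<eta>" using d(2)[OF r'(3)] by (simp add: dist_norm abs_less_iff)
  finally have "\<tau> q - \<eta> + r * m - \<eta>' \<le> f ?y + \<eta> + \<eta>" by simp
  moreover have "\<epsilon> * m \<le> r * m + \<eta>" using r'(4) by (simp add: algebra_simps)
  ultimately show "\<tau> (chart_inv c x) + \<epsilon> * m \<le> \<tau> (chart_inv c (x + \<epsilon> *\<^sub>R w)) + \<eta>0"
    using \<eta>'(2) unfolding f_def q_def[symmetric] \<eta>_def by linarith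
qed

text \<open>
  The infinitesimal form of the previous estimate; equivalently, the gradient of \<open>\<tau>\<close> has norm at
  least \<open>1\<close>.
\<close>

lemma dtau_timelike_ge:
  assumes x: "x \<in> snd c ` fst c" and w: "future_timelike_vec c x w"
  shows "sqrt (- metric_coords c x w w) \<le> dtau c x w"
proof (rule dense_le)
  fix m0 assume m0: "m0 < sqrt (- metric_coords c x w w)"
  have ww: "metric_coords c x w w < 0" using w by (simp add: future_timelike_vec_def)
  define m where "m = max m0 0"
  have m: "0 \<le> m" "m < sqrt (- metric_coords c x w w)" using m0 ww by (auto simp: m_def)
  then have "m\<^sup>2 < (sqrt (- metric_coords c x w w))\<^sup>2" by (intro power_strict_mono) auto
  then have m2: "m\<^sup>2 < - metric_coords c x w w" using ww by simp
  obtain e where e: "0 < e" "\<And>y u. norm (y - x) < e \<Longrightarrow> norm (u - w) < e \<Longrightarrow>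
    y \<in> snd c ` fst c \<and> future_timelike_vec c y u"
    using future_timelike_open[OF c x w] by blast
  have "eventually (\<lambda>y. metric_coords c y w w < - (m\<^sup>2)) (nhds x)"
    using order_tendstoD(2)[OF metric_coords_tendsto[OF c x filterlim_ident tendsto_const tendsto_const, of w w], of "- (m\<^sup>2)"] m2
    by simp
  then obtain d where d: "d > 0" "\<And>y. dist y x < d \<Longrightarrow> metric_coords c y w w < - (m\<^sup>2)"
    unfolding eventually_nhds_metric by blast
  define \<rho> where "\<rho> = min d e"
  have \<rho>: "0 < \<rho>" using d e by (simp add: \<rho>_def)
  have ball: "y \<in> snd c ` fst c \<and> future_timelike_vec c y w \<and> m\<^sup>2 \<le> - metric_coords c y w w"
    if "y \<in> ball x \<rho>" for y
    using that e(1) e(2)[of y w] d(2)[of y] by (auto simp: \<rho>_def dist_norm norm_minus_commute)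
  let ?f = "\<lambda>r. \<tau> (chart_inv c (x + r *\<^sub>R w))"
  have lim: "((\<lambda>h. (?f h - ?f 0) / h) \<longlongrightarrow> dtau c x w) (at_right 0)"
    using tau_along_line[OF x, of w] unfolding DERIV_def by (simp add: filterlim_at_split)
  have "eventually (\<lambda>h. norm w * h < \<rho> \<and> 0 < h) (at_right (0::real))"
    using \<rho> by (intro eventually_conj eventually_mult_less_at_right_0) (auto simp: eventually_at_filter)
  then have "eventually (\<lambda>h. m \<le> (?f h - ?f 0) / h) (at_right 0)"
  proof eventually_elim
    case (elim h)
    then have "?f 0 + h * m \<le> ?f h"
      using tau_timelike_segment[where \<rho> = \<rho> and \<epsilon> = h, OF x ball m(1)] by (simp add: mult.commute)
    then show ?case using elim by (simp add: pos_le_divide_eq mult.commute)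
  qed
  then have "m \<le> dtau c x w"
    by (rule tendsto_lowerbound[OF lim]) simp
  then show "m0 \<le> dtau c x w" by (simp add: m_def)
qed

text \<open>
  For a null vector \<open>w\<close> and a timelike vector \<open>T\<close>, the norm of \<open>w + s T\<close> grows like the square root
  of \<open>s\<close>. If \<open>d\<tau>(w)\<close> vanished, \<open>d\<tau>(w + s T)\<close> would be linear in \<open>s\<close> and could not dominate it for
  small \<open>s\<close>.
\<close>

lemma dtau_causal_pos:
  assumes x: "x \<in> snd c ` fst c" and w: "future_causal_vec c x w"
  shows "0 < dtau c x w"
proof (rule ccontr)
  assume "\<not> 0 < dtau c x w"
  then have n: "dtau c x w \<le> 0" by simp
  let ?G = "metric_coords c x" and ?T = "orient_coords c x"
  have lf: "lorentz_form ?G" using metric_coords_lorentz[OF c x] .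
  define a where "a = - ?G w ?T"
  have a: "0 < a" using w by (simp add: a_def future_causal_vec_def)
  \<comment> \<open>A value small enough that \<open>s * (dtau c x T)\<^sup>2 < 2 * a\<close>.\<close>
  define s where "s = a / ((dtau c x ?T)\<^sup>2 + 1)"
  have sp: "0 < s" using a by (simp add: s_def add_nonneg_pos)
  have TT: "?G ?T ?T < 0" using orient_coords_timelike[OF c x] .
  have "?G (1 *\<^sub>R w + s *\<^sub>R ?T) (1 *\<^sub>R w + s *\<^sub>R ?T) = 1\<^sup>2 * ?G w w + 2 * (1 * s) * ?G w ?T + s\<^sup>2 * ?G ?T ?T"
    by (rule lorentz_form_combination[OF lf])
  moreover have "s\<^sup>2 * ?G ?T ?T \<le> 0" using TT by (simp add: mult_nonneg_nonpos)
  moreover have "?G w w \<le> 0" using w by (simp add: future_causal_vec_def)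
  ultimately have le: "2 * (s * a) \<le> - ?G (w + s *\<^sub>R ?T) (w + s *\<^sub>R ?T)" by (simp add: a_def)
  have sa: "0 < s * a" using sp a by simp
  have "?G (w + s *\<^sub>R ?T) ?T = ?G w ?T + s * ?G ?T ?T"
    using lorentz_formD(1)[OF lf] by (simp add: bilinear_ladd bilinear_lmul)
  also have "\<dots> < 0" using a sp TT by (simp add: a_def add_neg_neg mult_pos_neg)
  finally have "future_timelike_vec c x (w + s *\<^sub>R ?T)"
    using le sa by (simp add: future_timelike_vec_def)
  then have "sqrt (- ?G (w + s *\<^sub>R ?T) (w + s *\<^sub>R ?T)) \<le> dtau c x (w + s *\<^sub>R ?T)"
    by (rule dtau_timelike_ge[OF x])
  also have "\<dots> = dtau c x w + s * dtau c x ?T"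
    using linear_dtau[OF x] by (simp add: linear_add linear_scale)
  also have "\<dots> \<le> s * dtau c x ?T" using n by simp
  finally have "(sqrt (- ?G (w + s *\<^sub>R ?T) (w + s *\<^sub>R ?T)))\<^sup>2 \<le> (s * dtau c x ?T)\<^sup>2"
    using le sa by (intro power_mono) auto
  then have "2 * (s * a) \<le> (s * dtau c x ?T)\<^sup>2" using le sa by simp
  then have "2 * a \<le> s * (dtau c x ?T)\<^sup>2" using sp by (simp add: power2_eq_square mult_ac)
  also have "\<dots> \<le> s * ((dtau c x ?T)\<^sup>2 + 1)" using sp by (intro mult_left_mono) auto
  also have "\<dots> = a"
  proof -
    have "(dtau c x ?T)\<^sup>2 + 1 \<noteq> 0" by (smt (verit) zero_le_power2)
    then show ?thesis by (simp add: s_def)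
  qed
  finally show False using a by simp
qed

lemma dtau_causal_ge:
  assumes x: "x \<in> snd c ` fst c" and w: "future_causal_vec c x w"
  shows "sqrt (- metric_coords c x w w) \<le> dtau c x w"
proof (cases "metric_coords c x w w < 0")
  case True
  then show ?thesis using w dtau_timelike_ge[OF x] by (simp add: future_causal_vec_def future_timelike_vec_def)
next
  case False
  then have "metric_coords c x w w = 0" using w by (simp add: future_causal_vec_def)
  then show ?thesis using dtau_causal_pos[OF x w] by simp
qed

lemma tau_curve_has_derivative:
  assumes "smooth_curve A I \<gamma>" "thick I" "s \<in> I" "\<gamma> s \<in> fst c"
  shows "((\<lambda>r. \<tau> (\<gamma> r)) has_vector_derivative dtau c (snd c (\<gamma> s)) (velocity A I \<gamma> s c)) (at s within I)"
proof -
  have x: "snd c (\<gamma> s) \<in> snd c ` fst c" using assms by blast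
  have "(\<tau> \<circ> chart_inv c has_derivative dtau c (snd c (\<gamma> s))) (at ((snd c \<circ> \<gamma>) s))"
    using tau_coords_has_derivative[OF x] unfolding comp_apply[of "snd c" \<gamma> s] .
  then have "((\<tau> \<circ> chart_inv c) \<circ> (snd c \<circ> \<gamma>) has_vector_derivative
      dtau c (snd c (\<gamma> s)) (velocity A I \<gamma> s c)) (at s within I)"
    by (rule vector_derivative_diff_chain_within[OF chart_curve_has_vector_derivative[OF assms(1,2) c assms(3,4)]
          has_derivative_at_withinI])
  then show ?thesis
    unfolding has_vector_derivative_def
  proof (rule has_derivative_transform_eventually)
    show "eventually (\<lambda>r. ((\<tau> \<circ> chart_inv c) \<circ> (snd c \<circ> \<gamma>)) r = \<tau> (\<gamma> r)) (at s within I)"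
      using eventually_in_chart[OF assms(1,2) c assms(3,4)]
      by eventually_elim (simp add: chart_inv_chart[OF c])
  qed (use assms chart_inv_chart[OF c] in auto)
qed

end

text \<open>
  Integration of a pointwise bound along the curve. The chart may depend on the point.
\<close>

lemma tau_increase_ge:
  assumes \<gamma>: "future_causal_from_to A g \<theta> a b \<gamma> p q"
    and K: "\<And>s. s \<in> {a..b} \<Longrightarrow> \<exists>c\<in>A. \<gamma> s \<in> fst c \<and>
      K * sqrt (- metric_coords c (snd c (\<gamma> s)) (velocity A {a..b} \<gamma> s c) (velocity A {a..b} \<gamma> s c))
        \<le> dtau c (snd c (\<gamma> s)) (velocity A {a..b} \<gamma> s c)"
  shows "K * lorentzian_length A g {a..b} \<gamma> \<le> \<tau> q - \<tau> p"
proof -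
  have ab: "a < b" and fc: "future_causal_curve A g \<theta> {a..b} \<gamma>" and \<gamma>ab: "\<gamma> a = p" "\<gamma> b = q"
    using \<gamma> by (auto simp: future_causal_from_to_def)
  have sc: "smooth_curve A {a..b} \<gamma>" using fc by (simp add: future_causal_curve_def)
  have th: "thick {a..b}" using ab by (rule thick_interval)
  obtain C where C: "\<And>s. s \<in> {a..b} \<Longrightarrow> C s \<in> A" "\<And>s. s \<in> {a..b} \<Longrightarrow> \<gamma> s \<in> fst (C s)"
    "\<And>s. s \<in> {a..b} \<Longrightarrow>
      K * sqrt (- metric_coords (C s) (snd (C s) (\<gamma> s)) (velocity A {a..b} \<gamma> s (C s)) (velocity A {a..b} \<gamma> s (C s)))
        \<le> dtau (C s) (snd (C s) (\<gamma> s)) (velocity A {a..b} \<gamma> s (C s))"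
    using K by metis
  define D where "D s = dtau (C s) (snd (C s) (\<gamma> s)) (velocity A {a..b} \<gamma> s (C s))" for s
  define F where "F s = sqrt (- g (\<gamma> s) (velocity A {a..b} \<gamma> s) (velocity A {a..b} \<gamma> s))" for s
  have "(D has_integral (\<tau> (\<gamma> b) - \<tau> (\<gamma> a))) {a..b}"
    by (rule fundamental_theorem_of_calculus)
      (use ab tau_curve_has_derivative[OF C(1) sc th _ C(2)] in \<open>auto simp: D_def\<close>)
  moreover have "F integrable_on {a..b}"
    unfolding F_def using continuous_on_speed_square[OF sc th]
    by (intro integrable_continuous_interval continuous_intros)
  then have "((\<lambda>s. K * F s) has_integral K * integral {a..b} F) {a..b}"
    by (intro has_integral_mult_right) (simp add: has_integral_integral)
  moreover have "K * F s \<le> D s" if s: "s \<in> {a..b}" for s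
    using C(3)[OF s] metric_velocity[OF C(1)[OF s] sc th s C(2)[OF s]] by (simp add: F_def D_def)
  ultimately have "K * integral {a..b} F \<le> \<tau> (\<gamma> b) - \<tau> (\<gamma> a)"
    using has_integral_le by blast
  then show ?thesis by (simp add: lorentzian_length_def F_def[abs_def] \<gamma>ab)
qed

lemma future_causal_subcurve:
  assumes "future_causal_from_to A g \<theta> a b \<gamma> p q" "a \<le> s" "s < t" "t \<le> b"
  shows "future_causal_from_to A g \<theta> s t \<gamma> (\<gamma> s) (\<gamma> t)"
    and "lorentzian_length A g {s..t} \<gamma>
      = integral {s..t} (\<lambda>r. sqrt (- g (\<gamma> r) (velocity A {a..b} \<gamma> r) (velocity A {a..b} \<gamma> r)))"
proof -
  have fc: "future_causal_curve A g \<theta> {a..b} \<gamma>" and ab: "a < b"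
    using assms by (auto simp: future_causal_from_to_def)
  have sub: "{s..t} \<subseteq> {a..b}" using assms by auto
  note * = future_causal_curve_subset[OF fc thick_interval[OF ab] sub thick_interval[OF assms(3)]]
  show "future_causal_from_to A g \<theta> s t \<gamma> (\<gamma> s) (\<gamma> t)"
    using *(1) assms(3) by (simp add: future_causal_from_to_def)
  show "lorentzian_length A g {s..t} \<gamma>
      = integral {s..t} (\<lambda>r. sqrt (- g (\<gamma> r) (velocity A {a..b} \<gamma> r) (velocity A {a..b} \<gamma> r)))"
    unfolding lorentzian_length_def by (rule integral_cong) (simp add: *(2))
qed

lemma lorentzian_length_split:
  assumes "future_causal_from_to A g \<theta> a b \<gamma> p q" "a < t" "t < b"
  shows "lorentzian_length A g {a..b} \<gamma> = lorentzian_length A g {a..t} \<gamma> + lorentzian_length A g {t..b} \<gamma>"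
proof -
  let ?F = "\<lambda>r. sqrt (- g (\<gamma> r) (velocity A {a..b} \<gamma> r) (velocity A {a..b} \<gamma> r))"
  have sc: "smooth_curve A {a..b} \<gamma>" and ab: "a < b"
    using assms by (auto simp: future_causal_from_to_def future_causal_curve_def)
  have "?F integrable_on {a..b}"
    using continuous_on_speed_square[OF sc thick_interval[OF ab]]
    by (intro integrable_continuous_interval continuous_intros)
  then have "integral {a..t} ?F + integral {t..b} ?F = integral {a..b} ?F"
    using assms by (intro Henstock_Kurzweil_Integration.integral_combine) auto
  then show ?thesis
    using future_causal_subcurve(2)[OF assms(1), of a t] future_causal_subcurve(2)[OF assms(1), of t b] assms
    by (simp add: lorentzian_length_def)
qed

lemma length_le_tau_increase:
  assumes \<gamma>: "future_causal_from_to A g \<theta> a b \<gamma> p q"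
  shows "lorentzian_length A g {a..b} \<gamma> \<le> \<tau> q - \<tau> p"
proof -
  have fc: "future_causal_curve A g \<theta> {a..b} \<gamma>" and th: "thick {a..b}"
    using \<gamma> thick_interval by (auto simp: future_causal_from_to_def)
  have "1 * lorentzian_length A g {a..b} \<gamma> \<le> \<tau> q - \<tau> p"
  proof (rule tau_increase_ge[OF \<gamma>])
    fix s assume s: "s \<in> {a..b}"
    obtain c where c: "c \<in> A" "\<gamma> s \<in> fst c" using chart_at_exists by blast
    have "future_causal_vec c (snd c (\<gamma> s)) (velocity A {a..b} \<gamma> s c)"
      using future_causal_curveD[OF c(1) fc th s c(2)] .
    then show "\<exists>c\<in>A. \<gamma> s \<in> fst c \<and> 1 * sqrt (- metric_coords c (snd c (\<gamma> s)) (velocity A {a..b} \<gamma> s c) (velocity A {a..b} \<gamma> s c))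
        \<le> dtau c (snd c (\<gamma> s)) (velocity A {a..b} \<gamma> s c)"
      using dtau_causal_ge[OF c(1)] c by (intro bexI[of _ c]) auto
  qed
  then show ?thesis by simp
qed

end

section \<open>Almost minimal directions\<close>

context smooth_manifold
begin

text \<open>
  The time \<open>t\<close> is the last one at which the curve is outside the open ball, or the initial time if
  the curve never leaves it.
\<close>

lemma curve_stays_in_chart_ball:
  fixes a b :: real
  assumes c: "c \<in> A" and x: "x \<in> snd c ` fst c" and \<rho>: "0 < \<rho>" "cball x \<rho> \<subseteq> snd c ` fst c"
    and \<gamma>: "a < b" "continuous_on {a..b} \<gamma>" "\<gamma> b = chart_inv c x"
  obtains t where "a \<le> t" "t < b" "\<And>s. s \<in> {t..b} \<Longrightarrow> \<gamma> s \<in> fst c \<and> snd c (\<gamma> s) \<in> cball x \<rho>"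
    "t = a \<or> norm (snd c (\<gamma> t) - x) = \<rho>"
proof -
  define V where "V = chart_inv c ` ball x \<rho>"
  define W where "W = chart_inv c ` cball x \<rho>"
  have inW: "p \<in> W \<longleftrightarrow> p \<in> fst c \<and> snd c p \<in> cball x \<rho>" for p
    unfolding W_def using \<rho>(2) chart_inv_chart[OF c] chart_chart_inv[OF c] chart_inv_in[OF c]
    by (auto simp del: mem_cball simp: image_iff) (metis subsetD)+
  have bsub: "ball x \<rho> \<subseteq> cball x \<rho>" by (rule ball_subset_cball)
  have V_eq: "V = fst c \<inter> snd c -` ball x \<rho>"
  proof (intro equalityI subsetI)
    fix p assume "p \<in> V"
    then obtain y where y: "y \<in> ball x \<rho>" "p = chart_inv c y" by (auto simp: V_def)
    have "y \<in> snd c ` fst c" using y(1) bsub \<rho>(2) by blast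
    then show "p \<in> fst c \<inter> snd c -` ball x \<rho>"
      using y chart_chart_inv[OF c] chart_inv_in[OF c] by auto
  next
    fix p assume p: "p \<in> fst c \<inter> snd c -` ball x \<rho>"
    then have "p = chart_inv c (snd c p)" using chart_inv_chart[OF c] by simp
    then show "p \<in> V" using p unfolding V_def by blast
  qed
  have opV: "open V"
    unfolding V_eq Int_commute[of "fst c"]
    using continuous_on_open_vimage[OF open_chart_domain[OF c]] continuous_on_chart[OF c] by blast
  have VW: "V \<subseteq> W" unfolding V_def W_def using bsub by blast
  have clW: "closed W"
    unfolding W_def
    by (intro compact_imp_closed compact_continuous_image compact_cball
        continuous_on_subset[OF continuous_on_chart_inv[OF c] \<rho>(2)])
  have bV: "\<gamma> b \<in> V" using \<gamma>(3) \<rho>(1) by (auto simp: V_def)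
  show thesis
  proof (cases "\<gamma> ` {a..b} \<subseteq> V")
    case True
    then have "\<gamma> s \<in> W" if "s \<in> {a..b}" for s using that VW by blast
    then show ?thesis by (intro that[of a]) (use \<gamma>(1) inW in auto)
  next
    case False
    define S where "S = {a..b} \<inter> \<gamma> -` (- V)"
    have "closed S"
      unfolding S_def using \<gamma>(2) opV by (intro continuous_closed_preimage) auto
    moreover have Sne: "S \<noteq> {}" using False by (auto simp: S_def)
    moreover have bdd: "bdd_above S" by (rule bdd_aboveI[of _ b]) (auto simp: S_def)
    ultimately have tS: "Sup S \<in> S" using closed_contains_Sup by blast
    define t where "t = Sup S"
    have t: "t \<in> {a..b}" "\<gamma> t \<notin> V" using tS by (auto simp: t_def S_def)
    have tb: "t < b" using t bV by (cases "t = b") auto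
    have after: "\<gamma> s \<in> V" if "s \<in> {t<..b}" for s
    proof (rule ccontr)
      assume "\<gamma> s \<notin> V"
      then have "s \<in> S" using that t by (auto simp: S_def)
      then have "s \<le> t" unfolding t_def using bdd by (rule cSup_upper)
      then show False using that by simp
    qed
    have "closed ({t..b} \<inter> \<gamma> -` W)"
      using t clW continuous_on_subset[OF \<gamma>(2)] by (intro continuous_closed_preimage) auto
    moreover have "{t<..b} \<subseteq> {t..b} \<inter> \<gamma> -` W" using after subsetD[OF VW] by auto
    ultimately have "closure {t<..b} \<subseteq> {t..b} \<inter> \<gamma> -` W" by (rule closure_minimal[rotated])
    then have sW: "\<gamma> s \<in> W" if "s \<in> {t..b}" for s
      using that closure_greaterThanAtMost[OF tb] by auto
    then have "\<gamma> t \<in> W" using tb by simp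
    then have "\<gamma> t \<in> fst c" "snd c (\<gamma> t) \<in> cball x \<rho>" using inW by auto
    moreover have "snd c (\<gamma> t) \<notin> ball x \<rho>" using t(2) \<open>\<gamma> t \<in> fst c\<close> by (auto simp: V_eq)
    ultimately have "norm (snd c (\<gamma> t) - x) = \<rho>" by (simp add: dist_norm norm_minus_commute)
    then show ?thesis by (intro that[of t]) (use t tb sW inW in auto)
  qed
qed

end

context cosmological_spacetime
begin

text \<open>
  A strict inequality between \<open>d\<tau>\<close> and a multiple of the norm on all future timelike vectors at one
  point persists nearby, together with a lower bound by the Euclidean norm. A sequence of
  counterexamples, normalised in the Euclidean norm, would accumulate at a unit future causal vector
  at \<open>x\<close>: the strict inequality excludes timelike limits and positivity of \<open>d\<tau>\<close> excludes null ones.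
\<close>

lemma dtau_locally_dominates:
  assumes c: "c \<in> A" and x: "x \<in> snd c ` fst c"
    and big: "\<And>u. future_timelike_vec c x u \<Longrightarrow> K * sqrt (- metric_coords c x u u) < dtau c x u"
  obtains \<rho> where "0 < \<rho>" "cball x \<rho> \<subseteq> snd c ` fst c"
    "\<And>y w. y \<in> cball x \<rho> \<Longrightarrow> future_causal_vec c y w \<Longrightarrow>
       K * sqrt (- metric_coords c y w w) \<le> dtau c y w \<and> \<rho> * norm w \<le> dtau c y w"
proof -
  obtain r where r: "0 < r" "cball x r \<subseteq> snd c ` fst c"
    using open_chart_image[OF c] x open_contains_cball by blast
  let ?P = "\<lambda>\<rho> y w. K * sqrt (- metric_coords c y w w) \<le> dtau c y w \<and> \<rho> * norm w \<le> dtau c y w"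
  have "\<exists>\<rho>>0. \<rho> \<le> r \<and> (\<forall>y\<in>cball x \<rho>. \<forall>w. future_causal_vec c y w \<longrightarrow> ?P \<rho> y w)"
  proof (rule ccontr)
    assume no: "\<not> ?thesis"
    define R where "R n = r / real (Suc n)" for n
    have R: "0 < R n" "R n \<le> r" for n using r(1) by (auto simp: R_def field_simps)
    have "\<exists>y w. y \<in> cball x (R n) \<and> future_causal_vec c y w \<and> \<not> ?P (R n) y w" for n
      using no R[of n] by blast
    then obtain Y W where YW: "\<And>n. Y n \<in> cball x (R n)" "\<And>n. future_causal_vec c (Y n) (W n)"
      "\<And>n. \<not> ?P (R n) (Y n) (W n)" by metis
    have Yd: "Y n \<in> snd c ` fst c" for n
      using YW(1)[of n] R(2)[of n] r(2) by (auto simp: subset_iff)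
    define U where "U n = (1 / norm (W n)) *\<^sub>R W n" for n
    have Wne: "W n \<noteq> 0" for n
      using YW(2)[of n] bilinear_lzero[OF lorentz_formD(1)[OF metric_coords_lorentz[OF c Yd]]]
      by (auto simp: future_causal_vec_def)
    have U1: "norm (U n) = 1" for n using Wne[of n] by (simp add: U_def)
    have Ufc: "metric_coords c (Y n) (U n) (U n) \<le> 0" "metric_coords c (Y n) (U n) (orient_coords c (Y n)) \<le> 0" for n
    proof -
      have b: "bilinear (metric_coords c (Y n))" using lorentz_formD(1)[OF metric_coords_lorentz[OF c Yd]] .
      show "metric_coords c (Y n) (U n) (U n) \<le> 0" "metric_coords c (Y n) (U n) (orient_coords c (Y n)) \<le> 0"
        using YW(2)[of n] Wne[of n]
        by (auto simp: U_def bilinear_lmul[OF b] bilinear_rmul[OF b] future_causal_vec_def divide_le_0_iff)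
    qed
    have Umax: "dtau c (Y n) (U n) \<le> max (K * sqrt (- metric_coords c (Y n) (U n) (U n))) (R n)" for n
    proof -
      let ?s = "1 / norm (W n)"
      have s: "0 < ?s" using Wne[of n] by simp
      have b: "bilinear (metric_coords c (Y n))" using lorentz_formD(1)[OF metric_coords_lorentz[OF c Yd]] .
      have d: "dtau c (Y n) (U n) = ?s * dtau c (Y n) (W n)"
        using linear_dtau[OF c Yd] by (simp add: U_def linear_scale)
      have "- metric_coords c (Y n) (U n) (U n) = ?s\<^sup>2 * (- metric_coords c (Y n) (W n) (W n))"
        by (simp add: U_def bilinear_lmul[OF b] bilinear_rmul[OF b] power2_eq_square)
      then have q: "sqrt (- metric_coords c (Y n) (U n) (U n)) = ?s * sqrt (- metric_coords c (Y n) (W n) (W n))"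
      proof -
        have sq: "sqrt (r\<^sup>2 * y) = r * sqrt y" if "0 < r" for r y :: real
          using that by (simp add: real_sqrt_mult)
        show ?thesis unfolding \<open>- metric_coords c (Y n) (U n) (U n) = _\<close> by (rule sq[OF s])
      qed
      consider "dtau c (Y n) (W n) < K * sqrt (- metric_coords c (Y n) (W n) (W n))"
        | "dtau c (Y n) (W n) < R n * norm (W n)" using YW(3)[of n] by linarith
      then show ?thesis
      proof cases
        case 1
        then have "?s * dtau c (Y n) (W n) \<le> ?s * (K * sqrt (- metric_coords c (Y n) (W n) (W n)))"
          using s by (intro mult_left_mono) auto
        then show ?thesis unfolding d q by (simp add: mult_ac max.coboundedI1)
      next
        case 2
        then have "?s * dtau c (Y n) (W n) \<le> ?s * (R n * norm (W n))"
          using s by (intro mult_left_mono) auto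
        also have "\<dots> = R n" using Wne[of n] by simp
        finally show ?thesis unfolding d by simp
      qed
    qed
    obtain u \<phi> where \<phi>: "strict_mono \<phi>" "(U \<circ> \<phi>) \<longlonglongrightarrow> u" and u: "u \<in> sphere 0 1"
      using compact_sphere[of 0 1] U1 unfolding compact_def by (metis mem_sphere_0)
    have limR: "R \<longlonglongrightarrow> 0"
      unfolding R_def using LIMSEQ_inverse_real_of_nat[THEN tendsto_mult_left, of r] by (simp add: divide_inverse)
    have limY: "Y \<longlonglongrightarrow> x"
    proof (rule tendsto_dist_iff[THEN iffD2], rule Lim_null_comparison[OF _ limR])
      show "\<forall>\<^sub>F n in sequentially. norm (dist (Y n) x) \<le> R n"
        using YW(1) by (simp add: dist_commute)
    qed
    have Yl: "(\<lambda>n. Y (\<phi> n)) \<longlonglongrightarrow> x" and Rl: "(\<lambda>n. R (\<phi> n)) \<longlonglongrightarrow> 0"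
      using LIMSEQ_subseq_LIMSEQ[OF limY \<phi>(1)] LIMSEQ_subseq_LIMSEQ[OF limR \<phi>(1)] by (auto simp: comp_def)
    have Ul: "(\<lambda>n. U (\<phi> n)) \<longlonglongrightarrow> u" using \<phi>(2) by (simp add: comp_def)
    have uu: "metric_coords c x u u \<le> 0"
      using LIMSEQ_le_const2[OF metric_coords_tendsto[OF c x Yl Ul Ul]] Ufc(1) by blast
    have uT: "metric_coords c x u (orient_coords c x) \<le> 0"
      using LIMSEQ_le_const2[OF metric_coords_tendsto[OF c x Yl Ul orient_coords_tendsto[OF c x Yl]]] Ufc(2) by blast
    have u0: "u \<noteq> 0" using u by auto
    have "metric_coords c x u (orient_coords c x) \<noteq> 0"
      using lorentz_orthogonal_pos[OF metric_coords_lorentz[OF c x] orient_coords_timelike[OF c x] u0] uu by force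
    then have ufc: "future_causal_vec c x u" using uu uT by (simp add: future_causal_vec_def)
    have lim1: "(\<lambda>n. dtau c (Y (\<phi> n)) (U (\<phi> n))) \<longlonglongrightarrow> dtau c x u"
      by (rule dtau_tendsto[OF c x Yl Ul])
    have lim2: "(\<lambda>n. max (K * sqrt (- metric_coords c (Y (\<phi> n)) (U (\<phi> n)) (U (\<phi> n)))) (R (\<phi> n)))
        \<longlonglongrightarrow> max (K * sqrt (- metric_coords c x u u)) 0"
      by (intro tendsto_max tendsto_mult tendsto_const tendsto_real_sqrt tendsto_minus
          metric_coords_tendsto[OF c x Yl Ul Ul] Rl)
    have le: "dtau c x u \<le> max (K * sqrt (- metric_coords c x u u)) 0"
      by (rule LIMSEQ_le[OF lim1 lim2]) (use Umax in blast)
    have pos: "0 < dtau c x u" by (rule dtau_causal_pos[OF c x ufc])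
    show False
    proof (cases "metric_coords c x u u < 0")
      case True
      then have "future_timelike_vec c x u" using ufc by (simp add: future_causal_vec_def future_timelike_vec_def)
      then show False using big[of u] le pos by linarith
    next
      case False
      then have "metric_coords c x u u = 0" using uu by simp
      then show False using le pos by simp
    qed
  qed
  then obtain \<rho> where \<rho>: "0 < \<rho>" "\<rho> \<le> r"
    "\<And>y w. y \<in> cball x \<rho> \<Longrightarrow> future_causal_vec c y w \<Longrightarrow> ?P \<rho> y w" by blast
  have "cball x \<rho> \<subseteq> snd c ` fst c"
    using r(2) \<rho>(2) subset_cball[of \<rho> r x] by blast
  then show thesis using that[of \<rho>] \<rho> by blast
qed

text \<open>
  In substance the gradient of \<open>\<tau>\<close> has norm at most \<open>1\<close>; the constant \<open>11/10\<close> leaves the room that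
  makes maximising geodesics unnecessary. If \<open>d\<tau>\<close> exceeded \<open>11/10\<close> times the norm at \<open>x\<close>, it would do
  so on a ball around \<open>x\<close>. The final part of a curve ending at \<open>x\<close>, from its last entrance into the
  ball, would then be shorter than its increase of \<open>\<tau>\<close> by a fixed proportion, and that increase is
  bounded below because the curve crosses the ball. If the curve never leaves the ball, the same
  holds with the whole curve, whose length is then at most \<open>10/11\<close> of the value of \<open>\<tau>\<close> at its end.
  Either way the length would stay below that value by a fixed amount, contrary to the definition of
  \<open>\<tau>\<close> as a supremum.
\<close>

lemma almost_minimal_direction:
  assumes c: "c \<in> A" and x: "x \<in> snd c ` fst c"
  obtains u where "future_timelike_vec c x u" "metric_coords c x u u = -1" "dtau c x u \<le> 11/10"
proof -
  let ?K = "11/10 :: real"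
  have "\<exists>u. future_timelike_vec c x u \<and> dtau c x u \<le> ?K * sqrt (- metric_coords c x u u)"
  proof (rule ccontr)
    assume "\<not> ?thesis"
    then have big: "\<And>u. future_timelike_vec c x u \<Longrightarrow> ?K * sqrt (- metric_coords c x u u) < dtau c x u"
      by (meson not_le)
    obtain \<rho> where \<rho>: "0 < \<rho>" "cball x \<rho> \<subseteq> snd c ` fst c"
      "\<And>y w. y \<in> cball x \<rho> \<Longrightarrow> future_causal_vec c y w \<Longrightarrow>
         ?K * sqrt (- metric_coords c y w w) \<le> dtau c y w \<and> \<rho> * norm w \<le> dtau c y w"
      using dtau_locally_dominates[OF c x big] by metis
    define q where "q = chart_inv c x"
    define \<eta> where "\<eta> = min (\<rho> * \<rho>) (\<tau> q) / 11"
    have \<eta>: "0 < \<eta>" using \<rho>(1) tau_pos[of q] by (simp add: \<eta>_def)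
    obtain a b \<gamma> p where \<gamma>: "future_causal_from_to A g \<theta> a b \<gamma> p q"
      "\<tau> q - \<eta> < lorentzian_length A g {a..b} \<gamma>"
      using almost_maximal_curve[OF \<eta>] by metis
    have ab: "a < b" and fc: "future_causal_curve A g \<theta> {a..b} \<gamma>" and \<gamma>ab: "\<gamma> a = p" "\<gamma> b = q"
      and cont: "continuous_on {a..b} \<gamma>"
      using \<gamma>(1) by (auto simp: future_causal_from_to_def future_causal_curve_def smooth_curve_def)
    obtain t where t: "a \<le> t" "t < b" "\<And>s. s \<in> {t..b} \<Longrightarrow> \<gamma> s \<in> fst c \<and> snd c (\<gamma> s) \<in> cball x \<rho>"
      "t = a \<or> norm (snd c (\<gamma> t) - x) = \<rho>"
      by (rule curve_stays_in_chart_ball[OF c x \<rho>(1,2) ab cont]) (use \<gamma>ab q_def that in auto)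
    have \<gamma>t: "future_causal_from_to A g \<theta> t b \<gamma> (\<gamma> t) q"
      using future_causal_subcurve(1)[OF \<gamma>(1) t(1,2)] \<gamma>ab by simp
    have fct: "future_causal_curve A g \<theta> {t..b} \<gamma>" using \<gamma>t by (simp add: future_causal_from_to_def)
    have tht: "thick {t..b}" by (rule thick_interval[OF t(2)])
    let ?v = "\<lambda>s. velocity A {t..b} \<gamma> s c"
    have vfc: "future_causal_vec c (snd c (\<gamma> s)) (?v s)" if "s \<in> {t..b}" for s
      using future_causal_curveD[OF c fct tht that] t(3)[OF that] by blast
    have L1: "?K * lorentzian_length A g {t..b} \<gamma> \<le> \<tau> q - \<tau> (\<gamma> t)"
    proof (rule tau_increase_ge[OF \<gamma>t])
      fix s assume s: "s \<in> {t..b}"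
      then show "\<exists>d\<in>A. \<gamma> s \<in> fst d \<and> ?K * sqrt (- metric_coords d (snd d (\<gamma> s))
          (velocity A {t..b} \<gamma> s d) (velocity A {t..b} \<gamma> s d)) \<le> dtau d (snd d (\<gamma> s)) (velocity A {t..b} \<gamma> s d)"
        using c t(3)[OF s] \<rho>(3)[OF _ vfc[OF s]] by (intro bexI[of _ c]) auto
    qed
    show False
    proof (cases "t = a")
      case True
      then have "?K * lorentzian_length A g {a..b} \<gamma> \<le> \<tau> q - \<tau> p" using L1 \<gamma>ab by simp
      moreover have "\<eta> \<le> \<tau> q / 11" by (simp add: \<eta>_def)
      ultimately show False using \<gamma>(2) tau_pos[of p] tau_pos[of q] by simp
    next
      case False
      then have at: "a < t" using t(1) by simp
      have far: "norm (snd c (\<gamma> t) - x) = \<rho>" using t(4) False by simp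
      have L2: "lorentzian_length A g {a..t} \<gamma> \<le> \<tau> (\<gamma> t) - \<tau> p"
        using length_le_tau_increase[OF future_causal_subcurve(1)[OF \<gamma>(1), of a t]] at t(2) \<gamma>ab by simp
      have xb: "snd c (\<gamma> b) = x" using \<gamma>ab q_def chart_chart_inv[OF c x] by simp
      \<comment> \<open>The component of the curve in the direction \<open>n\<close> has to cover the radius of the ball.\<close>
      define n where "n = (1 / \<rho>) *\<^sub>R (x - snd c (\<gamma> t))"
      have n1: "norm n = 1" using far \<rho>(1) by (simp add: n_def norm_minus_commute)
      have nd: "n \<bullet> (x - snd c (\<gamma> t)) = \<rho>"
      proof -
        have "n \<bullet> (x - snd c (\<gamma> t)) = (1 / \<rho>) * (norm (x - snd c (\<gamma> t)))\<^sup>2"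
          by (simp add: n_def power2_norm_eq_inner)
        then show ?thesis using far \<rho>(1) by (simp add: norm_minus_commute power2_eq_square)
      qed
      define h where "h s = \<tau> (\<gamma> s) - \<rho> * (n \<bullet> snd c (\<gamma> s))" for s
      define h' where "h' s = dtau c (snd c (\<gamma> s)) (?v s) - \<rho> * (n \<bullet> ?v s)" for s
      have sct: "smooth_curve A {t..b} \<gamma>" using fct by (simp add: future_causal_curve_def)
      have "(h' has_integral (h b - h t)) {t..b}"
      proof (rule fundamental_theorem_of_calculus)
        fix s assume s: "s \<in> {t..b}"
        have \<gamma>s: "\<gamma> s \<in> fst c" using t(3)[OF s] by blast
        have "(snd c \<circ> \<gamma> has_vector_derivative ?v s) (at s within {t..b})"
          by (rule chart_curve_has_vector_derivative[OF sct tht c s \<gamma>s])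
        then have "((\<lambda>s. \<rho> * (n \<bullet> snd c (\<gamma> s))) has_vector_derivative \<rho> * (n \<bullet> ?v s)) (at s within {t..b})"
          unfolding has_vector_derivative_def comp_def by (auto intro!: derivative_eq_intros)
        then show "(h has_vector_derivative h' s) (at s within {t..b})"
          unfolding h_def h'_def
          using tau_curve_has_derivative[OF c sct tht s \<gamma>s] by (intro has_vector_derivative_diff) auto
      qed (use t in simp)
      moreover have "0 \<le> h' s" if s: "s \<in> {t..b}" for s
      proof -
        have "n \<bullet> ?v s \<le> norm n * norm (?v s)" by (rule norm_cauchy_schwarz)
        then have "\<rho> * (n \<bullet> ?v s) \<le> \<rho> * norm (?v s)" using n1 \<rho>(1) by simp
        moreover have "\<rho> * norm (?v s) \<le> dtau c (snd c (\<gamma> s)) (?v s)"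
          using \<rho>(3)[OF _ vfc[OF s]] t(3)[OF s] by blast
        ultimately show ?thesis by (simp add: h'_def)
      qed
      ultimately have "0 \<le> h b - h t" using has_integral_nonneg by blast
      then have "\<rho> * \<rho> \<le> \<tau> q - \<tau> (\<gamma> t)"
        using nd by (simp add: h_def xb[unfolded \<gamma>ab] \<gamma>ab inner_diff_right algebra_simps)
      moreover have "\<eta> \<le> \<rho> * \<rho> / 11" by (simp add: \<eta>_def)
      moreover have "lorentzian_length A g {a..b} \<gamma>
          = lorentzian_length A g {a..t} \<gamma> + lorentzian_length A g {t..b} \<gamma>"
        by (rule lorentzian_length_split[OF \<gamma>(1) at t(2)])
      ultimately show False using L1 L2 \<gamma>(2) tau_pos[of p] by simp
    qed
  qed
  then obtain u where u: "future_timelike_vec c x u" "dtau c x u \<le> ?K * sqrt (- metric_coords c x u u)" by blast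
  let ?m = "- metric_coords c x u u"
  define s where "s = 1 / sqrt ?m"
  have m: "0 < ?m" using u(1) by (simp add: future_timelike_vec_def)
  have s: "0 < s" "s\<^sup>2 * ?m = 1" "s * sqrt ?m = 1" using m by (auto simp: s_def power_divide)
  have b: "bilinear (metric_coords c x)" using lorentz_formD(1)[OF metric_coords_lorentz[OF c x]] .
  have 1: "metric_coords c x (s *\<^sub>R u) (s *\<^sub>R u) = -1"
    using s(2) by (simp add: bilinear_lmul[OF b] bilinear_rmul[OF b] power2_eq_square mult.assoc)
  have 2: "metric_coords c x (s *\<^sub>R u) (orient_coords c x) < 0"
    using s(1) u(1) by (simp add: bilinear_lmul[OF b] future_timelike_vec_def mult_pos_neg)
  have "dtau c x (s *\<^sub>R u) = s * dtau c x u" using linear_dtau[OF c x] by (simp add: linear_scale)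
  also have "\<dots> \<le> s * (?K * sqrt ?m)" using s(1) u(2) by (intro mult_left_mono) auto
  also have "\<dots> = ?K" using s(3) by simp
  finally show thesis using that[of "s *\<^sub>R u"] 1 2 by (simp add: future_timelike_vec_def)
qed

end

section \<open>Null distance along level curves\<close>

text \<open>
  A pseudometric on an interval with metric speed at most \<open>F\<close> at each point. The radii of the local
  bounds form a gauge, so that a tagged division fine for this gauge and for the integral of \<open>F\<close>
  turns them into a Riemann sum.
\<close>

lemma metric_le_integral_of_local_bound:
  fixes d :: "real \<Rightarrow> real \<Rightarrow> real" and F :: "real \<Rightarrow> real"
  assumes ab: "a \<le> b" and F: "F integrable_on {a..b}"
    and sym: "\<And>s r. d s r = d r s" and tri: "\<And>s r q. d s q \<le> d s r + d r q" and refl: "\<And>s. d s s = 0"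
    and loc: "\<And>s \<eta>. s \<in> {a..b} \<Longrightarrow> 0 < \<eta> \<Longrightarrow>
      \<exists>e>0. \<forall>r\<in>{a..b}. \<bar>r - s\<bar> < e \<longrightarrow> d s r \<le> (F s + \<eta>) * \<bar>r - s\<bar>"
  shows "d a b \<le> integral {a..b} F"
proof (rule field_le_epsilon)
  fix \<eta>0 :: real assume \<eta>0: "0 < \<eta>0"
  define \<eta> where "\<eta> = \<eta>0 / (1 + (b - a))"
  have \<eta>: "0 < \<eta>" "\<eta> * (1 + (b - a)) = \<eta>0" using \<eta>0 ab by (auto simp: \<eta>_def)
  have "\<forall>s. \<exists>e>0. s \<in> {a..b} \<longrightarrow> (\<forall>r\<in>{a..b}. \<bar>r - s\<bar> < e \<longrightarrow> d s r \<le> (F s + \<eta>) * \<bar>r - s\<bar>)"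
  proof
    fix s show "\<exists>e>0. s \<in> {a..b} \<longrightarrow> (\<forall>r\<in>{a..b}. \<bar>r - s\<bar> < e \<longrightarrow> d s r \<le> (F s + \<eta>) * \<bar>r - s\<bar>)"
      by (cases "s \<in> {a..b}") (use loc[OF _ \<eta>(1), of s] in \<open>auto intro: exI[of _ 1]\<close>)
  qed
  then obtain e where e: "\<And>s. 0 < e s" "\<And>s r. s \<in> {a..b} \<Longrightarrow> r \<in> {a..b} \<Longrightarrow> \<bar>r - s\<bar> < e s \<Longrightarrow>
      d s r \<le> (F s + \<eta>) * \<bar>r - s\<bar>" by metis
  obtain G where G: "gauge G" "\<And>p. p tagged_division_of {a..b} \<Longrightarrow> G fine p \<Longrightarrow>
      norm ((\<Sum>(x,k)\<in>p. measure lborel k *\<^sub>R F x) - integral {a..b} F) < \<eta>"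
    using integrable_integral[OF F] \<eta>(1) unfolding has_integral_real by meson
  have "gauge (\<lambda>x. G x \<inter> ball x (e x))"
    using G(1) gauge_ball_dependent[of e] e(1) by (intro gauge_Int) auto
  then obtain p where p: "p tagged_division_of {a..b}" "(\<lambda>x. G x \<inter> ball x (e x)) fine p"
    using fine_division_exists_real by blast
  have fine: "G fine p" "(\<lambda>x. ball x (e x)) fine p" using p(2) by (auto simp: fine_Int)
  have step: "d a (Sup K) - d a (Inf K) \<le> measure lborel K * (F x + \<eta>)" if xK: "(x, K) \<in> p" for x K
  proof -
    have xin: "x \<in> K" and Ksub: "K \<subseteq> {a..b}" and "\<exists>u v. K = cbox u v"
      using tagged_division_ofD(2-4)[OF p(1) xK] by auto
    then obtain u v where K: "K = {u..v}" by auto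
    have uv: "u \<le> x" "x \<le> v" using xin K by auto
    have Kb: "K \<subseteq> ball x (e x)" using fine(2) xK unfolding fine_def by blast
    have "u \<in> K" "v \<in> K" using K uv by auto
    then have "u \<in> ball x (e x)" "v \<in> ball x (e x)" "u \<in> {a..b}" "v \<in> {a..b}" "x \<in> {a..b}"
      using Kb Ksub xin by blast+
    then have "d x u \<le> (F x + \<eta>) * \<bar>u - x\<bar>" "d x v \<le> (F x + \<eta>) * \<bar>v - x\<bar>"
      by (auto intro!: e(2) simp: dist_real_def abs_minus_commute)
    moreover have "d a v \<le> d a u + d u x + d x v" using tri[of a v u] tri[of u v x] by linarith
    ultimately have "d a v - d a u \<le> (F x + \<eta>) * (x - u) + (F x + \<eta>) * (v - x)"
      using sym[of u x] uv by simp
    also have "\<dots> = (v - u) * (F x + \<eta>)" by (simp add: algebra_simps)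
    finally show ?thesis using K uv by simp
  qed
  have "d a b - d a a = (\<Sum>(x,K)\<in>p. d a (Sup K) - d a (Inf K))"
    using additive_tagged_division_1[OF ab p(1), of "d a"] by simp
  also have "\<dots> \<le> (\<Sum>(x,K)\<in>p. measure lborel K * (F x + \<eta>))"
    by (rule sum_mono) (use step in auto)
  also have "\<dots> = (\<Sum>(x,K)\<in>p. measure lborel K *\<^sub>R F x) + \<eta> * (\<Sum>(x,K)\<in>p. measure lborel K)"
    by (simp add: split_def distrib_left sum.distrib sum_distrib_left mult.commute)
  also have "(\<Sum>(x,K)\<in>p. measure lborel K) = b - a"
    using additive_content_tagged_division[of p a b] p(1) ab by simp
  also have "(\<Sum>(x,K)\<in>p. measure lborel K *\<^sub>R F x) \<le> integral {a..b} F + \<eta>"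
    using G(2)[OF p(1) fine(1)] by (simp add: abs_less_iff)
  finally have "d a b \<le> integral {a..b} F + \<eta> + \<eta> * (b - a)" by (simp add: refl)
  then show "d a b \<le> integral {a..b} F + \<eta>0" using \<eta>(2) by (simp add: algebra_simps)
qed

lemma difference_quotient_tendsto:
  assumes "(f has_vector_derivative v) (at s within S)"
  shows "((\<lambda>r. (1 / (r - s)) *\<^sub>R (f r - f s)) \<longlongrightarrow> v) (at s within S)"
proof (rule Lim_null[THEN iffD2], rule tendsto_norm_zero_cancel, rule Lim_transform_eventually)
  have "((\<lambda>r. (1 / norm (r - s)) *\<^sub>R (f r - (f s + (r - s) *\<^sub>R v))) \<longlongrightarrow> 0) (at s within S)"
    using assms unfolding has_vector_derivative_def has_derivative_within by blast
  then show "((\<lambda>r. norm ((1 / norm (r - s)) *\<^sub>R (f r - (f s + (r - s) *\<^sub>R v)))) \<longlongrightarrow> 0) (at s within S)"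
    by (rule tendsto_norm_zero)
  have eq: "norm ((1 / norm (r - s)) *\<^sub>R (f r - (f s + (r - s) *\<^sub>R v))) = norm ((1 / (r - s)) *\<^sub>R (f r - f s) - v)"
    if "r \<noteq> s" for r
  proof -
    have "(1 / (r - s)) *\<^sub>R (f r - f s) - v = (1 / (r - s)) *\<^sub>R (f r - (f s + (r - s) *\<^sub>R v))"
      using that by (simp add: scaleR_diff_right scaleR_add_right)
    then show ?thesis by simp
  qed
  then show "eventually (\<lambda>r. norm ((1 / norm (r - s)) *\<^sub>R (f r - (f s + (r - s) *\<^sub>R v)))
      = norm ((1 / (r - s)) *\<^sub>R (f r - f s) - v)) (at s within S)"
    by (simp add: eventually_at_filter)
qed

text \<open>
  That the null distance is a finite metric is part of having a metric completion. Thus upper bounds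
  on single causal curves can be combined by the triangle inequality, without concatenating curves.
\<close>

locale cosmological_null_metric = cosmological_spacetime A g \<theta> \<tau>
  for A :: "('a::{t2_space, second_countable_topology}, 'e::euclidean_space) chart set"
    and g :: "('a, 'e) metric_tensor"
    and \<theta> :: "'a \<Rightarrow> ('a, 'e) tangent"
    and \<tau> :: "'a \<Rightarrow> real" +
  fixes D :: "'a \<Rightarrow> 'a \<Rightarrow> real"
  assumes null_dist_eq: "ennreal (D p q) = null_dist A g \<theta> \<tau> p q"
    and D_refl: "D p p = 0"
    and D_sym: "D p q = D q p"
    and D_triangle: "D p r \<le> D p q + D q r"
begin

lemma D_le_tau_difference:
  assumes "future_causal_from_to A g \<theta> a b \<gamma> p q"
  shows "D p q \<le> \<bar>\<tau> q - \<tau> p\<bar>"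
proof (cases "p = q")
  case True
  then show ?thesis by (simp add: D_refl)
next
  case False
  define s where "s i = (if i = 0 then a else b)" for i :: nat
  have fc: "a < b" "future_causal_curve A g \<theta> {a..b} \<gamma>" "\<gamma> a = p" "\<gamma> b = q"
    using assms by (auto simp: future_causal_from_to_def)
  then have "piecewise_causal A g \<theta> 1 s \<gamma>"
    by (simp add: piecewise_causal_def partition_points_def s_def future_causal_curve_def smooth_curve_def)
  moreover have "null_length \<tau> 1 s \<gamma> = \<bar>\<tau> q - \<tau> p\<bar>" using fc by (simp add: null_length_def s_def)
  ultimately have "null_dist A g \<theta> \<tau> p q \<le> ennreal \<bar>\<tau> q - \<tau> p\<bar>"
    using False fc unfolding null_dist_def
    by (auto intro!: Inf_lower exI[of _ 1] exI[of _ s] exI[of _ \<gamma>] simp: s_def)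
  then have "ennreal (D p q) \<le> ennreal \<bar>\<tau> q - \<tau> p\<bar>" by (simp add: null_dist_eq)
  then show ?thesis by (simp add: ennreal_le_iff)
qed

text \<open>
  Let \<open>v\<close> be tangent to the level set of \<open>\<tau>\<close> at \<open>x\<close> and let \<open>u\<close> be an almost minimal direction. Since
  \<open>v\<close> is almost orthogonal to \<open>u\<close>, both \<open>v/2 + k u\<close> and \<open>- v/2 + k u\<close> are future timelike once \<open>k\<close>
  exceeds the norm of \<open>v\<close>. A point of the level set displaced from \<open>x\<close> by approximately \<open>\<delta> v\<close> is
  thus reached by going up from \<open>x\<close> to \<open>z = x + \<delta> (v/2 + k u)\<close> and down again. Either leg changes
  \<open>\<tau>\<close> by about \<open>\<delta> k d\<tau>(u) \<le> 11/10 \<delta> k\<close>.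
\<close>

lemma zigzag_bound:
  assumes c: "c \<in> A" and x: "x \<in> snd c ` fst c" and v: "dtau c x v = 0" and \<eta>: "0 < \<eta>"
  shows "0 \<le> metric_coords c x v v"
    and "\<exists>e>0. \<forall>\<delta> v'. 0 < \<delta> \<longrightarrow> \<delta> < e \<longrightarrow> norm (v' - v) < e \<longrightarrow>
      \<tau> (chart_inv c (x + \<delta> *\<^sub>R v')) = \<tau> (chart_inv c x) \<longrightarrow>
      D (chart_inv c x) (chart_inv c (x + \<delta> *\<^sub>R v')) \<le> \<delta> * (3 * sqrt (metric_coords c x v v) + \<eta>)"
proof -
  let ?G = "metric_coords c x" and ?T = "orient_coords c x"
  have lf: "lorentz_form ?G" using metric_coords_lorentz[OF c x] .
  have bl: "bilinear ?G" and sym: "\<And>u w. ?G u w = ?G w u" using lorentz_formD[OF lf] by auto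
  have TT: "?G ?T ?T < 0" using orient_coords_timelike[OF c x] .
  obtain u where u: "future_timelike_vec c x u" "?G u u = -1" "dtau c x u \<le> 11/10"
    using almost_minimal_direction[OF c x] by blast
  have uT: "?G u ?T < 0" using u(1) by (simp add: future_timelike_vec_def)
  have dom: "sqrt (- ?G w w) \<le> dtau c x w" if "?G w w < 0" "?G w ?T < 0" for w
    using dtau_timelike_ge[OF c x, of w] that by (simp add: future_timelike_vec_def)
  have near: "\<bar>?G u v\<bar> \<le> sqrt (?G v v) / 2"
    by (rule lorentz_near_minimal(2)[OF lf TT linear_dtau[OF c x] dom u(2) uT u(3) v])
  define h where "h = sqrt (?G v v)"
  show h0: "0 \<le> ?G v v"
    by (rule lorentz_near_minimal(1)[OF lf TT linear_dtau[OF c x] dom u(2) uT u(3) v])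
  have h: "0 \<le> h" "?G v v = h * h" "\<bar>?G u v\<bar> \<le> h / 2" unfolding h_def using near h0 by simp_all
  define k where "k = h + \<eta> / 10"
  have k: "0 < k" "h < k" using h(1) \<eta> by (auto simp: k_def)
  have ft: "future_timelike_vec c x (\<sigma> *\<^sub>R v + k *\<^sub>R u)" if \<sigma>: "\<sigma> = 1/2 \<or> \<sigma> = -(1/2)" for \<sigma>
  proof -
    have \<sigma>2: "\<sigma>\<^sup>2 = 1/4" using \<sigma> by (elim disjE; hypsubst; simp add: power2_eq_square)
    have \<sigma>1: "\<sigma> * ?G u v \<le> h / 4" "\<sigma> * ?G v u \<le> h / 4"
      using \<sigma> h(3) sym[of u v] by (elim disjE; hypsubst; simp add: abs_le_iff)+
    let ?w = "\<sigma> *\<^sub>R v + k *\<^sub>R u"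
    have "?G ?w ?w = \<sigma>\<^sup>2 * ?G v v + 2 * (\<sigma> * k) * ?G v u + k\<^sup>2 * ?G u u"
      by (rule lorentz_form_combination[OF lf])
    also have "\<dots> = (h * h) / 4 + 2 * k * (\<sigma> * ?G v u) - k * k"
      using \<sigma>2 h(2) u(2) by (simp add: power2_eq_square)
    also have "\<dots> \<le> (h * h) / 4 + 2 * k * (h / 4) - k * k"
      using \<sigma>1 k(1) by (intro add_mono diff_mono mult_left_mono) auto
    also have "\<dots> < 0"
    proof -
      have "h * h \<le> k * k" "h * k \<le> k * k" "0 < k * k" using h(1) k by (auto intro: mult_mono)
      moreover have "2 * k * (h / 4) = (h * k) / 2" by simp
      ultimately show ?thesis by linarith
    qed
    finally have ww: "?G ?w ?w < 0" .
    have "?G u ?w = \<sigma> * ?G u v - k" using u(2) by (simp add: bilinear_radd[OF bl] bilinear_rmul[OF bl])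
    also have "\<dots> < 0" using \<sigma>1(1) k h(1) by simp
    finally have "?G ?w ?T < 0"
      using lorentz_same_cone[OF lf TT _ uT ww] u(2) by simp
    then show ?thesis using ww by (simp add: future_timelike_vec_def)
  qed
  define w1 where "w1 = (1/2) *\<^sub>R v + k *\<^sub>R u"
  define w2 where "w2 = (- (1/2)) *\<^sub>R v + k *\<^sub>R u"
  have w: "future_timelike_vec c x w1" "future_timelike_vec c x w2"
    using ft[of "1/2"] ft[of "- (1/2)"] by (auto simp: w1_def w2_def)
  obtain e1 where e1: "0 < e1" "\<And>y w'. norm (y - x) < e1 \<Longrightarrow> norm (w' - w1) < e1 \<Longrightarrow>
      y \<in> snd c ` fst c \<and> future_timelike_vec c y w'" using future_timelike_open[OF c x w(1)] by blast
  obtain e2 where e2: "0 < e2" "\<And>y w'. norm (y - x) < e2 \<Longrightarrow> norm (w' - w2) < e2 \<Longrightarrow>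
      y \<in> snd c ` fst c \<and> future_timelike_vec c y w'" using future_timelike_open[OF c x w(2)] by blast
  have dw1: "dtau c x w1 = k * dtau c x u"
    using linear_dtau[OF c x] v by (simp add: w1_def linear_add linear_scale)
  have du: "0 < dtau c x u" by (rule dtau_causal_pos[OF c x future_timelike_imp_causal[OF u(1)]])
  let ?f = "\<lambda>r. \<tau> (chart_inv c (x + r *\<^sub>R w1))"
  have lim: "((\<lambda>r. (?f r - ?f 0) / r) \<longlongrightarrow> dtau c x w1) (at_right 0)"
    using tau_along_line[OF c x, of w1] unfolding DERIV_def by (simp add: filterlim_at_split)
  have "eventually (\<lambda>r. dist ((?f r - ?f 0) / r) (dtau c x w1) < \<eta> / 10) (at_right 0)"
    by (rule tendstoD[OF lim]) (use \<eta> in simp)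
  then obtain e3 where e3: "0 < e3"
      "\<And>r. 0 < r \<Longrightarrow> r < e3 \<Longrightarrow> dist ((?f r - ?f 0) / r) (dtau c x w1) < \<eta> / 10"
    unfolding eventually_at_right_field by auto
  define B where "B = norm w1 + norm w2 + norm v + 2"
  have B: "0 < B" by (simp add: B_def add_nonneg_pos)
  define e where "e = min (min 1 (min e2 e3)) (min (e1 / B) (e2 / B))"
  have e: "0 < e" "e \<le> 1" "e \<le> e2" "e \<le> e3" "e \<le> e1 / B" "e \<le> e2 / B"
    using e1(1) e2(1) e3(1) B by (auto simp: e_def)
  show "\<exists>e>0. \<forall>\<delta> v'. 0 < \<delta> \<longrightarrow> \<delta> < e \<longrightarrow> norm (v' - v) < e \<longrightarrow>
      \<tau> (chart_inv c (x + \<delta> *\<^sub>R v')) = \<tau> (chart_inv c x) \<longrightarrow>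
      D (chart_inv c x) (chart_inv c (x + \<delta> *\<^sub>R v')) \<le> \<delta> * (3 * sqrt (?G v v) + \<eta>)"
  proof (intro exI[of _ e] conjI allI impI e(1))
    fix \<delta> v' assume \<delta>: "0 < \<delta>" "\<delta> < e" and v': "norm (v' - v) < e"
      and same: "\<tau> (chart_inv c (x + \<delta> *\<^sub>R v')) = \<tau> (chart_inv c x)"
    have "\<delta> < e1 / B" "\<delta> < e2 / B" using \<delta>(2) e by auto
    then have \<delta>B: "\<delta> * B < e1" "\<delta> * B < e2" using B by (auto simp: pos_less_divide_eq)
    let ?z = "x + \<delta> *\<^sub>R w1" and ?y = "x + \<delta> *\<^sub>R v'"
    have seg1: "x + r *\<^sub>R w1 \<in> snd c ` fst c \<and> future_causal_vec c (x + r *\<^sub>R w1) w1"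
      if r: "0 \<le> r" "r \<le> \<delta>" for r
    proof -
      have "norm (r *\<^sub>R w1) \<le> \<delta> * B"
        using r \<delta>(1) by (auto simp: B_def intro!: mult_mono)
      then show ?thesis using e1(2)[of "x + r *\<^sub>R w1" w1] e1(1) \<delta>B future_timelike_imp_causal by auto
    qed
    \<comment> \<open>The direction of the second leg, from the displaced point to the common future point.\<close>
    define w' where "w' = w1 - v'"
    have w'2: "norm (w' - w2) < e"
    proof -
      have "w' - w2 = v - v'"
      proof -
        have "w' - w2 = ((1/2) *\<^sub>R v + (1/2) *\<^sub>R v) - v'"
          unfolding w'_def w1_def w2_def by simp
        also have "(1/2) *\<^sub>R v + (1/2) *\<^sub>R v = v" by (simp flip: scaleR_add_left)
        finally show ?thesis .
      qed
      then show ?thesis using v' by (simp add: norm_minus_commute)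
    qed
    have nv': "norm v' \<le> norm v + 1" using norm_triangle_ineq[of "v' - v" v] v' e(2) by simp
    have nw': "norm w' \<le> norm w2 + 1" using norm_triangle_ineq[of "w' - w2" w2] w'2 e(2) by simp
    have seg2: "?y + r *\<^sub>R w' \<in> snd c ` fst c \<and> future_causal_vec c (?y + r *\<^sub>R w') w'"
      if r: "0 \<le> r" "r \<le> \<delta>" for r
    proof -
      have "norm (\<delta> *\<^sub>R v' + r *\<^sub>R w') \<le> \<delta> * norm v' + r * norm w'"
        using norm_triangle_ineq[of "\<delta> *\<^sub>R v'" "r *\<^sub>R w'"] r \<delta>(1) by simp
      also have "\<dots> \<le> \<delta> * (norm v + 1) + \<delta> * (norm w2 + 1)"
        using r \<delta>(1) nv' nw' by (intro add_mono mult_mono) auto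
      also have "\<dots> = \<delta> * (norm v + norm w2 + 2)" by (simp add: algebra_simps)
      also have "\<dots> \<le> \<delta> * B" using \<delta>(1) by (intro mult_left_mono) (auto simp: B_def)
      also have "\<dots> < e2" by (rule \<delta>B(2))
      finally have "norm (?y + r *\<^sub>R w' - x) < e2" by (simp add: algebra_simps)
      then show ?thesis using e2(2)[of "?y + r *\<^sub>R w'" w'] w'2 e(3) future_timelike_imp_causal by auto
    qed
    have yz: "?y + \<delta> *\<^sub>R w' = ?z" by (simp add: w'_def algebra_simps)
    have D1: "D (chart_inv c x) (chart_inv c ?z) \<le> \<bar>?f \<delta> - ?f 0\<bar>"
      using D_le_tau_difference[OF future_causal_segment[OF c \<delta>(1) seg1]] by simp
    have D2: "D (chart_inv c ?y) (chart_inv c ?z) \<le> \<bar>?f \<delta> - ?f 0\<bar>"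
      using D_le_tau_difference[OF future_causal_segment[OF c \<delta>(1) seg2]] same unfolding yz by simp
    have "\<delta> < e3" using \<delta>(2) e(4) by simp
    then have "\<bar>(?f \<delta> - ?f 0) / \<delta> - dtau c x w1\<bar> < \<eta> / 10"
      using e3(2)[OF \<delta>(1)] unfolding dist_real_def by blast
    moreover have "0 < dtau c x w1" unfolding dw1 using k(1) du by (rule mult_pos_pos)
    ultimately have "\<bar>(?f \<delta> - ?f 0) / \<delta>\<bar> \<le> dtau c x w1 + \<eta> / 10" by linarith
    also have "\<dots> \<le> k * (11/10) + \<eta> / 10"
      unfolding dw1 using u(3) k(1) by (intro add_right_mono mult_left_mono) auto
    finally have q: "\<bar>?f \<delta> - ?f 0\<bar> \<le> \<delta> * (k * (11/10) + \<eta> / 10)"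
      using \<delta>(1) by (simp add: abs_divide pos_divide_le_eq mult.commute)
    have "D (chart_inv c x) (chart_inv c ?y) \<le> D (chart_inv c x) (chart_inv c ?z) + D (chart_inv c ?y) (chart_inv c ?z)"
      using D_triangle[of "chart_inv c x" "chart_inv c ?y" "chart_inv c ?z"] D_sym[of "chart_inv c ?y"] by simp
    also have "\<dots> \<le> \<delta> * (2 * (k * (11/10) + \<eta> / 10))" using D1 D2 q by (simp add: algebra_simps)
    also have "\<dots> \<le> \<delta> * (3 * h + \<eta>)"
    proof -
      have "2 * (k * (11/10) + \<eta> / 10) = h * (11/5) + \<eta> * (21/50)" by (simp add: k_def field_simps)
      also have "\<dots> \<le> 3 * h + \<eta>" using h(1) \<eta> by simp
      finally show ?thesis using \<delta>(1) by (intro mult_left_mono) auto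
    qed
    finally show "D (chart_inv c x) (chart_inv c ?y) \<le> \<delta> * (3 * sqrt (?G v v) + \<eta>)"
      by (simp add: h_def)
  qed
qed

text \<open>
  The zigzag bound applies on both sides of each point of the curve, with \<open>v\<close> and \<open>- v\<close>.
\<close>

lemma D_le_level_curve_length:
  assumes ab: "a < b" and \<sigma>: "smooth_curve A {a..b} \<sigma>" and level: "\<And>s. s \<in> {a..b} \<Longrightarrow> \<tau> (\<sigma> s) = t"
  shows "D (\<sigma> a) (\<sigma> b) \<le> 3 * integral {a..b} (\<lambda>r. sqrt (g (\<sigma> r) (velocity A {a..b} \<sigma> r) (velocity A {a..b} \<sigma> r)))"
proof -
  have th: "thick {a..b}" using ab by (rule thick_interval)
  define F where "F r = sqrt (g (\<sigma> r) (velocity A {a..b} \<sigma> r) (velocity A {a..b} \<sigma> r))" for r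
  have "F integrable_on {a..b}"
    unfolding F_def using continuous_on_speed_square[OF \<sigma> th]
    by (intro integrable_continuous_interval continuous_intros)
  then have int: "(\<lambda>r. 3 * F r) integrable_on {a..b}" by (rule integrable_on_mult_right)
  have "D (\<sigma> a) (\<sigma> b) \<le> integral {a..b} (\<lambda>r. 3 * F r)"
  proof (rule metric_le_integral_of_local_bound[where d = "\<lambda>s r. D (\<sigma> s) (\<sigma> r)"])
    fix s \<eta> :: real assume s: "s \<in> {a..b}" and \<eta>: "0 < \<eta>"
    obtain c where c: "c \<in> A" "\<sigma> s \<in> fst c" using chart_at_exists by blast
    note * = \<sigma> th c(1) s c(2)
    define x where "x = snd c (\<sigma> s)"
    define v where "v = velocity A {a..b} \<sigma> s c"
    have x: "x \<in> snd c ` fst c" using c(2) by (simp add: x_def)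
    have cx: "chart_inv c x = \<sigma> s" using chart_inv_chart[OF c] by (simp add: x_def)
    have "((\<lambda>r. \<tau> (\<sigma> r)) has_vector_derivative dtau c x v) (at s within {a..b})"
      using tau_curve_has_derivative[OF c(1) \<sigma> th s c(2)] by (simp add: x_def v_def)
    moreover have "((\<lambda>r. \<tau> (\<sigma> r)) has_vector_derivative 0) (at s within {a..b})"
      by (rule has_vector_derivative_transform[OF s, of _ "\<lambda>_. t"]) (use level in auto)
    ultimately have v0: "dtau c x v = 0"
      using vector_derivative_thick[OF th s] by metis
    have v0': "dtau c x (- v) = 0" using v0 linear_dtau[OF c(1) x] by (simp add: linear_neg)
    have b: "bilinear (metric_coords c x)" using lorentz_formD(1)[OF metric_coords_lorentz[OF c(1) x]] .
    have Gm: "metric_coords c x (- v) (- v) = metric_coords c x v v"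
      by (simp add: bilinear_lneg[OF b] bilinear_rneg[OF b])
    have Fs: "F s = sqrt (metric_coords c x v v)"
      using metric_velocity[OF c(1) \<sigma> th s c(2)] by (simp add: F_def x_def v_def)
    obtain e1 where e1: "0 < e1" "\<And>\<delta> v'. 0 < \<delta> \<Longrightarrow> \<delta> < e1 \<Longrightarrow> norm (v' - v) < e1 \<Longrightarrow>
      \<tau> (chart_inv c (x + \<delta> *\<^sub>R v')) = \<tau> (chart_inv c x) \<Longrightarrow>
      D (chart_inv c x) (chart_inv c (x + \<delta> *\<^sub>R v')) \<le> \<delta> * (3 * F s + \<eta>)"
      using zigzag_bound(2)[OF c(1) x v0 \<eta>] unfolding Fs by metis
    obtain e2 where e2: "0 < e2" "\<And>\<delta> v'. 0 < \<delta> \<Longrightarrow> \<delta> < e2 \<Longrightarrow> norm (v' - (- v)) < e2 \<Longrightarrow>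
      \<tau> (chart_inv c (x + \<delta> *\<^sub>R v')) = \<tau> (chart_inv c x) \<Longrightarrow>
      D (chart_inv c x) (chart_inv c (x + \<delta> *\<^sub>R v')) \<le> \<delta> * (3 * F s + \<eta>)"
      using zigzag_bound(2)[OF c(1) x v0' \<eta>] unfolding Fs Gm by metis
    have "((\<lambda>r. (1 / (r - s)) *\<^sub>R (snd c (\<sigma> r) - x)) \<longlongrightarrow> v) (at s within {a..b})"
      using difference_quotient_tendsto[OF chart_curve_has_vector_derivative[OF *]] by (simp add: x_def v_def)
    then have "eventually (\<lambda>r. norm ((1 / (r - s)) *\<^sub>R (snd c (\<sigma> r) - x) - v) < min e1 e2) (at s within {a..b})"
      using tendstoD[of _ v _ "min e1 e2"] e1(1) e2(1) by (simp add: dist_norm)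
    then have "eventually (\<lambda>r. norm ((1 / (r - s)) *\<^sub>R (snd c (\<sigma> r) - x) - v) < min e1 e2 \<and> \<sigma> r \<in> fst c) (at s within {a..b})"
      using eventually_in_chart[OF *] by (rule eventually_conj)
    then obtain d where d: "0 < d" "\<And>r. r \<in> {a..b} \<Longrightarrow> r \<noteq> s \<Longrightarrow> dist r s < d \<Longrightarrow>
        norm ((1 / (r - s)) *\<^sub>R (snd c (\<sigma> r) - x) - v) < min e1 e2 \<and> \<sigma> r \<in> fst c"
      unfolding eventually_at by blast
    show "\<exists>e>0. \<forall>r\<in>{a..b}. \<bar>r - s\<bar> < e \<longrightarrow> D (\<sigma> s) (\<sigma> r) \<le> (3 * F s + \<eta>) * \<bar>r - s\<bar>"
    proof (intro exI[of _ "min d (min e1 e2)"] conjI ballI impI)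
      show "0 < min d (min e1 e2)" using d(1) e1(1) e2(1) by simp
      fix r assume r: "r \<in> {a..b}" "\<bar>r - s\<bar> < min d (min e1 e2)"
      have lev: "\<tau> (\<sigma> r) = \<tau> (\<sigma> s)" using level r(1) s by simp
      consider "r = s" | "s < r" | "r < s" by linarith
      then show "D (\<sigma> s) (\<sigma> r) \<le> (3 * F s + \<eta>) * \<bar>r - s\<bar>"
      proof cases
        case 1 then show ?thesis by (simp add: D_refl)
      next
        case 2
        let ?v = "(1 / (r - s)) *\<^sub>R (snd c (\<sigma> r) - x)"
        have n: "norm (?v - v) < e1" "\<sigma> r \<in> fst c" using d(2)[OF r(1)] r(2) 2 by (auto simp: dist_real_def)
        have y: "chart_inv c (x + (r - s) *\<^sub>R ?v) = \<sigma> r" using 2 chart_inv_chart[OF c(1) n(2)] by simp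
        show ?thesis using e1(2)[of "r - s" ?v] n 2 r(2) lev unfolding y cx by (simp add: mult.commute)
      next
        case 3
        let ?v = "(1 / (s - r)) *\<^sub>R (snd c (\<sigma> r) - x)"
        have m: "?v = - ((1 / (r - s)) *\<^sub>R (snd c (\<sigma> r) - x))"
          using 3 by (simp add: scaleR_minus_left[symmetric] minus_divide_right del: scaleR_minus_left)
        have n0: "norm ((1 / (r - s)) *\<^sub>R (snd c (\<sigma> r) - x) - v) < e2" "\<sigma> r \<in> fst c"
          using d(2)[OF r(1)] r(2) 3 by (auto simp: dist_real_def)
        have n: "norm (?v - (- v)) < e2"
          using n0(1) norm_minus_cancel[of "(1 / (r - s)) *\<^sub>R (snd c (\<sigma> r) - x) - v"] unfolding m by simp
        have y: "chart_inv c (x + (s - r) *\<^sub>R ?v) = \<sigma> r" using 3 chart_inv_chart[OF c(1) n0(2)] by simp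
        show ?thesis using e2(2)[of "s - r" ?v] n 3 r(2) lev unfolding y cx by (simp add: mult.commute)
      qed
    qed
  next
    show "D (\<sigma> s) (\<sigma> r) = D (\<sigma> r) (\<sigma> s)" "D (\<sigma> s) (\<sigma> q) \<le> D (\<sigma> s) (\<sigma> r) + D (\<sigma> r) (\<sigma> q)" for s r q
      by (rule D_sym, rule D_triangle)
  qed (use ab int D_refl in auto)
  then show ?thesis by (simp add: F_def[abs_def])
qed

lemma D_le_induced_length:
  assumes "piecewise_smooth_in A {p. \<tau> p = t} N s \<sigma>"
  shows "D (\<sigma> (s 0)) (\<sigma> (s N)) \<le> 3 * induced_length A g N s \<sigma>"
proof -
  have pp: "\<And>i. i < N \<Longrightarrow> s i < s (Suc i)" and img: "\<sigma> ` {s 0..s N} \<subseteq> {p. \<tau> p = t}"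
    and sm: "\<And>i. i < N \<Longrightarrow> smooth_curve A {s i..s (Suc i)} \<sigma>"
    using assms by (auto simp: piecewise_smooth_in_def partition_points_def)
  have mono: "s i \<le> s j" if "i \<le> j" "j \<le> N" for i j
    using that
  proof (induction j rule: dec_induct)
    case (step n)
    then show ?case using pp[of n] by simp
  qed simp
  have "D (\<sigma> (s 0)) (\<sigma> (s n)) \<le> 3 * induced_length A g n s \<sigma>" if "n \<le> N" for n
    using that
  proof (induction n)
    case 0
    then show ?case by (simp add: induced_length_def D_refl)
  next
    case (Suc n)
    have "{s n..s (Suc n)} \<subseteq> {s 0..s N}" using mono[of 0 n] mono[of "Suc n" N] Suc.prems by auto
    then have "\<tau> (\<sigma> r) = t" if "r \<in> {s n..s (Suc n)}" for r using img that by blast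
    then have "D (\<sigma> (s n)) (\<sigma> (s (Suc n))) \<le> 3 * integral {s n..s (Suc n)}
        (\<lambda>r. sqrt (g (\<sigma> r) (velocity A {s n..s (Suc n)} \<sigma> r) (velocity A {s n..s (Suc n)} \<sigma> r)))"
      using pp[of n] sm[of n] Suc.prems by (intro D_le_level_curve_length[of _ _ _ t]) auto
    then show ?case
      using Suc.IH Suc.prems D_triangle[of "\<sigma> (s 0)" "\<sigma> (s (Suc n))" "\<sigma> (s n)"]
      by (simp add: induced_length_def)
  qed
  then show ?thesis by simp
qed

text \<open>
  An almost maximal curve ending at \<open>q\<close> starts at a point with \<open>\<tau> < t\<close>, hence crosses the level \<open>t\<close>.
\<close>

lemma descend_to_level:
  assumes "0 < t" "t \<le> \<tau> q"
  obtains q' where "\<tau> q' = t" "D q' q \<le> \<tau> q - t"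
proof (cases "t = \<tau> q")
  case True
  then show ?thesis using that[of q] by (simp add: D_refl)
next
  case False
  then have tq: "t < \<tau> q" using assms(2) by simp
  obtain a b \<gamma> p where \<gamma>: "future_causal_from_to A g \<theta> a b \<gamma> p q"
    "\<tau> q - t < lorentzian_length A g {a..b} \<gamma>"
    using almost_maximal_curve[OF assms(1)] by metis
  have "\<tau> p < t" using \<gamma>(2) length_le_tau_increase[OF \<gamma>(1)] by simp
  have ab: "a < b" and sc: "smooth_curve A {a..b} \<gamma>" and \<gamma>ab: "\<gamma> a = p" "\<gamma> b = q"
    using \<gamma>(1) by (auto simp: future_causal_from_to_def future_causal_curve_def)
  have "continuous_on {a..b} (\<lambda>s. \<tau> (\<gamma> s))"
    unfolding continuous_on_eq_continuous_within
  proof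
    fix s assume s: "s \<in> {a..b}"
    obtain c where c: "c \<in> A" "\<gamma> s \<in> fst c" using chart_at_exists by blast
    show "continuous (at s within {a..b}) (\<lambda>s. \<tau> (\<gamma> s))"
      by (rule has_vector_derivative_continuous[OF tau_curve_has_derivative[OF c(1) sc thick_interval[OF ab] s c(2)]])
  qed
  then obtain r where r: "a \<le> r" "r \<le> b" "\<tau> (\<gamma> r) = t"
    using IVT'[of "\<lambda>s. \<tau> (\<gamma> s)" a t b] \<open>\<tau> p < t\<close> tq \<gamma>ab ab by auto
  have "r \<noteq> b" using r(3) tq \<gamma>ab by auto
  then have "D (\<gamma> r) q \<le> \<bar>\<tau> q - \<tau> (\<gamma> r)\<bar>"
    using D_le_tau_difference[OF future_causal_subcurve(1)[OF \<gamma>(1) r(1), of b]] r \<gamma>ab by simp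
  then show ?thesis using that[of "\<gamma> r"] r(3) tq by simp
qed

text \<open>
  From the point with the larger value of \<open>\<tau>\<close> one descends to the level of the other point and then
  uses the small diameter of that level.
\<close>

lemma D_small_for_small_tau:
  assumes diam: "((\<lambda>t. diam (induced_dist A g {p. \<tau> p = t}) {p. \<tau> p = t}) \<longlongrightarrow> 0) (at_right (0::real))"
    and \<epsilon>: "0 < \<epsilon>"
  obtains \<delta> where "0 < \<delta>" "\<And>p q. \<tau> p < \<delta> \<Longrightarrow> \<tau> q < \<delta> \<Longrightarrow> D p q < \<epsilon>"
proof -
  have "eventually (\<lambda>t. diam (induced_dist A g {p. \<tau> p = t}) {p. \<tau> p = t} < ennreal (\<epsilon> / 6)) (at_right 0)"
    by (rule order_tendstoD(2)[OF diam]) (use \<epsilon> in simp)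
  then obtain d where d: "0 < d" "\<And>t. 0 < t \<Longrightarrow> t < d \<Longrightarrow>
      diam (induced_dist A g {p. \<tau> p = t}) {p. \<tau> p = t} < ennreal (\<epsilon> / 6)"
    unfolding eventually_at_right_field by auto
  have level: "D p q \<le> \<epsilon> / 2" if "\<tau> p < d" "\<tau> p = \<tau> q" for p q
  proof -
    let ?S = "{x. \<tau> x = \<tau> p}"
    have "induced_dist A g ?S p q \<le> (SUP y\<in>?S. induced_dist A g ?S p y)"
      by (rule SUP_upper) (use that in simp)
    also have "\<dots> \<le> diam (induced_dist A g ?S) ?S"
      unfolding diam_def by (rule SUP_upper) simp
    also have "\<dots> < ennreal (\<epsilon> / 6)" using d(2)[OF tau_pos that(1)] .
    finally obtain N s \<sigma> where \<sigma>: "ennreal (induced_length A g N s \<sigma>) < ennreal (\<epsilon> / 6)"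
      "piecewise_smooth_in A ?S N s \<sigma>" "\<sigma> (s 0) = p" "\<sigma> (s N) = q"
      unfolding induced_dist_def Inf_less_iff by blast
    have "induced_length A g N s \<sigma> < \<epsilon> / 6"
      using \<sigma>(1) ennreal_leI[of "\<epsilon> / 6" "induced_length A g N s \<sigma>"] by (meson not_less)
    then show ?thesis using D_le_induced_length[OF \<sigma>(2)] \<sigma>(3,4) by simp
  qed
  define \<delta> where "\<delta> = min d (\<epsilon> / 2)"
  have close: "D p q < \<epsilon>" if lt: "\<tau> p < \<delta>" "\<tau> q < \<delta>" and le: "\<tau> p \<le> \<tau> q" for p q
  proof -
    obtain q' where q': "\<tau> q' = \<tau> p" "D q' q \<le> \<tau> q - \<tau> p"
      using descend_to_level[OF tau_pos le] by metis
    have "D p q \<le> D p q' + D q' q" by (rule D_triangle)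
    also have "D p q' \<le> \<epsilon> / 2" by (rule level) (use lt(1) q'(1) in \<open>simp_all add: \<delta>_def\<close>)
    also have "D q' q < \<epsilon> / 2" using q'(2) lt(2) tau_pos[of p] by (simp add: \<delta>_def)
    finally show ?thesis by simp
  qed
  show thesis
  proof (rule that[of \<delta>])
    show "0 < \<delta>" using d(1) \<epsilon> by (simp add: \<delta>_def)
    show "D p q < \<epsilon>" if "\<tau> p < \<delta>" "\<tau> q < \<delta>" for p q
      using close[of p q] close[of q p] that D_sym[of p q] by (cases "\<tau> p \<le> \<tau> q") auto
  qed
qed

lemma tau_arbitrarily_small:
  assumes "0 < \<delta>"
  shows "\<exists>p. \<tau> p < \<delta>"
proof -
  obtain q :: 'a where True by blast
  obtain a b \<gamma> p where "future_causal_from_to A g \<theta> a b \<gamma> p q"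
    "\<tau> q - \<delta> < lorentzian_length A g {a..b} \<gamma>"
    using almost_maximal_curve[OF assms] by metis
  then show ?thesis using length_le_tau_increase by (intro exI[of _ p]) fastforce
qed

end

section \<open>The initial level set\<close>

text \<open>
  Points with small \<open>\<tau>\<close> are uniformly close to each other. Hence points whose values of \<open>\<tau>\<close> tend to
  \<open>0\<close> form a Cauchy sequence, and its limit lies on the initial level. By density, any two points of
  the initial level are limits of points of the spacetime, whose values of \<open>\<tau>\<close> tend to \<open>0\<close> by the
  Lipschitz property, so they coincide.
\<close>

theorem theorem1p3:
  fixes A :: "('a::{t2_space, second_countable_topology}, 'e::euclidean_space) chart set"
    and g :: "('a, 'e) metric_tensor"
    and \<theta> :: "'a \<Rightarrow> ('a, 'e) tangent"
    and \<tau> :: "'a \<Rightarrow> real"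
    and Mbar :: "'b set" and dbar :: "'b \<Rightarrow> 'b \<Rightarrow> real" and \<iota> :: "'a \<Rightarrow> 'b"
    and \<tau>bar :: "'b \<Rightarrow> real"
  assumes spacetime: "spacetime A g \<theta>"
    and regular: "regular_cosmological_time A g \<theta>"
    and tau: "\<And>p. cosmological_time A g \<theta> p = ennreal (\<tau> p)"
    and tau_pos: "\<And>p. 0 < \<tau> p"
    and tau_smooth: "smooth_fun A \<tau>"
    and completion: "is_completion (null_dist A g \<theta> \<tau>) Mbar dbar \<iota>"
    and ext: "\<And>p. \<tau>bar (\<iota> p) = \<tau> p"
    and ext_lipschitz: "lipschitz1_on Mbar dbar \<tau>bar"
    and ext_nonneg: "\<And>x. x \<in> Mbar \<Longrightarrow> 0 \<le> \<tau>bar x"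
    and diam_lim:
      "((\<lambda>t. diam (induced_dist A g {p. \<tau> p = t}) {p. \<tau> p = t}) \<longlongrightarrow> 0) (at_right (0::real))"
  shows "\<exists>p\<^sub>B\<^sub>B. {x \<in> Mbar. \<tau>bar x = 0} = {p\<^sub>B\<^sub>B}"
proof -
  interpret M: Metric_space Mbar dbar
    using completion by (simp add: is_completion_def)
  have complete: "M.mcomplete" and \<iota>: "\<And>p. \<iota> p \<in> Mbar"
    and null: "\<And>p q. ennreal (dbar (\<iota> p) (\<iota> q)) = null_dist A g \<theta> \<tau> p q"
    and dense: "M.mtopology closure_of range \<iota> = Mbar"
    using completion by (auto simp: is_completion_def)
  interpret cosmological_null_metric A g \<theta> \<tau> "\<lambda>p q. dbar (\<iota> p) (\<iota> q)"
    by (intro cosmological_null_metric.intro cosmological_spacetime.intro cosmological_spacetime_axioms.intro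
        cosmological_null_metric_axioms.intro spacetime tau tau_pos tau_smooth null M.commute
        M.triangle \<iota> M.mdist_zero)
  note small = D_small_for_small_tau[OF diam_lim]
  have lip: "\<bar>\<tau>bar x - \<tau>bar y\<bar> \<le> dbar x y" if "x \<in> Mbar" "y \<in> Mbar" for x y
    using ext_lipschitz that by (simp add: lipschitz1_on_def)

  have "\<forall>n. \<exists>p. \<tau> p < inverse (real (Suc n))" using tau_arbitrarily_small by simp
  then obtain P where P: "\<And>n. \<tau> (P n) < inverse (real (Suc n))" by metis
  have P_small: "\<exists>N. \<forall>n\<ge>N. \<tau> (P n) < \<delta>" if \<delta>: "0 < \<delta>" for \<delta>
  proof -
    obtain N where N: "inverse (real (Suc N)) < \<delta>" using reals_Archimedean[OF \<delta>] by blast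
    have "\<tau> (P n) < \<delta>" if n: "N \<le> n" for n
    proof -
      have "inverse (real (Suc n)) \<le> inverse (real (Suc N))" using n by (intro le_imp_inverse_le) auto
      then show ?thesis using P[of n] N by linarith
    qed
    then show ?thesis by blast
  qed
  have "M.MCauchy (\<lambda>n. \<iota> (P n))"
    unfolding M.MCauchy_def
  proof (intro conjI allI impI)
    show "range (\<lambda>n. \<iota> (P n)) \<subseteq> Mbar" using \<iota> by blast
    fix \<epsilon> :: real assume "0 < \<epsilon>"
    then obtain \<delta> where \<delta>: "0 < \<delta>" "\<And>p q. \<tau> p < \<delta> \<Longrightarrow> \<tau> q < \<delta> \<Longrightarrow> dbar (\<iota> p) (\<iota> q) < \<epsilon>"
      using small by metis
    show "\<exists>N. \<forall>n n'. N \<le> n \<longrightarrow> N \<le> n' \<longrightarrow> dbar (\<iota> (P n)) (\<iota> (P n')) < \<epsilon>"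
      using P_small[OF \<delta>(1)] \<delta>(2) by blast
  qed
  then obtain x where xl: "limitin M.mtopology (\<lambda>n. \<iota> (P n)) x sequentially"
    using complete unfolding M.mcomplete_def by blast
  then have x: "x \<in> Mbar" by (simp add: M.limitin_metric)
  have lim: "eventually (\<lambda>n. dbar (\<iota> (P n)) x < \<epsilon>) sequentially" if "0 < \<epsilon>" for \<epsilon>
    using xl that by (auto simp: M.limitin_metric elim: eventually_mono)
  have "\<tau>bar x \<le> 0"
  proof (rule field_le_epsilon)
    fix \<epsilon> :: real assume \<epsilon>: "0 < \<epsilon>"
    have "eventually (\<lambda>n. \<tau> (P n) < \<epsilon> / 2) sequentially"
      using P_small[of "\<epsilon> / 2"] \<epsilon> by (simp add: eventually_sequentially)
    moreover have "eventually (\<lambda>n. dbar (\<iota> (P n)) x < \<epsilon> / 2) sequentially" by (rule lim) (use \<epsilon> in simp)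
    ultimately obtain n where n: "\<tau> (P n) < \<epsilon> / 2" "dbar (\<iota> (P n)) x < \<epsilon> / 2"
      using eventually_happens[OF eventually_conj] by fastforce
    then show "\<tau>bar x \<le> 0 + \<epsilon>" using lip[OF \<iota>[of "P n"] x] unfolding ext by linarith
  qed
  then have x0: "\<tau>bar x = 0" using ext_nonneg[OF x] by simp

  have approx: "\<exists>p. dbar y (\<iota> p) < r \<and> \<tau> p < r" if y: "y \<in> Mbar" "\<tau>bar y = 0" and r: "0 < r" for y r
  proof -
    have "y \<in> M.mtopology closure_of range \<iota>" using y(1) dense by simp
    then obtain p where p: "dbar y (\<iota> p) < r" using r unfolding M.metric_closure_of by auto
    moreover have "\<tau> p \<le> dbar y (\<iota> p)" using lip[OF y(1) \<iota>[of p]] by (simp add: ext y(2))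
    ultimately show ?thesis by force
  qed
  have "y = x" if y: "y \<in> Mbar" "\<tau>bar y = 0" for y
  proof -
    have "dbar y x \<le> 0"
    proof (rule field_le_epsilon)
      fix \<epsilon> :: real assume \<epsilon>: "0 < \<epsilon>"
      obtain \<delta> where \<delta>: "0 < \<delta>" "\<And>p q. \<tau> p < \<delta> \<Longrightarrow> \<tau> q < \<delta> \<Longrightarrow> dbar (\<iota> p) (\<iota> q) < \<epsilon> / 3"
        using small[of "\<epsilon> / 3"] \<epsilon> by auto
      define r where "r = min \<delta> (\<epsilon> / 3)"
      have r: "0 < r" using \<delta>(1) \<epsilon> by (simp add: r_def)
      obtain p q where p: "dbar y (\<iota> p) < r" "\<tau> p < r" and q: "dbar x (\<iota> q) < r" "\<tau> q < r"
        using approx[OF y r] approx[OF x x0 r] by blast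
      have "dbar y x \<le> dbar y (\<iota> p) + dbar (\<iota> p) x" using M.triangle[OF y(1) \<iota> x] .
      also have "dbar (\<iota> p) x \<le> dbar (\<iota> p) (\<iota> q) + dbar (\<iota> q) x" using M.triangle[OF \<iota> \<iota> x] .
      also have "dbar (\<iota> p) (\<iota> q) < \<epsilon> / 3" using \<delta>(2) p(2) q(2) by (simp add: r_def)
      finally show "dbar y x \<le> 0 + \<epsilon>" using p(1) q(1) M.commute[of "\<iota> q" x] by (simp add: r_def)
    qed
    then show ?thesis using M.nonneg[of y x] M.zero[OF y(1) x] by simp
  qed
  then have "{x \<in> Mbar. \<tau>bar x = 0} = {x}" using x x0 by blast
  then show ?thesis by blast
qed

end
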